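(* Let $X=(X^+,X^-)$ be a piecewise analytic vector field with switching curve $\Sigma=f^{-1}(0)$. Suppose that $p$ is a $\Sigma$-singular point of $X$ such that $X^+f(p)=X^-f(p)=0$, and that there is a neighborhood $V$ of $p$ in $\Sigma$ such that $X^+f(q)\cdot X^-f(q)>0$ for all $q\in V\setminus\{p\}$. (i) If $X^+(p)\neq 0$ and $X^-(p)\neq 0$, then $p$ is a $\Sigma$-monodromic singular point of $X$ if and only if $p$ is a fold of order $n^+$ of $X^+$ with $(X^+)^{n^+}f(p)<0$ and $p$ is a fold of order $n^-$ of $X^-$ with $(X^-)^{n^-}f(p)>0$ (for some even integers $n^+,n^-$). (ii) If $X^+(p)=0$ and $X^-(p)\neq 0$ (resp. $X^-(p)=0$ and $X^+(p)\neq 0$), then $p$ is a $\Sigma$-monodromic singular point of $X$ if and only if $X^+$ has no characteristic orbit in $\Sigma^+$ associated with $p$ (resp. $X^-$ has no characteristic orbit in $\Sigma^-$ associated with $p$) and $p$ is a fold of order $n$ of $X^-$ with $(X^-)^nf(p)>0$ (resp. a fold of order $n$ of $X^+$ with $(X^+)^nf(p)<0$), for some even integer $n$. (iii) If $X^+(p)=X^-(p)=0$, then $p$ is a $\Sigma$-monodromic singular point of $X$ if and only if $X^+$ has no characteristic orbit in $\Sigma^+$ associated with $p$ and $X^-$ has no characteristic orbit in $\Sigma^-$ associated with $p$.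
   Context: Setting. $f:\mathbb R^2\to\mathbb R$ is an analytic function having $0$ as a regular value, $\Sigma=f^{-1}(0)$, $\Sigma^{\pm}=\{p\in\mathbb R^2:\pm f(p)>0\}$. A piecewise analytic vector field $X=(X^+,X^-)$ is a pair of analytic planar vector fields, with $X=X^+$ where $f\ge 0$ and $X=X^-$ where $f\le 0$ (bi-valued on $\Sigma$). For a vector field $Y$, $Yf=\langle\nabla f,Y\rangle$ and $Y^nf=Y(Y^{n-1}f)$. $\Sigma$-singular points. On $\Sigma$: the sewing arc $SW$ is where $X^+f\cdot X^-f>0$; the escaping arc $ES$ is where $X^+f>0$, $X^-f<0$; the sliding arc $SL$ is where $X^+f<0$, $X^-f>0$. On $ES\cup SL$ the Filippov vector field $F_X(p)$ is the vector tangent to $\Sigma$ in the cone spanned by $X^+(p)$ and $X^-(p)$ (their convex combination tangent to $\Sigma$). A point $p\in\Sigma$ is $\Sigma$-regular if $p\in SW$, or if $p\in SL\cup ES$ and $F_X(p)\neq 0$; otherwise $p$ is a $\Sigma$-singular point. $\Sigma$-characteristic orbits. An isolated $\Sigma$-singular point $p$ has a $\Sigma$-characteristic orbit if one of the following holds: (1) there is a regular trajectory $\gamma$ of $X^+$ (resp. $X^-$) with $p=\gamma(t_0)$ for some $t_0\in\mathbb R$ and $p\in\overline{\gamma\cap\Sigma^+}$ (resp. $p\in\overline{\gamma\cap\Sigma^-}$); (2) there is a regular trajectory $\gamma$ of $X^+$ (resp. $X^-$) with $\lim_{t\to\infty}\gamma(t)=p$ or $\lim_{t\to-\infty}\gamma(t)=p$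 and a neighborhood $V$ of $p$ with $\gamma\cap V\subset V\cap\Sigma^+$ (resp. $\gamma\cap V\subset V\cap\Sigma^-$); (3) for every neighborhood $V$ of $p$ there is $q\in V\cap\Sigma$ with $X^+f(q)\cdot X^-f(q)<0$. An isolated $\Sigma$-singular point without $\Sigma$-characteristic orbits is called a $\Sigma$-monodromic singular point. Folds. A $\Sigma$-singular point $p$ is a fold of order $n$ of $X^+$ (resp. of $X^-$), $n$ even, if, with $Y=X^+$ (resp. $Y=X^-$), $Y(p)\ne0$, $Yf(p)=\dots=Y^{n-1}f(p)=0$ and $Y^nf(p)\neq0$. Characteristic orbits. Let $p$ be an isolated singular point of an analytic vector field $Y$. An orbit $\gamma$ of $Y$ tending to $p$ as $t\to\infty$ (or as $t\to-\infty$) is a characteristic orbit associated with $p$ if $\lim (\gamma(t)-p)/|\gamma(t)-p|$ exists as $t\to\infty$ (resp. $t\to-\infty$). For $K\subset\mathbb R^2$ with $p\in\overline K$, $Y$ has a characteristic orbit in $K$ associated with $p$ if there are a characteristic orbit $\gamma$ associated with $p$ and a neighborhood $V$ of $p$ with $\gamma\cap V\subset V\cap K$; otherwise $Y$ has no characteristic orbit in $K$. *)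

theory Defs
  imports "HOL-Analysis.Analysis"
begin

text \<open>Real analyticity on the whole plane: near every point the function is the sum of a
  double power series. Since \<open>has_sum\<close> is unconditional, the series converges absolutely.\<close>

definition analytic_plane :: "(real^2 \<Rightarrow> 'b::real_normed_vector) \<Rightarrow> bool" where
  "analytic_plane g \<longleftrightarrow>
     (\<forall>p. \<exists>r>0. \<exists>c :: nat \<Rightarrow> nat \<Rightarrow> 'b. \<forall>x\<in>ball p r.
        ((\<lambda>(i, j). ((x $ 1 - p $ 1) ^ i * (x $ 2 - p $ 2) ^ j) *\<^sub>R c i j) has_sum g x) UNIV)"

definition gradient :: "(real^2 \<Rightarrow> real) \<Rightarrow> real^2 \<Rightarrow> real^2" where
  "gradient f p = (\<chi> i. frechet_derivative f (at p) (axis i 1))"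

definition lie :: "(real^2 \<Rightarrow> real^2) \<Rightarrow> (real^2 \<Rightarrow> real) \<Rightarrow> real^2 \<Rightarrow> real" where
  "lie Y f = (\<lambda>p. gradient f p \<bullet> Y p)"

definition regular_value :: "(real^2 \<Rightarrow> real) \<Rightarrow> real \<Rightarrow> bool" where
  "regular_value f c \<longleftrightarrow> (\<forall>p. f p = c \<longrightarrow> gradient f p \<noteq> 0)"

definition switching_curve :: "(real^2 \<Rightarrow> real) \<Rightarrow> (real^2) set" where
  "switching_curve f = f -` {0}"

definition plus_side :: "(real^2 \<Rightarrow> real) \<Rightarrow> (real^2) set" where
  "plus_side f = {p. f p > 0}"

definition minus_side :: "(real^2 \<Rightarrow> real) \<Rightarrow> (real^2) set" where
  "minus_side f = {p. - f p > 0}"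

text \<open>A piecewise analytic vector field is given by its two components \<open>Xp\<close> (used where
  \<open>f \<ge> 0\<close>) and \<open>Xm\<close> (used where \<open>f \<le> 0\<close>), both defined on the whole plane.\<close>

definition sewing_arc ::
  "(real^2 \<Rightarrow> real) \<Rightarrow> (real^2 \<Rightarrow> real^2) \<Rightarrow> (real^2 \<Rightarrow> real^2) \<Rightarrow> (real^2) set" where
  "sewing_arc f Xp Xm = {p \<in> switching_curve f. lie Xp f p * lie Xm f p > 0}"

definition escaping_arc ::
  "(real^2 \<Rightarrow> real) \<Rightarrow> (real^2 \<Rightarrow> real^2) \<Rightarrow> (real^2 \<Rightarrow> real^2) \<Rightarrow> (real^2) set" where
  "escaping_arc f Xp Xm = {p \<in> switching_curve f. lie Xp f p > 0 \<and> lie Xm f p < 0}"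

definition sliding_arc ::
  "(real^2 \<Rightarrow> real) \<Rightarrow> (real^2 \<Rightarrow> real^2) \<Rightarrow> (real^2 \<Rightarrow> real^2) \<Rightarrow> (real^2) set" where
  "sliding_arc f Xp Xm = {p \<in> switching_curve f. lie Xp f p < 0 \<and> lie Xm f p > 0}"

text \<open>Well defined only on the escaping and sliding arcs.\<close>

definition filippov_field ::
  "(real^2 \<Rightarrow> real) \<Rightarrow> (real^2 \<Rightarrow> real^2) \<Rightarrow> (real^2 \<Rightarrow> real^2) \<Rightarrow> real^2 \<Rightarrow> real^2" where
  "filippov_field f Xp Xm p =
     (THE v. v \<in> closed_segment (Xp p) (Xm p) \<and> gradient f p \<bullet> v = 0)"

lemma filippov_field_eq:
  assumes "p \<in> escaping_arc f Xp Xm \<union> sliding_arc f Xp Xm"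
  shows "filippov_field f Xp Xm p =
    (lie Xm f p *\<^sub>R Xp p - lie Xp f p *\<^sub>R Xm p) /\<^sub>R (lie Xm f p - lie Xp f p)"
proof -
  define a b where "a = lie Xp f p" and "b = lie Xm f p"
  have ab: "(a > 0 \<and> b < 0) \<or> (a < 0 \<and> b > 0)"
    using assms by (auto simp: escaping_arc_def sliding_arc_def a_def b_def)
  have ne: "b - a \<noteq> 0" using ab by auto
  have inner: "gradient f p \<bullet> ((1 - u) *\<^sub>R Xp p + u *\<^sub>R Xm p) = (1 - u) * a + u * b" for u
    by (simp add: a_def b_def lie_def inner_right_distrib)
  define u0 where "u0 = - a / (b - a)"
  have u0: "0 \<le> u0" "u0 \<le> 1"
    using ab by (auto simp: u0_def divide_simps)
  have zero: "(1 - u) * a + u * b = 0 \<longleftrightarrow> u = u0" for u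
    using ne by (auto simp: u0_def field_simps)
  have "filippov_field f Xp Xm p = (1 - u0) *\<^sub>R Xp p + u0 *\<^sub>R Xm p"
    unfolding filippov_field_def
  proof (rule the_equality)
    show "(1 - u0) *\<^sub>R Xp p + u0 *\<^sub>R Xm p \<in> closed_segment (Xp p) (Xm p) \<and>
        gradient f p \<bullet> ((1 - u0) *\<^sub>R Xp p + u0 *\<^sub>R Xm p) = 0"
      using u0 zero[of u0] inner[of u0] by (auto simp: closed_segment_def)
  next
    fix v assume "v \<in> closed_segment (Xp p) (Xm p) \<and> gradient f p \<bullet> v = 0"
    then show "v = (1 - u0) *\<^sub>R Xp p + u0 *\<^sub>R Xm p"
      using zero inner by (auto simp: closed_segment_def)
  qed
  also have "\<dots> = (b *\<^sub>R Xp p - a *\<^sub>R Xm p) /\<^sub>R (b - a)"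
  proof -
    have "1 - u0 = inverse (b - a) * b" "u0 = - (inverse (b - a) * a)"
      using ne by (auto simp: u0_def field_simps)
    then show ?thesis
      by (simp add: scaleR_diff_right)
  qed
  finally show ?thesis by (simp add: a_def b_def)
qed

definition sigma_regular ::
  "(real^2 \<Rightarrow> real) \<Rightarrow> (real^2 \<Rightarrow> real^2) \<Rightarrow> (real^2 \<Rightarrow> real^2) \<Rightarrow> real^2 \<Rightarrow> bool" where
  "sigma_regular f Xp Xm p \<longleftrightarrow>
     p \<in> sewing_arc f Xp Xm \<or>
     p \<in> sliding_arc f Xp Xm \<union> escaping_arc f Xp Xm \<and> filippov_field f Xp Xm p \<noteq> 0"

definition sigma_singular ::
  "(real^2 \<Rightarrow> real) \<Rightarrow> (real^2 \<Rightarrow> real^2) \<Rightarrow> (real^2 \<Rightarrow> real^2) \<Rightarrow> real^2 \<Rightarrow> bool" where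
  "sigma_singular f Xp Xm p \<longleftrightarrow> p \<in> switching_curve f \<and> \<not> sigma_regular f Xp Xm p"

text \<open>A regular (non-equilibrium) trajectory is an integral curve on an open interval, which is
  not required to be the maximal one. This matters when the conditions below ask the curve to
  stay in \<open>K\<close> near \<open>p\<close>: only the end tending to \<open>p\<close> is meant. If, say, the separatrix of a
  saddle \<open>p\<close> enters \<open>p\<close> inside \<open>K\<close> but belongs to a homoclinic loop that leaves \<open>p\<close> outside
  \<open>K\<close>, then the part of the separatrix near its end still has to count.\<close>

definition regular_trajectory ::
  "(real^2 \<Rightarrow> real^2) \<Rightarrow> (real \<Rightarrow> real^2) \<Rightarrow> real set \<Rightarrow> bool" where
  "regular_trajectory Y \<gamma> I \<longleftrightarrow>
     open I \<and> is_interval I \<and>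
     (\<forall>t\<in>I. (\<gamma> has_vector_derivative Y (\<gamma> t)) (at t) \<and> Y (\<gamma> t) \<noteq> 0)"

text \<open>\<open>F\<close> is \<open>at_top\<close> or \<open>at_bot\<close>.\<close>

definition tends_to_point ::
  "(real \<Rightarrow> real^2) \<Rightarrow> real set \<Rightarrow> real^2 \<Rightarrow> real filter \<Rightarrow> bool" where
  "tends_to_point \<gamma> I p F \<longleftrightarrow> (\<forall>\<^sub>F t in F. t \<in> I) \<and> (\<gamma> \<longlongrightarrow> p) F"

definition trajectory_through ::
  "(real^2 \<Rightarrow> real^2) \<Rightarrow> (real^2) set \<Rightarrow> real^2 \<Rightarrow> bool" where
  "trajectory_through Y K p \<longleftrightarrow>
     (\<exists>\<gamma> I t0. regular_trajectory Y \<gamma> I \<and> t0 \<in> I \<and> \<gamma> t0 = p \<and> p \<in> closure (\<gamma> ` I \<inter> K))"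

definition trajectory_tending ::
  "(real^2 \<Rightarrow> real^2) \<Rightarrow> (real^2) set \<Rightarrow> real^2 \<Rightarrow> bool" where
  "trajectory_tending Y K p \<longleftrightarrow>
     (\<exists>\<gamma> I V. regular_trajectory Y \<gamma> I \<and>
        (tends_to_point \<gamma> I p at_top \<or> tends_to_point \<gamma> I p at_bot) \<and>
        open V \<and> p \<in> V \<and> \<gamma> ` I \<inter> V \<subseteq> V \<inter> K)"

definition has_sigma_characteristic_orbit ::
  "(real^2 \<Rightarrow> real) \<Rightarrow> (real^2 \<Rightarrow> real^2) \<Rightarrow> (real^2 \<Rightarrow> real^2) \<Rightarrow> real^2 \<Rightarrow> bool" where
  "has_sigma_characteristic_orbit f Xp Xm p \<longleftrightarrow>
     trajectory_through Xp (plus_side f) p \<or> trajectory_through Xm (minus_side f) p \<or>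
     trajectory_tending Xp (plus_side f) p \<or> trajectory_tending Xm (minus_side f) p \<or>
     (\<forall>V. open V \<and> p \<in> V \<longrightarrow> (\<exists>q \<in> V \<inter> switching_curve f. lie Xp f q * lie Xm f q < 0))"

definition sigma_monodromic ::
  "(real^2 \<Rightarrow> real) \<Rightarrow> (real^2 \<Rightarrow> real^2) \<Rightarrow> (real^2 \<Rightarrow> real^2) \<Rightarrow> real^2 \<Rightarrow> bool" where
  "sigma_monodromic f Xp Xm p \<longleftrightarrow>
     p isolated_in {q. sigma_singular f Xp Xm q} \<and> \<not> has_sigma_characteristic_orbit f Xp Xm p"

definition fold_point ::
  "(real^2 \<Rightarrow> real) \<Rightarrow> (real^2 \<Rightarrow> real^2) \<Rightarrow> nat \<Rightarrow> real^2 \<Rightarrow> bool" where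
  "fold_point f Y n p \<longleftrightarrow>
     even n \<and> n \<ge> 2 \<and> Y p \<noteq> 0 \<and> (\<forall>k\<in>{1..<n}. (lie Y ^^ k) f p = 0) \<and> (lie Y ^^ n) f p \<noteq> 0"

text \<open>Meant for a zero \<open>p\<close> of \<open>Y\<close>. Then \<open>\<gamma> t \<noteq> p\<close> for all \<open>t \<in> I\<close>, because the trajectory
  is regular, so the quotient is a genuine unit vector. The zero is not required to be isolated:
  the definition makes sense for any zero.\<close>

definition characteristic_orbit ::
  "(real^2 \<Rightarrow> real^2) \<Rightarrow> real^2 \<Rightarrow> (real \<Rightarrow> real^2) \<Rightarrow> real set \<Rightarrow> bool" where
  "characteristic_orbit Y p \<gamma> I \<longleftrightarrow>
     regular_trajectory Y \<gamma> I \<and>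
     (\<exists>F\<in>{at_top, at_bot}. tends_to_point \<gamma> I p F \<and>
        (\<exists>u. ((\<lambda>t. (\<gamma> t - p) /\<^sub>R norm (\<gamma> t - p)) \<longlongrightarrow> u) F))"

definition has_characteristic_orbit_in ::
  "(real^2 \<Rightarrow> real^2) \<Rightarrow> (real^2) set \<Rightarrow> real^2 \<Rightarrow> bool" where
  "has_characteristic_orbit_in Y K p \<longleftrightarrow>
     (\<exists>\<gamma> I V. characteristic_orbit Y p \<gamma> I \<and> open V \<and> p \<in> V \<and> \<gamma> ` I \<inter> V \<subseteq> V \<inter> K)"

end

theory Submission
  imports Defs
begin

text \<open>
  The hypothesis on \<open>V\<close> makes \<open>p\<close> an isolated \<open>\<Sigma>\<close>-singular point at which the third kind of
  \<open>\<Sigma>\<close>-characteristic orbit is impossible: every other point of \<open>\<Sigma>\<close> nearby is a sewing point.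
  What remains are two independent questions, one for \<open>X\<^sup>+\<close> on the side \<open>f > 0\<close> and one for
  \<open>X\<^sup>-\<close> on the side \<open>f < 0\<close>. Replacing \<open>f\<close> by \<open>- f\<close> turns the second into the first, so everything
  reduces to one analytic field \<open>Y\<close> and one side \<open>f > 0\<close>: when is there neither a trajectory through
  \<open>p\<close> accumulating at \<open>p\<close> from that side, nor a trajectory tending to \<open>p\<close> inside it?

  If \<open>Y p \<noteq> 0\<close>, nothing can tend to \<open>p\<close>, because near \<open>p\<close> the trajectories move with a definite
  speed. Let \<open>\<gamma>\<close> pass through \<open>p\<close>. The \<open>k\<close>-th derivative of \<open>f \<circ> \<gamma>\<close> is \<open>Y\<^sup>k f\<close> along \<open>\<gamma>\<close>. Not all
  \<open>Y\<^sup>k f p\<close> can vanish: Cauchy estimates would give \<open>f = 0\<close> along \<open>\<gamma>\<close> near \<open>p\<close> (\<open>flat_contact\<close>),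
  so \<open>\<gamma>\<close> would run inside \<open>\<Sigma>\<close> and \<open>Y f\<close> would vanish at points of \<open>\<Sigma>\<close> close to \<open>p\<close>. Hence \<open>f \<circ> \<gamma>\<close>
  behaves like a power of time whose exponent and sign are the order of contact and the sign of the first
  nonzero \<open>Y\<^sup>k f p\<close> (\<open>contact_sign\<close>), and the local arc of \<open>\<gamma>\<close> avoids \<open>f > 0\<close> exactly for a fold
  of even order with negative leading value. It is not enough to look at the local arc, since \<open>\<gamma>\<close> might come
  back and accumulate at \<open>p\<close>. In the plane it cannot, unless it repeats its own local arc: this is the
  Poincare-Bendixson monotonicity of successive crossings of a transversal, which rests on the
  Jordan curve theorem (\<open>no_closer_return\<close>, \<open>no_forward_return\<close>).

  If \<open>Y p = 0\<close>, no regular trajectory passes through \<open>p\<close>, and characteristic orbits in \<open>f > 0\<close> are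
  trajectories tending to \<open>p\<close>. For the converse let \<open>H\<close> be the lowest-order homogeneous part of \<open>Y\<close> at
  \<open>p\<close>. If \<open>det (v, H v)\<close> is not identically zero, then a trajectory close to \<open>p\<close> can cross any ray on
  which it does not vanish in one sense only. A trajectory that stays on one side of \<open>\<Sigma>\<close> cannot wind around \<open>p\<close>,
  so its direction converges (\<open>direction_converges\<close>). If \<open>det (v, H v) = 0\<close> identically,
  the field is almost radial, and in every direction with \<open>H v \<noteq> 0\<close> a thin sector contains an orbit
  that enters \<open>p\<close> with a limit direction (\<open>entering_sector_orbit\<close>). Such sectors exist inside \<open>f > 0\<close>, so
  a characteristic orbit exists whatever the given trajectory does.
\<close>

section \<open>Majorised power series in two variables\<close>

text \<open>The number \<open>M\<close> bounds the sum of the absolute values of the terms of a power series for \<open>g\<close> on the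
  closed square of radius \<open>r\<close> around \<open>p\<close>. The series is a plain sequence of monomials \<open>c k\<close> with exponents
  \<open>a k\<close>, \<open>b k\<close>, in which a monomial may occur repeatedly. Then the product of two series is indexed by pairs
  and differentiation keeps the index, so that neither needs a Cauchy product or a shift of coefficients.\<close>

definition majorised :: "(real^2 \<Rightarrow> real) \<Rightarrow> real^2 \<Rightarrow> real \<Rightarrow> real \<Rightarrow> bool" where
  "majorised g p r M \<longleftrightarrow>
     (\<exists>(c :: nat \<Rightarrow> real) a b S.
        ((\<lambda>k. \<bar>c k\<bar> * r ^ (a k + b k)) has_sum S) UNIV \<and> S \<le> M \<and>
        (\<forall>x. \<bar>x $ 1 - p $ 1\<bar> \<le> r \<longrightarrow> \<bar>x $ 2 - p $ 2\<bar> \<le> r \<longrightarrow>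
          ((\<lambda>k. c k * ((x $ 1 - p $ 1) ^ a k * (x $ 2 - p $ 2) ^ b k)) has_sum g x) UNIV))"

text \<open>For sums and products of series, whose natural index sets are disjoint sums and products of the natural numbers.\<close>

lemma majorisedI:
  fixes h :: "nat \<Rightarrow> 'i" and c :: "'i \<Rightarrow> real"
  assumes h: "bij h"
    and S: "((\<lambda>k. \<bar>c k\<bar> * r ^ (a k + b k)) has_sum S) UNIV" "S \<le> M"
    and g: "\<And>x. \<bar>x $ 1 - p $ 1\<bar> \<le> r \<Longrightarrow> \<bar>x $ 2 - p $ 2\<bar> \<le> r \<Longrightarrow>
          ((\<lambda>k. c k * ((x $ 1 - p $ 1) ^ a k * (x $ 2 - p $ 2) ^ b k)) has_sum g x) UNIV"
  shows "majorised g p r M"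
  unfolding majorised_def
proof (intro exI conjI allI impI)
  show "((\<lambda>k. \<bar>(c \<circ> h) k\<bar> * r ^ ((a \<circ> h) k + (b \<circ> h) k)) has_sum S) UNIV"
    using has_sum_reindex_bij_betw[OF h, THEN iffD2, OF S(1)] by simp
  show "S \<le> M" by fact
  fix x :: "real^2" assume "\<bar>x $ 1 - p $ 1\<bar> \<le> r" "\<bar>x $ 2 - p $ 2\<bar> \<le> r"
  then show "((\<lambda>k. (c \<circ> h) k * ((x $ 1 - p $ 1) ^ (a \<circ> h) k * (x $ 2 - p $ 2) ^ (b \<circ> h) k)) has_sum g x) UNIV"
    using has_sum_reindex_bij_betw[OF h, THEN iffD2, OF g] by simp
qed

lemma monomial_bound:
  fixes u v c r :: real
  assumes "\<bar>u\<bar> \<le> r" "\<bar>v\<bar> \<le> r"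
  shows "\<bar>c * (u ^ a * v ^ b)\<bar> \<le> \<bar>c\<bar> * r ^ (a + b)"
proof -
  have "r \<ge> 0" using assms by linarith
  have "\<bar>u\<bar> ^ a * \<bar>v\<bar> ^ b \<le> r ^ a * r ^ b"
    using assms \<open>r \<ge> 0\<close> by (intro mult_mono power_mono) auto
  then show ?thesis
    by (simp add: abs_mult power_abs power_add mult_left_mono)
qed

lemma majorised_bound:
  assumes "majorised g p r M" "\<bar>x $ 1 - p $ 1\<bar> \<le> r" "\<bar>x $ 2 - p $ 2\<bar> \<le> r"
  shows "\<bar>g x\<bar> \<le> M"
proof -
  obtain c :: "nat \<Rightarrow> real" and a b S where S: "((\<lambda>k. \<bar>c k\<bar> * r ^ (a k + b k)) has_sum S) UNIV" "S \<le> M"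
    and g: "((\<lambda>k. c k * ((x $ 1 - p $ 1) ^ a k * (x $ 2 - p $ 2) ^ b k)) has_sum g x) UNIV"
    using assms unfolding majorised_def by blast
  have "norm (g x) \<le> S"
    by (rule norm_infsum_le[OF g S(1)]) (use monomial_bound[OF assms(2,3)] in auto)
  then show ?thesis using S(2) by simp
qed

lemma majorised_mono:
  assumes "majorised g p r M" "0 \<le> s" "s \<le> r" "M \<le> N"
  shows "majorised g p s N"
proof -
  obtain c :: "nat \<Rightarrow> real" and a b S where S: "((\<lambda>k. \<bar>c k\<bar> * r ^ (a k + b k)) has_sum S) UNIV" "S \<le> M"
    and g: "\<And>x. \<bar>x $ 1 - p $ 1\<bar> \<le> r \<Longrightarrow> \<bar>x $ 2 - p $ 2\<bar> \<le> r \<Longrightarrow>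
        ((\<lambda>k. c k * ((x $ 1 - p $ 1) ^ a k * (x $ 2 - p $ 2) ^ b k)) has_sum g x) UNIV"
    using assms(1) unfolding majorised_def by blast
  have le: "\<bar>c k\<bar> * s ^ (a k + b k) \<le> \<bar>c k\<bar> * r ^ (a k + b k)" for k
    using assms by (intro mult_left_mono power_mono) auto
  have "(\<lambda>k. \<bar>c k\<bar> * s ^ (a k + b k)) summable_on UNIV"
    by (rule summable_on_comparison_test[OF has_sum_imp_summable[OF S(1)] le]) (use assms in auto)
  then obtain S' where S': "((\<lambda>k. \<bar>c k\<bar> * s ^ (a k + b k)) has_sum S') UNIV"
    by (auto simp: summable_on_def)
  have "S' \<le> S" by (rule has_sum_mono[OF S' S(1) le])
  with S S' assms g show ?thesis
    by (intro majorisedI[OF bij_id S']) auto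
qed

lemma majorised_add:
  assumes "majorised g p r M" "majorised h p r N"
  shows "majorised (\<lambda>x. g x + h x) p r (M + N)"
proof -
  obtain c :: "nat \<Rightarrow> real" and a b S where S: "((\<lambda>k. \<bar>c k\<bar> * r ^ (a k + b k)) has_sum S) UNIV" "S \<le> M"
    and g: "\<And>x. \<bar>x $ 1 - p $ 1\<bar> \<le> r \<Longrightarrow> \<bar>x $ 2 - p $ 2\<bar> \<le> r \<Longrightarrow>
        ((\<lambda>k. c k * ((x $ 1 - p $ 1) ^ a k * (x $ 2 - p $ 2) ^ b k)) has_sum g x) UNIV"
    using assms(1) unfolding majorised_def by blast
  obtain c' :: "nat \<Rightarrow> real" and a' b' S' where S': "((\<lambda>k. \<bar>c' k\<bar> * r ^ (a' k + b' k)) has_sum S') UNIV" "S' \<le> N"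
    and h: "\<And>x. \<bar>x $ 1 - p $ 1\<bar> \<le> r \<Longrightarrow> \<bar>x $ 2 - p $ 2\<bar> \<le> r \<Longrightarrow>
        ((\<lambda>k. c' k * ((x $ 1 - p $ 1) ^ a' k * (x $ 2 - p $ 2) ^ b' k)) has_sum h x) UNIV"
    using assms(2) unfolding majorised_def by blast
  have plus: "(F has_sum (A + B)) UNIV"
    if "((\<lambda>k. F (Inl k)) has_sum A) UNIV" "((\<lambda>k. F (Inr k)) has_sum B) UNIV"
    for F :: "nat + nat \<Rightarrow> real" and A B
  proof -
    have "(F has_sum A) (range Inl)" "(F has_sum B) (range Inr)"
      using that by (auto simp: has_sum_reindex o_def)
    then have "(F has_sum (A + B)) (range Inl \<union> range Inr)"
      by (rule has_sum_Un_disjoint) auto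
    then show ?thesis by (simp add: UNIV_sum)
  qed
  show ?thesis
  proof (rule majorisedI[where h = sum_decode and c = "case_sum c c'" and a = "case_sum a a'"
        and b = "case_sum b b'" and S = "S + S'"])
    show "bij sum_decode" by (rule bij_sum_decode)
    show "S + S' \<le> M + N" using S S' by simp
    show "((\<lambda>k. \<bar>case_sum c c' k\<bar> * r ^ (case_sum a a' k + case_sum b b' k)) has_sum S + S') UNIV"
      by (rule plus) (use S S' in auto)
    fix x :: "real^2" assume "\<bar>x $ 1 - p $ 1\<bar> \<le> r" "\<bar>x $ 2 - p $ 2\<bar> \<le> r"
    then show "((\<lambda>k. case_sum c c' k * ((x $ 1 - p $ 1) ^ case_sum a a' k * (x $ 2 - p $ 2) ^ case_sum b b' k))
        has_sum g x + h x) UNIV"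
      by (intro plus) (use g h in auto)
  qed
qed

text \<open>Absolute convergence of both factors makes the doubly indexed family summable, and its value can
  then be computed by iterated summation.\<close>

lemma has_sum_product_abs:
  fixes u v :: "nat \<Rightarrow> real"
  assumes u: "(u has_sum A) UNIV" and v: "(v has_sum B) UNIV"
    and U: "(\<lambda>k. \<bar>u k\<bar>) summable_on UNIV" and V: "(\<lambda>k. \<bar>v k\<bar>) summable_on UNIV"
  shows "((\<lambda>(k, l). u k * v l) has_sum (A * B)) UNIV"
proof -
  obtain B' where B': "((\<lambda>k. \<bar>v k\<bar>) has_sum B') UNIV" using V by (auto simp: summable_on_def)
  have "(\<lambda>(k, l). \<bar>u k\<bar> * \<bar>v l\<bar>) summable_on (SIGMA k:UNIV. UNIV)"
  proof (rule summable_on_SigmaI[where g = "\<lambda>k. \<bar>u k\<bar> * B'"])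
    show "((\<lambda>y. case (x, y) of (k, l) \<Rightarrow> \<bar>u k\<bar> * \<bar>v l\<bar>) has_sum \<bar>u x\<bar> * B') UNIV" for x
      using has_sum_cmult_right[OF B'] by simp
    show "(\<lambda>k. \<bar>u k\<bar> * B') summable_on UNIV" using U by (rule summable_on_cmult_left)
  qed auto
  then have "(\<lambda>x. norm (case x of (k, l) \<Rightarrow> u k * v l)) summable_on (SIGMA k:UNIV. UNIV)"
    by (simp add: case_prod_unfold abs_mult)
  then have "(\<lambda>(k, l). u k * v l) summable_on (SIGMA k:UNIV. UNIV)"
    by (rule abs_summable_summable)
  moreover have "((\<lambda>y. case (x, y) of (k, l) \<Rightarrow> u k * v l) has_sum u x * B) UNIV" for x
    using has_sum_cmult_right[OF v] by simp
  moreover have "((\<lambda>k. u k * B) has_sum (A * B)) UNIV" by (rule has_sum_cmult_left[OF u])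
  ultimately have "((\<lambda>(k, l). u k * v l) has_sum (A * B)) (SIGMA k:UNIV. UNIV)"
    by (intro has_sum_SigmaI[where g = "\<lambda>k. u k * B"]) auto
  then show ?thesis by simp
qed

lemma majorised_mult:
  assumes "majorised g p r M" "majorised h p r N" and r: "0 \<le> r"
  shows "majorised (\<lambda>x. g x * h x) p r (M * N)"
proof -
  obtain c :: "nat \<Rightarrow> real" and a b S where S: "((\<lambda>k. \<bar>c k\<bar> * r ^ (a k + b k)) has_sum S) UNIV" "S \<le> M"
    and g: "\<And>x. \<bar>x $ 1 - p $ 1\<bar> \<le> r \<Longrightarrow> \<bar>x $ 2 - p $ 2\<bar> \<le> r \<Longrightarrow>
        ((\<lambda>k. c k * ((x $ 1 - p $ 1) ^ a k * (x $ 2 - p $ 2) ^ b k)) has_sum g x) UNIV"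
    using assms(1) unfolding majorised_def by blast
  obtain c' :: "nat \<Rightarrow> real" and a' b' S' where S': "((\<lambda>k. \<bar>c' k\<bar> * r ^ (a' k + b' k)) has_sum S') UNIV" "S' \<le> N"
    and h: "\<And>x. \<bar>x $ 1 - p $ 1\<bar> \<le> r \<Longrightarrow> \<bar>x $ 2 - p $ 2\<bar> \<le> r \<Longrightarrow>
        ((\<lambda>k. c' k * ((x $ 1 - p $ 1) ^ a' k * (x $ 2 - p $ 2) ^ b' k)) has_sum h x) UNIV"
    using assms(2) unfolding majorised_def by blast
  have pos: "0 \<le> S" "0 \<le> S'"
    by (rule has_sum_nonneg[OF S(1)], use r in simp) (rule has_sum_nonneg[OF S'(1)], use r in simp)
  show ?thesis
  proof (rule majorisedI[where h = prod_decode and c = "\<lambda>(k, l). c k * c' l" and a = "\<lambda>(k, l). a k + a' l"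
        and b = "\<lambda>(k, l). b k + b' l" and S = "S * S'"])
    show "bij prod_decode" by (rule bij_prod_decode)
    show "S * S' \<le> M * N" using S S' pos by (intro mult_mono) auto
    have "((\<lambda>(k, l). (\<bar>c k\<bar> * r ^ (a k + b k)) * (\<bar>c' l\<bar> * r ^ (a' l + b' l))) has_sum S * S') UNIV"
      by (rule has_sum_product_abs[OF S(1) S'(1)])
         (use has_sum_imp_summable[OF S(1)] has_sum_imp_summable[OF S'(1)] r in \<open>auto simp: abs_mult\<close>)
    then show "((\<lambda>k. \<bar>case k of (k, l) \<Rightarrow> c k * c' l\<bar> * r ^ ((case k of (k, l) \<Rightarrow> a k + a' l) +
        (case k of (k, l) \<Rightarrow> b k + b' l))) has_sum S * S') UNIV"
      by (simp add: case_prod_unfold abs_mult power_add mult_ac)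
    fix x :: "real^2" assume x: "\<bar>x $ 1 - p $ 1\<bar> \<le> r" "\<bar>x $ 2 - p $ 2\<bar> \<le> r"
    have "((\<lambda>(k, l). (c k * ((x $ 1 - p $ 1) ^ a k * (x $ 2 - p $ 2) ^ b k)) *
          (c' l * ((x $ 1 - p $ 1) ^ a' l * (x $ 2 - p $ 2) ^ b' l))) has_sum g x * h x) UNIV"
      using monomial_bound[OF x]
      by (intro has_sum_product_abs g h x
          summable_on_comparison_test[OF has_sum_imp_summable[OF S(1)]]
          summable_on_comparison_test[OF has_sum_imp_summable[OF S'(1)]]) auto
    then show "((\<lambda>k. (case k of (k, l) \<Rightarrow> c k * c' l) * ((x $ 1 - p $ 1) ^ (case k of (k, l) \<Rightarrow> a k + a' l) *
        (x $ 2 - p $ 2) ^ (case k of (k, l) \<Rightarrow> b k + b' l))) has_sum g x * h x) UNIV"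
      by (simp add: case_prod_unfold power_add mult_ac)
  qed
qed

text \<open>Shrinking the radius from \<open>r\<close> to \<open>s\<close> pays for the factor \<open>a\<close> that differentiation brings down: by the
  factorisation of \<open>r\<^sup>a - s\<^sup>a\<close>, the quotient \<open>(r\<^sup>a - s\<^sup>a) / (r - s)\<close> is a sum of \<open>a\<close> terms, each at least \<open>s\<^sup>a / s\<close>.\<close>

lemma deriv_coeff_bound:
  fixes s r :: real
  assumes "0 < s" "s < r"
  shows "real a * s ^ (a - 1 + b) \<le> r ^ (a + b) / (r - s)"
proof -
  have "(r - s) * (real a * s ^ (a - 1)) \<le> r ^ a"
  proof (cases a)
    case (Suc n)
    have "(\<Sum>i<Suc n. s ^ n) \<le> (\<Sum>i<Suc n. r ^ i * s ^ (n - i))"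
    proof (rule sum_mono)
      fix i assume "i \<in> {..<Suc n}"
      then have "s ^ n = s ^ i * s ^ (n - i)" by (simp flip: power_add)
      also have "\<dots> \<le> r ^ i * s ^ (n - i)"
        using assms by (intro mult_right_mono power_mono) auto
      finally show "s ^ n \<le> r ^ i * s ^ (n - i)" .
    qed
    then have "(r - s) * (real a * s ^ n) \<le> (r - s) * (\<Sum>i<Suc n. r ^ i * s ^ (n - i))"
      using assms Suc by (intro mult_left_mono) auto
    also have "\<dots> = r ^ Suc n - s ^ Suc n"
      by (subst power_diff_sumr2) (simp add: mult.commute)
    also have "\<dots> \<le> r ^ Suc n" using assms by simp
    finally show ?thesis using Suc by simp
  qed simp
  then have "(r - s) * (real a * s ^ (a - 1)) * s ^ b \<le> r ^ a * r ^ b"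
    using assms by (intro mult_mono power_mono) auto
  then show ?thesis
    using assms by (simp add: field_simps power_add)
qed

definition partial :: "2 \<Rightarrow> (real^2 \<Rightarrow> real) \<Rightarrow> real^2 \<Rightarrow> real" where
  "partial i g x = frechet_derivative g (at x) (axis i 1)"

text \<open>Termwise differentiation is justified by the Weierstrass test: the differentiated
  series are dominated on the smaller square by the terms of the original one divided by \<open>r - s\<close>.\<close>

lemma majorised_derivative:
  assumes maj: "majorised g p r M" and s: "0 < s" "s < r"
  obtains G1 G2 where "majorised G1 p s (M / (r - s))" "majorised G2 p s (M / (r - s))"
    "\<And>x. \<bar>x $ 1 - p $ 1\<bar> < s \<Longrightarrow> \<bar>x $ 2 - p $ 2\<bar> < s \<Longrightarrow>
       (g has_derivative (\<lambda>h. G1 x * h $ 1 + G2 x * h $ 2)) (at x)"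
proof -
  obtain c :: "nat \<Rightarrow> real" and a b S where S: "((\<lambda>k. \<bar>c k\<bar> * r ^ (a k + b k)) has_sum S) UNIV" "S \<le> M"
    and g: "\<And>x. \<bar>x $ 1 - p $ 1\<bar> \<le> r \<Longrightarrow> \<bar>x $ 2 - p $ 2\<bar> \<le> r \<Longrightarrow>
        ((\<lambda>k. c k * ((x $ 1 - p $ 1) ^ a k * (x $ 2 - p $ 2) ^ b k)) has_sum g x) UNIV"
    using maj unfolding majorised_def by blast
  define t1 where "t1 x k = c k * real (a k) * ((x $ 1 - p $ 1) ^ (a k - 1) * (x $ 2 - p $ 2) ^ b k)"
    for x :: "real^2" and k
  define t2 where "t2 x k = c k * real (b k) * ((x $ 1 - p $ 1) ^ a k * (x $ 2 - p $ 2) ^ (b k - 1))"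
    for x :: "real^2" and k
  define G1 where "G1 x = infsum (t1 x) UNIV" for x
  define G2 where "G2 x = infsum (t2 x) UNIV" for x
  define m where "m k = \<bar>c k\<bar> * r ^ (a k + b k) / (r - s)" for k
  have m: "(m has_sum (S / (r - s))) UNIV"
    unfolding m_def by (rule has_sum_divide_const[OF S(1)])
  have msum: "summable m" using has_sum_imp_summable[OF m] by (rule summable_on_imp_summable)
  have le1: "\<bar>c k * real (a k)\<bar> * s ^ (a k - 1 + b k) \<le> m k" for k
    using mult_left_mono[OF deriv_coeff_bound[OF s, of "a k" "b k"], of "\<bar>c k\<bar>"]
    by (simp add: m_def abs_mult mult.assoc)
  have le2: "\<bar>c k * real (b k)\<bar> * s ^ (a k + (b k - 1)) \<le> m k" for k
    using mult_left_mono[OF deriv_coeff_bound[OF s, of "b k" "a k"], of "\<bar>c k\<bar>"]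
    by (simp add: m_def abs_mult mult.assoc add.commute)
  have b1: "\<bar>t1 x k\<bar> \<le> m k" and b2: "\<bar>t2 x k\<bar> \<le> m k"
    if "\<bar>x $ 1 - p $ 1\<bar> \<le> s" "\<bar>x $ 2 - p $ 2\<bar> \<le> s" for x k
    using order_trans[OF monomial_bound[OF that] le1] order_trans[OF monomial_bound[OF that] le2]
    by (auto simp: t1_def t2_def)
  have s1: "(t1 x has_sum G1 x) UNIV" and s2: "(t2 x has_sum G2 x) UNIV"
    if "\<bar>x $ 1 - p $ 1\<bar> \<le> s" "\<bar>x $ 2 - p $ 2\<bar> \<le> s" for x
  proof -
    have "t1 x summable_on UNIV" "t2 x summable_on UNIV"
      by (rule abs_summable_summable,
          rule Infinite_Sum.abs_summable_on_comparison_test'[OF has_sum_imp_summable[OF m]], use b1 b2 that in auto)+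
    then show "(t1 x has_sum G1 x) UNIV" "(t2 x has_sum G2 x) UNIV"
      unfolding G1_def G2_def by (simp_all add: has_sum_infsum)
  qed
  have maj1: "majorised G1 p s (M / (r - s))"
  proof -
    have "(\<lambda>k. \<bar>c k * real (a k)\<bar> * s ^ (a k - 1 + b k)) summable_on UNIV"
      by (rule summable_on_comparison_test[OF has_sum_imp_summable[OF m] le1]) (use s in auto)
    then obtain S' where S': "((\<lambda>k. \<bar>c k * real (a k)\<bar> * s ^ (a k - 1 + b k)) has_sum S') UNIV"
      by (auto simp: summable_on_def)
    have "S' \<le> S / (r - s)" by (rule has_sum_mono[OF S' m le1])
    also have "\<dots> \<le> M / (r - s)" using S s by (intro divide_right_mono) auto
    finally show ?thesis
      by (rule majorisedI[OF bij_id S']) (use s1 in \<open>simp_all add: t1_def[abs_def]\<close>)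
  qed
  have maj2: "majorised G2 p s (M / (r - s))"
  proof -
    have "(\<lambda>k. \<bar>c k * real (b k)\<bar> * s ^ (a k + (b k - 1))) summable_on UNIV"
      by (rule summable_on_comparison_test[OF has_sum_imp_summable[OF m] le2]) (use s in auto)
    then obtain S' where S': "((\<lambda>k. \<bar>c k * real (b k)\<bar> * s ^ (a k + (b k - 1))) has_sum S') UNIV"
      by (auto simp: summable_on_def)
    have "S' \<le> S / (r - s)" by (rule has_sum_mono[OF S' m le2])
    also have "\<dots> \<le> M / (r - s)" using S s by (intro divide_right_mono) auto
    finally show ?thesis
      by (rule majorisedI[OF bij_id S']) (use s2 in \<open>simp_all add: t2_def[abs_def]\<close>)
  qed
  define Q where "Q = {x::real^2. \<bar>x $ 1 - p $ 1\<bar> < s \<and> \<bar>x $ 2 - p $ 2\<bar> < s}"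
  have "Q = box (\<chi> i. p $ i - s) (\<chi> i. p $ i + s)"
    by (auto simp: Q_def mem_box_cart forall_2)
  then have Q: "open Q" "convex Q" by (simp_all add: open_box convex_box)
  have der: "(g has_derivative (\<lambda>h. G1 x * h $ 1 + G2 x * h $ 2)) (at x)" if x: "x \<in> Q" for x
  proof -
    define f where "f k x = c k * ((x $ 1 - p $ 1) ^ a k * (x $ 2 - p $ 2) ^ b k)" for k and x :: "real^2"
    have fd: "(f k has_derivative (\<lambda>h. t1 x k * h $ 1 + t2 x k * h $ 2)) (at x within Q)" for k x
      unfolding f_def t1_def t2_def
      apply (rule derivative_eq_intros bounded_linear.has_derivative[OF bounded_linear_vec_nth] refl)+
      apply (simp add: fun_eq_iff algebra_simps)
      done
    have unif: "\<forall>\<^sub>F n in sequentially. \<forall>x\<in>Q. \<forall>h::real^2. norm ((\<Sum>k<n. t1 x k * h $ 1 + t2 x k * h $ 2) -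
         (G1 x * h $ 1 + G2 x * h $ 2)) \<le> e * norm h" if e: "e > 0" for e
    proof -
      have u1: "uniform_limit Q (\<lambda>n x. \<Sum>k<n. t1 x k) (\<lambda>x. suminf (t1 x)) sequentially"
        by (rule Weierstrass_m_test[OF _ msum]) (use b1 in \<open>auto simp: Q_def\<close>)
      have u2: "uniform_limit Q (\<lambda>n x. \<Sum>k<n. t2 x k) (\<lambda>x. suminf (t2 x)) sequentially"
        by (rule Weierstrass_m_test[OF _ msum]) (use b2 in \<open>auto simp: Q_def\<close>)
      have eq: "suminf (t1 x) = G1 x" "suminf (t2 x) = G2 x" if "x \<in> Q" for x
        using that has_sum_imp_sums[OF s1, of x] has_sum_imp_sums[OF s2, of x]
        by (auto simp: Q_def sums_iff)
      have "\<forall>\<^sub>F n in sequentially. (\<forall>x\<in>Q. dist (\<Sum>k<n. t1 x k) (suminf (t1 x)) < e / 2) \<and>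
           (\<forall>x\<in>Q. dist (\<Sum>k<n. t2 x k) (suminf (t2 x)) < e / 2)"
        using uniform_limitD[OF u1, of "e/2"] uniform_limitD[OF u2, of "e/2"] e
        by (auto intro: eventually_conj)
      then show ?thesis
      proof eventually_elim
        case (elim n)
        show ?case
        proof (intro ballI allI)
          fix x and h :: "real^2" assume x: "x \<in> Q"
          have d: "\<bar>(\<Sum>k<n. t1 x k) - G1 x\<bar> \<le> e/2" "\<bar>(\<Sum>k<n. t2 x k) - G2 x\<bar> \<le> e/2"
            using elim x eq[OF x] by (force simp: dist_real_def)+
          have "(\<Sum>k<n. t1 x k * h $ 1 + t2 x k * h $ 2) - (G1 x * h $ 1 + G2 x * h $ 2)
              = ((\<Sum>k<n. t1 x k) - G1 x) * h $ 1 + ((\<Sum>k<n. t2 x k) - G2 x) * h $ 2"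
            by (simp add: sum.distrib sum_distrib_right left_diff_distrib)
          also have "\<bar>\<dots>\<bar> \<le> \<bar>(\<Sum>k<n. t1 x k) - G1 x\<bar> * \<bar>h $ 1\<bar> + \<bar>(\<Sum>k<n. t2 x k) - G2 x\<bar> * \<bar>h $ 2\<bar>"
            by (rule order_trans[OF abs_triangle_ineq]) (simp add: abs_mult)
          also have "\<dots> \<le> e/2 * norm h + e/2 * norm h"
            using d e by (intro add_mono mult_mono component_le_norm_cart) auto
          finally show "norm ((\<Sum>k<n. t1 x k * h $ 1 + t2 x k * h $ 2) - (G1 x * h $ 1 + G2 x * h $ 2)) \<le> e * norm h"
            by simp
        qed
      qed
    qed
    have gs: "(\<lambda>k. f k x) sums g x" if "x \<in> Q" for x
      using that s unfolding f_def by (intro has_sum_imp_sums g) (auto simp: Q_def)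
    have "\<exists>g'. \<forall>x\<in>Q. (\<lambda>k. f k x) sums g' x \<and>
        (g' has_derivative (\<lambda>h. G1 x * h $ 1 + G2 x * h $ 2)) (at x within Q)"
      by (rule has_derivative_series[OF Q(2) fd unif x gs[OF x]])
    then obtain g' where g': "\<forall>x\<in>Q. (\<lambda>k. f k x) sums g' x \<and>
        (g' has_derivative (\<lambda>h. G1 x * h $ 1 + G2 x * h $ 2)) (at x within Q)"
      by (elim exE)
    have eq: "g' y = g y" if "y \<in> Q" for y
      by (rule sums_unique2[OF conjunct1[OF bspec[OF g' that]] gs[OF that]])
    have "(g' has_derivative (\<lambda>h. G1 x * h $ 1 + G2 x * h $ 2)) (at x)"
      using bspec[OF g' x] at_within_open[OF x Q(1)] by simp
    then show ?thesis
      by (rule has_derivative_transform_within_open[OF _ Q(1) x eq])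
  qed
  show thesis
    by (rule that[OF maj1 maj2 der]) (auto simp: Q_def)
qed

lemma partial_eqI:
  assumes "(g has_derivative (\<lambda>h. A * h $ 1 + B * h $ 2)) (at x)"
  shows "partial 1 g x = A" "partial 2 g x = B"
  using frechet_derivative_at[OF assms, symmetric] by (simp_all add: partial_def axis_def)

lemma majorised_cong:
  assumes "majorised g p r M" "\<And>x. \<bar>x $ 1 - p $ 1\<bar> \<le> r \<Longrightarrow> \<bar>x $ 2 - p $ 2\<bar> \<le> r \<Longrightarrow> g x = h x"
  shows "majorised h p r M"
proof -
  obtain c :: "nat \<Rightarrow> real" and a b S where S: "((\<lambda>k. \<bar>c k\<bar> * r ^ (a k + b k)) has_sum S) UNIV" "S \<le> M"
    and g: "\<And>x. \<bar>x $ 1 - p $ 1\<bar> \<le> r \<Longrightarrow> \<bar>x $ 2 - p $ 2\<bar> \<le> r \<Longrightarrow>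
        ((\<lambda>k. c k * ((x $ 1 - p $ 1) ^ a k * (x $ 2 - p $ 2) ^ b k)) has_sum g x) UNIV"
    using assms(1) unfolding majorised_def by blast
  show ?thesis
    by (rule majorisedI[OF bij_id S]) (use g assms(2) in auto)
qed

text \<open>Cauchy's estimate for a first derivative. The factor \<open>2\<close> comes from differentiating on the open square
  halfway between \<open>s\<close> and \<open>r\<close>, which contains the closed square of radius \<open>s\<close>.\<close>

lemma majorised_partial:
  assumes maj: "majorised g p r M" and s: "0 < s" "s < r"
  shows "majorised (partial i g) p s (2 * M / (r - s))"
    and "\<And>x. \<bar>x $ 1 - p $ 1\<bar> \<le> s \<Longrightarrow> \<bar>x $ 2 - p $ 2\<bar> \<le> s \<Longrightarrow> g differentiable at x"
proof -
  define t where "t = (s + r) / 2"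
  have t: "s < t" "t < r" "0 < t" and rt: "M / (r - t) = 2 * M / (r - s)"
    using s by (auto simp: t_def field_simps)
  obtain G1 G2 where G: "majorised G1 p t (M / (r - t))" "majorised G2 p t (M / (r - t))"
    "\<And>x. \<bar>x $ 1 - p $ 1\<bar> < t \<Longrightarrow> \<bar>x $ 2 - p $ 2\<bar> < t \<Longrightarrow>
       (g has_derivative (\<lambda>h. G1 x * h $ 1 + G2 x * h $ 2)) (at x)"
    using majorised_derivative[OF maj t(3,2)] by blast
  have "majorised (partial 1 g) p s (M / (r - t))"
    by (rule majorised_cong[OF majorised_mono[OF G(1)]])
       (use s t partial_eqI(1)[OF G(3)] in auto)
  moreover have "majorised (partial 2 g) p s (M / (r - t))"
    by (rule majorised_cong[OF majorised_mono[OF G(2)]])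
       (use s t partial_eqI(2)[OF G(3)] in auto)
  ultimately show "majorised (partial i g) p s (2 * M / (r - s))"
    using exhaust_2[of i] rt by auto
  show "g differentiable at x" if "\<bar>x $ 1 - p $ 1\<bar> \<le> s" "\<bar>x $ 2 - p $ 2\<bar> \<le> s" for x
    using G(3)[of x] that t by (auto simp: differentiable_def)
qed

lemma lie_partial: "lie Y g x = partial 1 g x * Y x $ 1 + partial 2 g x * Y x $ 2"
  by (simp add: lie_def gradient_def partial_def inner_vec_def sum_2)

lemma majorised_lie:
  assumes maj: "majorised g p r M" and s: "0 < s" "s < r"
    and Y: "\<And>i. majorised (\<lambda>x. Y x $ i) p r K"
  shows "majorised (lie Y g) p s (4 * K / (r - s) * M)"
proof -
  have Ys: "majorised (\<lambda>x. Y x $ i) p s K" for i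
    by (rule majorised_mono[OF Y]) (use s in auto)
  have "majorised (\<lambda>x. partial i g x * Y x $ i) p s (2 * M / (r - s) * K)" for i
    by (rule majorised_mult[OF majorised_partial(1)[OF maj s] Ys]) (use s in auto)
  then have "majorised (\<lambda>x. partial 1 g x * Y x $ 1 + partial 2 g x * Y x $ 2) p s
      (2 * M / (r - s) * K + 2 * M / (r - s) * K)"
    by (intro majorised_add)
  moreover have "2 * M / (r - s) * K + 2 * M / (r - s) * K = 4 * K / (r - s) * M"
    by (simp add: add_divide_distrib[symmetric])
  ultimately show ?thesis by (simp add: lie_partial[abs_def] mult.assoc)
qed

text \<open>The form in which real analyticity is used below. Unlike analyticity itself, it is visibly inherited by
  partial derivatives and products, hence by all iterated Lie derivatives.\<close>

definition locally_majorised :: "(real^2 \<Rightarrow> real) \<Rightarrow> bool" where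
  "locally_majorised g \<longleftrightarrow> (\<forall>p. \<exists>r>0. \<exists>M. majorised g p r M)"

lemma analytic_plane_majorised:
  assumes "analytic_plane g"
  shows "locally_majorised g"
  unfolding locally_majorised_def
proof
  fix p
  obtain r c where r: "r > 0" and c: "\<And>x. x \<in> ball p r \<Longrightarrow>
      ((\<lambda>(i, j). ((x $ 1 - p $ 1) ^ i * (x $ 2 - p $ 2) ^ j) *\<^sub>R c i j) has_sum g x) UNIV"
    using assms unfolding analytic_plane_def by meson
  define s where "s = r / 3"
  have s: "s > 0" using r by (simp add: s_def)
  have ball: "x \<in> ball p r" if "\<bar>x $ 1 - p $ 1\<bar> \<le> s" "\<bar>x $ 2 - p $ 2\<bar> \<le> s" for x
  proof -
    have "norm (x - p) \<le> \<bar>x $ 1 - p $ 1\<bar> + \<bar>x $ 2 - p $ 2\<bar>"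
      using norm_le_l1_cart[of "x - p"] by (simp add: sum_2)
    also have "\<dots> < r" using that r by (simp add: s_def)
    finally show ?thesis by (simp add: dist_norm norm_minus_commute)
  qed
  define x0 where "x0 = (\<chi> i. p $ i + s)"
  have "x0 \<in> ball p r" by (rule ball) (use s in \<open>auto simp: x0_def\<close>)
  from c[OF this] have "(\<lambda>(i, j). (s ^ i * s ^ j) * c i j) summable_on UNIV"
    by (auto simp: x0_def dest: has_sum_imp_summable)
  then have "(\<lambda>x. norm (case x of (i, j) \<Rightarrow> (s ^ i * s ^ j) * c i j)) summable_on UNIV"
    by (simp only: summable_on_iff_abs_summable_on_real[symmetric])
  then obtain S where "((\<lambda>x. norm (case x of (i, j) \<Rightarrow> (s ^ i * s ^ j) * c i j)) has_sum S) UNIV"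
    by (auto simp: summable_on_def)
  then have S: "((\<lambda>x. \<bar>case x of (i, j) \<Rightarrow> c i j\<bar> * s ^ (fst x + snd x)) has_sum S) UNIV"
    using s by (simp add: case_prod_unfold abs_mult power_add mult_ac)
  have "majorised g p s S"
    by (rule majorisedI[OF bij_prod_decode S])
       (use c[OF ball] in \<open>auto simp: case_prod_unfold mult_ac\<close>)
  then show "\<exists>r>0. \<exists>M. majorised g p r M" using s by blast
qed

lemma analytic_plane_component:
  fixes Y :: "real^2 \<Rightarrow> real^2"
  assumes "analytic_plane Y"
  shows "analytic_plane (\<lambda>x. Y x $ i)"
  unfolding analytic_plane_def
proof
  fix p
  obtain r c where r: "r > 0" and c: "\<And>x. x \<in> ball p r \<Longrightarrow>
      ((\<lambda>(i, j). ((x $ 1 - p $ 1) ^ i * (x $ 2 - p $ 2) ^ j) *\<^sub>R c i j) has_sum Y x) UNIV"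
    using assms unfolding analytic_plane_def by meson
  have "((\<lambda>(k, j). ((x $ 1 - p $ 1) ^ k * (x $ 2 - p $ 2) ^ j) *\<^sub>R (c k j $ i)) has_sum Y x $ i) UNIV"
    if "x \<in> ball p r" for x
    using has_sum_bounded_linear[OF bounded_linear_vec_nth c[OF that]]
    by (simp add: case_prod_unfold o_def)
  then show "\<exists>r>0. \<exists>c. \<forall>x\<in>ball p r.
     ((\<lambda>(i, j). ((x $ 1 - p $ 1) ^ i * (x $ 2 - p $ 2) ^ j) *\<^sub>R c i j) has_sum Y x $ i) UNIV"
    using r by (intro exI[of _ r] conjI exI[of _ "\<lambda>k j. c k j $ i"]) auto
qed

lemma majorised_common:
  assumes "\<And>i::2. locally_majorised (\<lambda>x. Y x $ i)" "locally_majorised g"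
  obtains r K M where "r > 0" "\<And>i. majorised (\<lambda>x. Y x $ i) p r K" "majorised g p r M"
proof -
  obtain r1 M1 where 1: "r1 > 0" "majorised (\<lambda>x. Y x $ 1) p r1 M1"
    using assms(1) unfolding locally_majorised_def by meson
  obtain r2 M2 where 2: "r2 > 0" "majorised (\<lambda>x. Y x $ 2) p r2 M2"
    using assms(1) unfolding locally_majorised_def by meson
  obtain r3 M3 where 3: "r3 > 0" "majorised g p r3 M3"
    using assms(2) unfolding locally_majorised_def by meson
  define r where "r = min r1 (min r2 r3)"
  have r: "0 \<le> r" "r \<le> r1" "r \<le> r2" "r \<le> r3" "r > 0" using 1 2 3 by (auto simp: r_def)
  have "majorised (\<lambda>x. Y x $ 1) p r (max M1 M2)" "majorised (\<lambda>x. Y x $ 2) p r (max M1 M2)"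
    by (rule majorised_mono[OF 1(2)] majorised_mono[OF 2(2)], use r in auto)+
  then have "majorised (\<lambda>x. Y x $ i) p r (max M1 M2)" for i
    using exhaust_2[of i] by auto
  moreover have "majorised g p r M3"
    by (rule majorised_mono[OF 3(2)]) (use r in auto)
  ultimately show thesis using that r by blast
qed

lemma locally_majorised_lie:
  assumes "\<And>i::2. locally_majorised (\<lambda>x. Y x $ i)" "locally_majorised g"
  shows "locally_majorised (lie Y g)"
  unfolding locally_majorised_def
proof
  fix p
  obtain r K M where "r > 0" "\<And>i. majorised (\<lambda>x. Y x $ i) p r K" "majorised g p r M"
    using majorised_common[OF assms] by blast
  then have "majorised (lie Y g) p (r/2) (4 * K / (r - r/2) * M)"
    by (intro majorised_lie) auto
  then show "\<exists>r>0. \<exists>M. majorised (lie Y g) p r M" using \<open>r > 0\<close> half_gt_zero by blast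
qed

lemma locally_majorised_iterate_lie:
  assumes "\<And>i::2. locally_majorised (\<lambda>x. Y x $ i)" "locally_majorised g"
  shows "locally_majorised ((lie Y ^^ n) g)"
proof (induction n)
  case 0
  show ?case using assms(2) by simp
next
  case (Suc n)
  show ?case using locally_majorised_lie[OF assms(1) Suc] by simp
qed

lemma locally_majorised_partial:
  assumes "locally_majorised g"
  shows "locally_majorised (partial i g)"
  unfolding locally_majorised_def
proof
  fix p
  obtain r M where r: "r > 0" "majorised g p r M"
    using assms unfolding locally_majorised_def by blast
  then have "majorised (partial i g) p (r/2) (2 * M / (r - r/2))"
    by (intro majorised_partial) auto
  then show "\<exists>r>0. \<exists>M. majorised (partial i g) p r M" using \<open>r > 0\<close> half_gt_zero by blast
qed

lemma locally_majorised_differentiable: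
  assumes "locally_majorised g"
  shows "g differentiable at x"
proof -
  obtain r M where r: "r > 0" "majorised g x r M"
    using assms unfolding locally_majorised_def by blast
  show ?thesis
    by (rule majorised_partial(2)[OF r(2), of "r/2"]) (use r in auto)
qed

lemma has_derivative_partial:
  assumes "g differentiable at x"
  shows "(g has_derivative (\<lambda>h. partial 1 g x * h $ 1 + partial 2 g x * h $ 2)) (at x)"
proof -
  have D: "(g has_derivative frechet_derivative g (at x)) (at x)"
    using assms frechet_derivative_works by blast
  then have lin: "linear (frechet_derivative g (at x))" by (rule has_derivative_linear)
  have "frechet_derivative g (at x) h = partial 1 g x * h $ 1 + partial 2 g x * h $ 2" for h
  proof -
    have "h = h $ 1 *\<^sub>R axis 1 1 + h $ 2 *\<^sub>R axis 2 1"
      by (simp add: vec_eq_iff forall_2 axis_def)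
    then have "frechet_derivative g (at x) h = frechet_derivative g (at x) (h $ 1 *\<^sub>R axis 1 1 + h $ 2 *\<^sub>R axis 2 1)"
      by simp
    also have "\<dots> = h $ 1 * partial 1 g x + h $ 2 * partial 2 g x"
      unfolding partial_def using lin by (simp add: linear_add linear_scale)
    finally show ?thesis by (simp add: mult.commute)
  qed
  then have "frechet_derivative g (at x) = (\<lambda>h. partial 1 g x * h $ 1 + partial 2 g x * h $ 2)" ..
  with D show ?thesis by simp
qed

lemma lie_along_curve:
  assumes "g differentiable at (\<gamma> t)" "(\<gamma> has_vector_derivative Y (\<gamma> t)) (at t within A)"
  shows "((\<lambda>t. g (\<gamma> t)) has_real_derivative lie Y g (\<gamma> t)) (at t within A)"
proof -
  have "((g \<circ> \<gamma>) has_vector_derivative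
      (\<lambda>h. partial 1 g (\<gamma> t) * h $ 1 + partial 2 g (\<gamma> t) * h $ 2) (Y (\<gamma> t))) (at t within A)"
    by (rule vector_derivative_diff_chain_within[OF assms(2)])
       (rule has_derivative_at_withinI[OF has_derivative_partial[OF assms(1)]])
  then show ?thesis
    by (simp add: has_real_derivative_iff_has_vector_derivative o_def lie_partial)
qed

text \<open>Cauchy's estimate for the iterates: descend from radius \<open>r\<close> to \<open>r / 2\<close> in \<open>n\<close> equal steps, each of
  which costs the same factor, proportional to \<open>n\<close>. The bound grows like \<open>n\<^sup>n\<close>, that is, like \<open>n!\<close> up to an
  exponential factor, and so has the strength of analyticity.\<close>

lemma iterated_lie_bound:
  assumes "r > 0" "\<And>i::2. majorised (\<lambda>x. Y x $ i) p r K" "majorised g p r M"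
    and n: "n > 0" and x: "\<bar>x $ 1 - p $ 1\<bar> \<le> r / 2" "\<bar>x $ 2 - p $ 2\<bar> \<le> r / 2"
  shows "\<bar>(lie Y ^^ n) g x\<bar> \<le> (8 * K / r * real n) ^ n * M"
proof -
  define d where "d = r / (2 * real n)"
  have d: "d > 0" "n * d = r / 2" using assms(1) n by (auto simp: d_def)
  have "k \<le> n \<Longrightarrow> majorised ((lie Y ^^ k) g) p (r - k * d) ((4 * K / d) ^ k * M)" for k
  proof (induction k)
    case 0
    then show ?case using assms(3) by simp
  next
    case (Suc k)
    have "Suc k * d \<le> n * d" using Suc.prems d by (intro mult_right_mono) auto
    then have pos: "0 < r - Suc k * d" using d assms(1) by linarith
    have le: "r - Suc k * d < r - k * d" "r - k * d \<le> r" using d by (auto simp: algebra_simps)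
    have "majorised (lie Y ((lie Y ^^ k) g)) p (r - Suc k * d)
        (4 * K / ((r - k * d) - (r - Suc k * d)) * ((4 * K / d) ^ k * M))"
      using Suc pos le by (intro majorised_lie majorised_mono[OF assms(2)]) auto
    moreover have "(r - k * d) - (r - Suc k * d) = d" by (simp add: algebra_simps)
    ultimately show ?case by (simp add: mult.assoc)
  qed
  from this[of n] d have "majorised ((lie Y ^^ n) g) p (r / 2) ((4 * K / d) ^ n * M)"
    by simp
  from majorised_bound[OF this x] show ?thesis
    by (simp add: d_def field_simps)
qed

section \<open>Contact of an orbit with a curve\<close>

lemma power_le_exp_fact: "real n ^ n \<le> exp (real n) * fact n"
proof -
  have "(\<lambda>k. real n ^ k /\<^sub>R fact k) sums exp (real n)" by (rule exp_converges)
  then have "(\<Sum>k\<in>{n}. real n ^ k /\<^sub>R fact k) \<le> exp (real n)"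
    by (intro sum_le_suminf[THEN order_trans]) (auto simp: sums_iff)
  then show ?thesis by (simp add: field_simps)
qed

text \<open>Taylor's formula for \<open>g \<circ> \<gamma>\<close>, whose derivatives are the iterated Lie derivatives of \<open>g\<close> along the orbit.\<close>

lemma taylor_along_orbit:
  assumes Y: "\<And>i::2. locally_majorised (\<lambda>x. Y x $ i)" and g: "locally_majorised g"
    and sol: "\<And>t. \<bar>t - t0\<bar> < d \<Longrightarrow> (\<gamma> has_vector_derivative Y (\<gamma> t)) (at t)"
    and zero: "\<And>k. k < n \<Longrightarrow> (lie Y ^^ k) g (\<gamma> t0) = 0"
    and n: "n > 0" and t: "\<bar>t - t0\<bar> < d"
  obtains \<xi> where "\<bar>\<xi> - t0\<bar> \<le> \<bar>t - t0\<bar>" "g (\<gamma> t) = (lie Y ^^ n) g (\<gamma> \<xi>) / fact n * (t - t0) ^ n"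
proof (cases "t = t0")
  case True
  then show ?thesis using that[of t0] zero[of 0] n by simp
next
  case False
  define e where "e = \<bar>t - t0\<bar>"
  have der: "((\<lambda>s. (lie Y ^^ m) g (\<gamma> s)) has_real_derivative (lie Y ^^ Suc m) g (\<gamma> s)) (at s)"
    if "\<bar>s - t0\<bar> < d" for m s
    using lie_along_curve[where \<gamma> = \<gamma> and t = s and Y = Y, OF locally_majorised_differentiable[OF locally_majorised_iterate_lie[OF Y g]] sol[OF that]]
    by simp
  have "\<exists>s. (if t < t0 then t < s \<and> s < t0 else t0 < s \<and> s < t) \<and>
      (\<lambda>s. g (\<gamma> s)) t = (\<Sum>m<n. (\<lambda>s. (lie Y ^^ m) g (\<gamma> s)) t0 / fact m * (t - t0) ^ m)
        + (\<lambda>s. (lie Y ^^ n) g (\<gamma> s)) s / fact n * (t - t0) ^ n"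
    by (rule Taylor[where diff = "\<lambda>m s. (lie Y ^^ m) g (\<gamma> s)" and a = "t0 - e" and b = "t0 + e"])
       (use n der t False in \<open>auto simp: e_def simp del: funpow.simps\<close>)
  then obtain s where s: "if t < t0 then t < s \<and> s < t0 else t0 < s \<and> s < t"
      "g (\<gamma> t) = (\<Sum>m<n. (lie Y ^^ m) g (\<gamma> t0) / fact m * (t - t0) ^ m)
        + (lie Y ^^ n) g (\<gamma> s) / fact n * (t - t0) ^ n"
    by auto
  show ?thesis by (rule that[of s]) (use s zero in \<open>auto split: if_splits\<close>)
qed

text \<open>The substitute for analyticity of the orbit itself: the remainder of order \<open>n\<close> in Taylor's formula is bounded by a
  constant times \<open>(C \<bar>t - t0\<bar>)\<^sup>n\<close>, because the Lie derivatives grow no faster than \<open>n!\<close> times an exponential.\<close>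

lemma flat_contact:
  assumes Y: "\<And>i::2. locally_majorised (\<lambda>x. Y x $ i)" and g: "locally_majorised g"
    and d: "d > 0" and sol: "\<And>t. \<bar>t - t0\<bar> < d \<Longrightarrow> (\<gamma> has_vector_derivative Y (\<gamma> t)) (at t)"
    and zero: "\<And>k. (lie Y ^^ k) g (\<gamma> t0) = 0"
  obtains e where "e > 0" "\<And>t. \<bar>t - t0\<bar> < e \<Longrightarrow> g (\<gamma> t) = 0"
proof -
  obtain r K M where r: "r > 0" and K: "\<And>i. majorised (\<lambda>x. Y x $ i) (\<gamma> t0) r K"
    and M: "majorised g (\<gamma> t0) r M"
    using majorised_common[OF Y g] by blast
  have K0: "K \<ge> 0" using majorised_bound[OF K, of "\<gamma> t0" 1] r by simp
  have "isCont \<gamma> t0"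
    using sol[of t0] d has_vector_derivative_continuous by auto
  then obtain e1 where e1: "e1 > 0" "\<And>t. \<bar>t - t0\<bar> < e1 \<Longrightarrow> norm (\<gamma> t - \<gamma> t0) < r / 2"
    unfolding continuous_at_eps_delta dist_norm real_norm_def using r half_gt_zero by blast
  \<comment> \<open>The radius of convergence is \<open>1 / C\<close>: the bound \<open>(8 K n / r)\<^sup>n\<close> is at most \<open>C\<^sup>n\<close> times the factorial of \<open>n\<close>.
    The radius \<open>e\<close> is at most half of it, so the remainders decay like powers of \<open>1 / 2\<close>.\<close>
  define C where "C = 8 * K / r * exp 1"
  define e where "e = min (min d e1) (1 / (2 * (C + 1)))"
  have C0: "C \<ge> 0" using K0 r by (simp add: C_def)
  have e: "e > 0" "e \<le> d" "e \<le> e1" using d e1 C0 by (auto simp: e_def)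
  have "g (\<gamma> t) = 0" if t: "\<bar>t - t0\<bar> < e" for t
  proof -
    have small: "C * \<bar>t - t0\<bar> \<le> 1/2"
    proof -
      have "C * \<bar>t - t0\<bar> \<le> (C + 1) * (1 / (2 * (C + 1)))"
        using t C0 by (intro mult_mono) (auto simp: e_def)
      also have "\<dots> = 1/2" using C0 by (simp add: divide_simps)
      finally show ?thesis .
    qed
    have bound: "\<bar>g (\<gamma> t)\<bar> \<le> M * (1/2) ^ n" if n: "n > 0" for n
    proof -
      have td: "\<bar>t - t0\<bar> < d" using t e by simp
      obtain \<xi> where \<xi>: "\<bar>\<xi> - t0\<bar> \<le> \<bar>t - t0\<bar>"
        and eq: "g (\<gamma> t) = (lie Y ^^ n) g (\<gamma> \<xi>) / fact n * (t - t0) ^ n"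
        by (rule taylor_along_orbit[where \<gamma> = \<gamma>, OF Y g sol zero n td])
      have "norm (\<gamma> \<xi> - \<gamma> t0) < r / 2" using e1(2) \<xi> t e by auto
      then have "\<bar>\<gamma> \<xi> $ i - \<gamma> t0 $ i\<bar> \<le> r / 2" for i
        using component_le_norm_cart[of "\<gamma> \<xi> - \<gamma> t0" i] by simp
      then have "\<bar>(lie Y ^^ n) g (\<gamma> \<xi>)\<bar> \<le> (8 * K / r * real n) ^ n * M"
        by (intro iterated_lie_bound[OF r K M n])
      also have "\<dots> = (8 * K / r) ^ n * M * real n ^ n" by (subst power_mult_distrib) (simp add: mult_ac)
      also have "\<dots> \<le> (8 * K / r) ^ n * M * (exp (real n) * fact n)"
        using K0 r majorised_bound[OF M, of "\<gamma> t0"]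
        by (intro mult_left_mono power_le_exp_fact) auto
      also have "\<dots> = C ^ n * M * fact n"
        unfolding C_def power_mult_distrib[of "8 * K / r" "exp 1"] by (simp flip: exp_of_nat_mult)
      finally have *: "\<bar>(lie Y ^^ n) g (\<gamma> \<xi>)\<bar> / fact n \<le> C ^ n * M"
        by (simp add: field_simps)
      have "\<bar>g (\<gamma> t)\<bar> = \<bar>(lie Y ^^ n) g (\<gamma> \<xi>)\<bar> / fact n * \<bar>t - t0\<bar> ^ n"
        by (simp add: eq abs_mult power_abs)
      also have "\<dots> \<le> C ^ n * M * \<bar>t - t0\<bar> ^ n"
        using * by (intro mult_right_mono) auto
      also have "\<dots> = M * (C * \<bar>t - t0\<bar>) ^ n" by (simp add: power_mult_distrib)
      also have "\<dots> \<le> M * (1/2) ^ n"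
        using small C0 r majorised_bound[OF M, of "\<gamma> t0"]
        by (intro mult_left_mono power_mono) auto
      finally show ?thesis .
    qed
    have "(\<lambda>n. M * (1/2) ^ n) \<longlonglongrightarrow> M * 0"
      by (intro tendsto_mult tendsto_const LIMSEQ_power_zero) auto
    then have "\<bar>g (\<gamma> t)\<bar> \<le> M * 0"
      by (rule tendsto_lowerbound) (use bound in \<open>auto intro!: eventually_sequentiallyI[of 1]\<close>)
    then show ?thesis by simp
  qed
  then show thesis using that e by blast
qed

text \<open>The first nonvanishing Lie derivative decides on which side of the curve \<open>g = 0\<close> the orbit runs before and after contact.\<close>

lemma contact_sign:
  assumes Y: "\<And>i::2. locally_majorised (\<lambda>x. Y x $ i)" and g: "locally_majorised g"
    and d: "d > 0" and sol: "\<And>t. \<bar>t - t0\<bar> < d \<Longrightarrow> (\<gamma> has_vector_derivative Y (\<gamma> t)) (at t)"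
    and zero: "\<And>k. k < n \<Longrightarrow> (lie Y ^^ k) g (\<gamma> t0) = 0"
    and n: "n > 0" and nz: "(lie Y ^^ n) g (\<gamma> t0) \<noteq> 0"
  obtains e where "e > 0" "e \<le> d" "\<And>t. \<bar>t - t0\<bar> < e \<Longrightarrow>
     sgn (g (\<gamma> t)) = sgn ((lie Y ^^ n) g (\<gamma> t0)) * sgn (t - t0) ^ n"
proof -
  define h where "h = (\<lambda>t. (lie Y ^^ n) g (\<gamma> t))"
  have "(h has_real_derivative (lie Y ((lie Y ^^ n) g)) (\<gamma> t0)) (at t0)"
    unfolding h_def
    by (rule lie_along_curve[where \<gamma> = \<gamma> and t = t0 and Y = Y, OF locally_majorised_differentiable[OF locally_majorised_iterate_lie[OF Y g]]])
       (use sol d in auto)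
  then have "isCont h t0" by (rule DERIV_isCont)
  then obtain e1 where e1: "e1 > 0" "\<And>t. \<bar>t - t0\<bar> < e1 \<Longrightarrow> \<bar>h t - h t0\<bar> < \<bar>h t0\<bar>"
    unfolding continuous_at_eps_delta dist_real_def
    using nz unfolding h_def zero_less_abs_iff[symmetric] by blast
  have sg: "sgn (h t) = sgn (h t0)" if "\<bar>t - t0\<bar> < e1" for t
    using e1(2)[OF that] by (auto simp: sgn_if split: if_splits)
  show thesis
  proof (rule that[of "min d e1"])
    fix t assume t: "\<bar>t - t0\<bar> < min d e1"
    then have td: "\<bar>t - t0\<bar> < d" by simp
    obtain \<xi> where \<xi>: "\<bar>\<xi> - t0\<bar> \<le> \<bar>t - t0\<bar>"
      and eq: "g (\<gamma> t) = (lie Y ^^ n) g (\<gamma> \<xi>) / fact n * (t - t0) ^ n"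
      by (rule taylor_along_orbit[where \<gamma> = \<gamma>, OF Y g sol zero n td])
    have "sgn (g (\<gamma> t)) = sgn (h \<xi>) * sgn (t - t0) ^ n"
      by (simp add: eq h_def sgn_mult sgn_divide power_sgn)
    then show "sgn (g (\<gamma> t)) = sgn ((lie Y ^^ n) g (\<gamma> t0)) * sgn (t - t0) ^ n"
      using sg[of \<xi>] \<xi> t by (simp add: h_def)
  qed (use d e1 in auto)
qed

section \<open>Ordinary differential equations\<close>

text \<open>The derivative is taken within \<open>A\<close>, so that solutions on closed time intervals can be joined at their endpoints.\<close>

definition solves :: "('a::real_normed_vector \<Rightarrow> 'a) \<Rightarrow> (real \<Rightarrow> 'a) \<Rightarrow> real set \<Rightarrow> bool" where
  "solves Y x A \<longleftrightarrow> (\<forall>t\<in>A. (x has_vector_derivative Y (x t)) (at t within A))"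

lemma solves_subset: "solves Y x A \<Longrightarrow> B \<subseteq> A \<Longrightarrow> solves Y x B"
  unfolding solves_def by (meson has_vector_derivative_within_subset subsetD)

lemma solves_continuous: "solves Y x A \<Longrightarrow> continuous_on A x"
  unfolding solves_def continuous_on_eq_continuous_within
  using has_vector_derivative_continuous by blast

lemma solves_cong:
  assumes "solves Y x A" "\<And>t. t \<in> A \<Longrightarrow> x t = y t"
  shows "solves Y y A"
  unfolding solves_def
proof
  fix t assume t: "t \<in> A"
  have "(x has_vector_derivative Y (y t)) (at t within A)"
    using assms t unfolding solves_def by metis
  then show "(y has_vector_derivative Y (y t)) (at t within A)"
    by (rule has_vector_derivative_transform[OF t, rotated]) (use assms in auto)
qed

lemma solves_at:
  assumes "solves Y x A" "open B" "B \<subseteq> A" "t \<in> B"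
  shows "(x has_vector_derivative Y (x t)) (at t)"
  using solves_subset[OF assms(1,3)] assms(2,4) at_within_open[OF assms(4,2)]
  unfolding solves_def by metis

text \<open>For \<open>s = 1\<close> this is a shift of time and for \<open>s = - 1\<close> a reversal of time.\<close>

lemma solves_affine_time:
  assumes "solves Y x A" "s * s = 1"
  shows "solves (\<lambda>z. s *\<^sub>R Y z) (\<lambda>t. x (c + s * t)) {t. c + s * t \<in> A}"
  unfolding solves_def
proof
  fix t assume t: "t \<in> {t. c + s * t \<in> A}"
  have "((\<lambda>t. c + s * t) has_real_derivative s) (at t within {t. c + s * t \<in> A})"
    by (auto intro!: derivative_eq_intros)
  then have 1: "((\<lambda>t. c + s * t) has_vector_derivative s) (at t within {t. c + s * t \<in> A})"
    by (simp add: has_real_derivative_iff_has_vector_derivative)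
  have "(x has_vector_derivative Y (x (c + s * t))) (at (c + s * t) within (\<lambda>t. c + s * t) ` {t. c + s * t \<in> A})"
    by (rule has_vector_derivative_within_subset[of _ _ _ A]) (use t assms in \<open>auto simp: solves_def\<close>)
  from vector_diff_chain_within[OF 1 this]
  show "((\<lambda>t. x (c + s * t)) has_vector_derivative s *\<^sub>R Y (x (c + s * t))) (at t within {t. c + s * t \<in> A})"
    by (simp add: o_def)
qed

lemma solves_shift:
  assumes "solves Y x A" "\<And>t. t \<in> B \<Longrightarrow> c + t \<in> A"
  shows "solves Y (\<lambda>t. x (c + t)) B"
  using solves_subset[OF solves_affine_time[OF assms(1), of 1 c], of B] assms(2) by (simp add: subset_iff)

lemma solves_affine_image:
  assumes "solves Y z A" "bounded_linear L" "\<And>t. t \<in> A \<Longrightarrow> W (L (z t) + k) = L (Y (z t))"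
  shows "solves W (\<lambda>t. L (z t) + k) A"
  unfolding solves_def
proof
  fix t assume t: "t \<in> A"
  have "(z has_vector_derivative Y (z t)) (at t within A)" using assms(1) t by (simp add: solves_def)
  then have "((\<lambda>t. L (z t) + k) has_vector_derivative L (Y (z t))) (at t within A)"
    by (simp add: has_vector_derivative_add_const bounded_linear.has_vector_derivative[OF assms(2)])
  then show "((\<lambda>t. L (z t) + k) has_vector_derivative W (L (z t) + k)) (at t within A)"
    by (simp only: assms(3)[OF t])
qed

lemma has_vector_derivative_Un:
  assumes "(f has_vector_derivative D) (at x within S)" "(f has_vector_derivative D) (at x within T)"
  shows "(f has_vector_derivative D) (at x within S \<union> T)"
  using assms unfolding has_vector_derivative_def has_derivative_within
  by (simp add: at_within_union filterlim_sup)

lemma solves_glue: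
  assumes x: "solves Y x S" and y: "solves Y y T" and S: "S \<subseteq> {..b}" "b \<in> S" and T: "T \<subseteq> {b..}" "b \<in> T"
    and xy: "x b = y b"
  shows "solves Y (\<lambda>t. if t \<le> b then x t else y t) (S \<union> T)" (is "solves Y ?z _")
  unfolding solves_def
proof
  fix t assume t: "t \<in> S \<union> T"
  have zS: "solves Y ?z S" by (rule solves_cong[OF x]) (use S in auto)
  have zT: "solves Y ?z T" by (rule solves_cong[OF y]) (use T xy in force)
  consider "t < b" | "t = b" | "t > b" by linarith
  then show "(?z has_vector_derivative Y (?z t)) (at t within S \<union> T)"
  proof cases
    case 1
    then have "at t within S \<union> T = at t within S"
      by (intro at_within_nhd[of _ "{..<b}"]) (use T in auto)
    then show ?thesis using zS t 1 T unfolding solves_def by force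
  next
    case 2
    have "(?z has_vector_derivative Y (?z b)) (at b within S)" "(?z has_vector_derivative Y (?z b)) (at b within T)"
      using zS zT S T unfolding solves_def by blast+
    then show ?thesis using has_vector_derivative_Un 2 by blast
  next
    case 3
    then have "at t within S \<union> T = at t within T"
      by (intro at_within_nhd[of _ "{b<..}"]) (use S in auto)
    then show ?thesis using zT t 3 S unfolding solves_def by force
  qed
qed

definition locally_lipschitz :: "('a::real_normed_vector \<Rightarrow> 'a) \<Rightarrow> bool" where
  "locally_lipschitz Y \<longleftrightarrow> (\<forall>R. \<exists>L. L-lipschitz_on (cball 0 R) Y)"

lemma locally_lipschitz_scaleR:
  "locally_lipschitz Y \<Longrightarrow> locally_lipschitz (\<lambda>z. s *\<^sub>R Y z)"
  unfolding locally_lipschitz_def using lipschitz_on_cmult by blast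

text \<open>Gronwall's argument: with \<open>L\<close> a Lipschitz constant on a ball containing both solutions, the squared distance
  multiplied by \<open>exp (- 2 L t)\<close> does not increase.\<close>

lemma solves_unique_forward:
  fixes Y :: "'a::real_inner \<Rightarrow> 'a"
  assumes Y: "locally_lipschitz Y" and x: "solves Y x {a..b}" and y: "solves Y y {a..b}"
    and eq: "x a = y a" and t: "t \<in> {a..b}"
  shows "x t = y t"
proof -
  have cont: "continuous_on {a..b} x" "continuous_on {a..b} y"
    using x y by (auto dest: solves_continuous)
  have "bounded (x ` {a..b} \<union> y ` {a..b})"
    using cont by (auto intro!: compact_imp_bounded compact_continuous_image)
  then obtain R where R: "\<forall>z\<in>x ` {a..b} \<union> y ` {a..b}. norm z \<le> R"
    unfolding bounded_iff by blast
  obtain L where L: "L-lipschitz_on (cball 0 R) Y" using Y unfolding locally_lipschitz_def by blast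
  define w where "w = (\<lambda>t. exp (- 2 * L * t) * ((x t - y t) \<bullet> (x t - y t)))"
  have der: "(w has_real_derivative (exp (- 2 * L * s) *
      (2 * ((x s - y s) \<bullet> (Y (x s) - Y (y s))) - 2 * L * ((x s - y s) \<bullet> (x s - y s))))) (at s within {a..b})"
    if s: "s \<in> {a..b}" for s
  proof -
    have dx: "(x has_derivative (\<lambda>h. h *\<^sub>R Y (x s))) (at s within {a..b})"
      and dy: "(y has_derivative (\<lambda>h. h *\<^sub>R Y (y s))) (at s within {a..b})"
      using x y s unfolding solves_def has_vector_derivative_def by auto
    show ?thesis unfolding w_def has_field_derivative_def
      by (rule derivative_eq_intros dx dy refl | simp)+
         (simp add: fun_eq_iff algebra_simps inner_commute)
  qed
  have neg: "exp (- 2 * L * s) *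
      (2 * ((x s - y s) \<bullet> (Y (x s) - Y (y s))) - 2 * L * ((x s - y s) \<bullet> (x s - y s))) \<le> 0"
    if s: "s \<in> {a..b}" for s
  proof -
    have "(x s - y s) \<bullet> (Y (x s) - Y (y s)) \<le> norm (x s - y s) * norm (Y (x s) - Y (y s))"
      by (rule norm_cauchy_schwarz)
    also have "\<dots> \<le> norm (x s - y s) * (L * norm (x s - y s))"
      using lipschitz_onD[OF L, of "x s" "y s"] R s by (intro mult_left_mono) (auto simp: dist_norm)
    finally have "(x s - y s) \<bullet> (Y (x s) - Y (y s)) \<le> L * ((x s - y s) \<bullet> (x s - y s))"
      by (simp add: dot_square_norm power2_eq_square mult_ac)
    then show ?thesis by (intro mult_nonneg_nonpos) auto
  qed
  have "- w a \<le> - w t"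
  proof (rule DERIV_nonneg_imp_increasing_open[where f = "\<lambda>t. - w t"])
    show "a \<le> t" using t by simp
    have "continuous_on {a..b} w" using der by (rule DERIV_continuous_on)
    then show "continuous_on {a..t} (\<lambda>t. - w t)"
      by (intro continuous_on_minus) (use t in \<open>auto elim: continuous_on_subset\<close>)
    fix s assume s: "a < s" "s < t"
    have "(w has_real_derivative (exp (- 2 * L * s) *
      (2 * ((x s - y s) \<bullet> (Y (x s) - Y (y s))) - 2 * L * ((x s - y s) \<bullet> (x s - y s))))) (at s)"
      using der[of s] s t at_within_interior[of s "{a..b}"] by simp
    from DERIV_minus[OF this] show "\<exists>D. DERIV (\<lambda>t. - w t) s :> D \<and> 0 \<le> D"
      by (intro exI conjI) (use neg[of s] s t in auto)
  qed
  then have "w t \<le> w a" by simp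
  then have "exp (- 2 * L * t) * ((x t - y t) \<bullet> (x t - y t)) \<le> 0"
    by (simp add: w_def eq)
  then have "(x t - y t) \<bullet> (x t - y t) \<le> 0"
    by (simp add: mult_le_0_iff)
  then have "(x t - y t) \<bullet> (x t - y t) = 0"
    using inner_ge_zero[of "x t - y t"] by linarith
  then show ?thesis by simp
qed

lemma solves_unique:
  fixes Y :: "'a::real_inner \<Rightarrow> 'a"
  assumes Y: "locally_lipschitz Y" and x: "solves Y x {a..b}" and y: "solves Y y {a..b}"
    and c: "c \<in> {a..b}" and eq: "x c = y c" and t: "t \<in> {a..b}"
  shows "x t = y t"
proof (cases "c \<le> t")
  case True
  show ?thesis
    by (rule solves_unique_forward[OF Y solves_subset[OF x] solves_subset[OF y] eq, of b])
       (use c t True in auto)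
next
  case False
  have A: "solves (\<lambda>z. (-1) *\<^sub>R Y z) (\<lambda>t. u (c + (-1) * t)) {0..c - a}" if "solves Y u {a..b}" for u
    by (rule solves_subset[OF solves_affine_time[OF that]]) (use c in auto)
  have "x (c + (-1) * (c - t)) = y (c + (-1) * (c - t))"
    by (rule solves_unique_forward[OF locally_lipschitz_scaleR[OF Y] A[OF x] A[OF y]])
       (use eq c t False in auto)
  then show ?thesis by simp
qed

lemma integral_has_vector_derivative_halfline:
  fixes g :: "real \<Rightarrow> 'a::banach"
  assumes "continuous_on {0..} g" "t \<ge> 0"
  shows "((\<lambda>t. integral {0..t} g) has_vector_derivative g t) (at t within {0..})"
proof -
  have "((\<lambda>t. integral {0..t} g) has_vector_derivative g t) (at t within {0..t+1})"
    by (rule integral_has_vector_derivative[OF continuous_on_subset[OF assms(1)]]) (use assms in auto)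
  moreover have "at t within {0..t+1} = at t within {0..}"
    by (rule at_within_nhd[of _ "{..<t+1}"]) auto
  ultimately show ?thesis by simp
qed

lemma integral_exp_bound:
  fixes g :: "real \<Rightarrow> 'a::banach"
  assumes "continuous_on {0..} g" "t \<ge> 0" "K > 0" "A \<ge> 0" "\<And>s. s \<ge> 0 \<Longrightarrow> norm (g s) \<le> A * exp (K * s)"
  shows "norm (integral {0..t} g) \<le> A / K * exp (K * t)"
proof -
  have "((\<lambda>s. A * exp (K * s)) has_integral (A / K * exp (K * t) - A / K * exp (K * 0))) {0..t}"
    by (rule fundamental_theorem_of_calculus[OF assms(2)])
       (use assms in \<open>auto intro!: derivative_eq_intros simp: has_real_derivative_iff_has_vector_derivative[symmetric]\<close>)
  then have I: "(\<lambda>s. A * exp (K * s)) integrable_on {0..t}"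
      "integral {0..t} (\<lambda>s. A * exp (K * s)) = A / K * exp (K * t) - A / K"
    by (auto simp: has_integral_integrable_integral)
  have "norm (integral {0..t} g) \<le> integral {0..t} (\<lambda>s. A * exp (K * s))"
    by (rule integral_norm_bound_integral[OF _ I(1)])
       (use assms in \<open>auto intro!: integrable_continuous_real intro: continuous_on_subset\<close>)
  also have "\<dots> \<le> A / K * exp (K * t)" using I assms by simp
  finally show ?thesis .
qed

text \<open>Picard iteration on the whole half line at once. The integral equation is written for the weighted deviation
  \<open>y t = exp (- K t) *\<^sub>R (x t - x0)\<close>, a bounded continuous function. With \<open>K\<close> twice the Lipschitz constant the
  integral operator contracts the supremum norm by the factor \<open>1 / 2\<close>.\<close>

lemma ode_exists_halfline:
  fixes F :: "'a::{banach, real_inner} \<Rightarrow> 'a"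
  assumes F: "L-lipschitz_on UNIV F"
  shows "\<exists>x. x 0 = x0 \<and> solves F x {0..}"
proof -
  define l where "l = L + 1"
  define K where "K = 2 * l"
  have L0: "L \<ge> 0" using F lipschitz_on_nonneg by blast
  then have K: "K > 0" "l > 0" by (auto simp: K_def l_def)
  have Fl: "norm (F u - F v) \<le> l * norm (u - v)" for u v
    using lipschitz_onD[OF F, of u v] L0 by (auto simp: dist_norm l_def algebra_simps intro: order_trans)
  have contF: "continuous_on UNIV F" by (rule lipschitz_on_continuous_on[OF F])
  define G where "G y s = F (x0 + exp (K * s) *\<^sub>R apply_bcontfun y s)" for y :: "real \<Rightarrow>\<^sub>C 'a" and s
  have contG: "continuous_on A (G y)" for A y
    unfolding G_def by (intro continuous_on_compose2[OF contF] continuous_intros) auto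
  \<comment> \<open>Arguments \<open>t < 0\<close> are clamped to \<open>0\<close>, since bounded continuous functions live on the whole line.\<close>
  define P where "P y t = exp (- (K * max 0 t)) *\<^sub>R integral {0..max 0 t} (G y)" for y t
  have contI: "continuous_on {0..} (\<lambda>t. integral {0..t} (G y))" for y
    unfolding continuous_on_eq_continuous_within
    using integral_has_vector_derivative_halfline[OF contG] has_vector_derivative_continuous by blast
  have boundP: "norm (P y t) \<le> (norm (F x0) + l * norm y) / K" for y t
  proof -
    define A where "A = norm (F x0) + l * norm y"
    have A: "A \<ge> 0" using K by (simp add: A_def)
    have "norm (G y s) \<le> A * exp (K * s)" if "s \<ge> 0" for s
    proof -
      have "norm (G y s) \<le> norm (F x0) + norm (F (x0 + exp (K * s) *\<^sub>R y s) - F x0)"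
        unfolding G_def using norm_triangle_sub by blast
      also have "\<dots> \<le> norm (F x0) + l * (exp (K * s) * norm (y s))"
        using Fl[of "x0 + exp (K * s) *\<^sub>R y s" x0] by simp
      also have "\<dots> \<le> norm (F x0) * exp (K * s) + l * (exp (K * s) * norm y)"
        using K that by (intro add_mono mult_left_mono norm_bounded) (auto intro: mult_right_le_one_le simp: mult_le_cancel_left1)
      finally show ?thesis by (simp add: A_def algebra_simps)
    qed
    then have "norm (integral {0..max 0 t} (G y)) \<le> A / K * exp (K * max 0 t)"
      by (intro integral_exp_bound contG K A) auto
    then have "exp (- (K * max 0 t)) * norm (integral {0..max 0 t} (G y)) \<le>
        exp (- (K * max 0 t)) * (A / K * exp (K * max 0 t))"
      by (intro mult_left_mono) auto
    also have "\<dots> = A / K" by (simp add: exp_minus)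
    finally show ?thesis by (simp add: P_def A_def)
  qed
  have Pb: "P y \<in> bcontfun" for y
  proof (rule bcontfun_normI[OF _ boundP])
    show "continuous_on UNIV (P y)"
      unfolding P_def
      by (intro continuous_intros continuous_on_compose2[OF contI]) auto
  qed
  define T where "T y = Bcontfun (P y)" for y
  have T: "apply_bcontfun (T y) = P y" for y
    unfolding T_def using Pb by (simp add: Bcontfun_inverse)
  have contr: "dist (T y) (T z) \<le> 1/2 * dist y z" for y z
  proof (rule dist_bound)
    fix t
    have "norm (G y s - G z s) \<le> (l * dist y z) * exp (K * s)" for s
    proof -
      have "norm (G y s - G z s) \<le> l * norm (exp (K * s) *\<^sub>R (y s - z s))"
        using Fl[of "x0 + exp (K * s) *\<^sub>R y s" "x0 + exp (K * s) *\<^sub>R z s"]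
        by (simp add: G_def algebra_simps)
      also have "\<dots> = l * exp (K * s) * dist (y s) (z s)" by (simp add: dist_norm)
      also have "\<dots> \<le> l * exp (K * s) * dist y z"
        using K by (intro mult_left_mono dist_bounded) auto
      finally show ?thesis by (simp add: mult_ac)
    qed
    then have "norm (integral {0..max 0 t} (\<lambda>s. G y s - G z s)) \<le> (l * dist y z) / K * exp (K * max 0 t)"
      using K by (intro integral_exp_bound continuous_intros contG) auto
    moreover have "integral {0..max 0 t} (\<lambda>s. G y s - G z s) = integral {0..max 0 t} (G y) - integral {0..max 0 t} (G z)"
      by (intro integral_diff integrable_continuous_real contG)
    ultimately have "norm (P y t - P z t) \<le> exp (- (K * max 0 t)) * ((l * dist y z) / K * exp (K * max 0 t))"
      unfolding P_def scaleR_diff_right[symmetric] norm_scaleR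
      by (intro mult_mono) auto
    also have "\<dots> = 1/2 * dist y z" using K by (simp add: exp_minus K_def)
    finally show "dist (T y t) (T z t) \<le> 1/2 * dist y z" by (simp add: T dist_norm)
  qed
  obtain y where y: "T y = y"
    using banach_fix_type[of "1/2" T] contr by auto
  define x where "x t = x0 + integral {0..t} (G y)" for t
  have xG: "F (x t) = G y t" if "t \<ge> 0" for t
  proof -
    have "apply_bcontfun y t = P y t" using T[of y] y by simp
    then have "exp (K * t) *\<^sub>R y t = integral {0..t} (G y)"
      using that by (simp add: P_def exp_minus)
    then show ?thesis by (simp add: G_def x_def)
  qed
  have "solves F x {0..}"
    unfolding solves_def
  proof
    fix t :: real assume t: "t \<in> {0..}"
    have "(x has_vector_derivative 0 + G y t) (at t within {0..})"
      unfolding x_def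
      by (intro has_vector_derivative_add has_vector_derivative_const
            integral_has_vector_derivative_halfline contG) (use t in auto)
    then show "(x has_vector_derivative F (x t)) (at t within {0..})"
      using xG t by simp
  qed
  moreover have "x 0 = x0" by (simp add: x_def)
  ultimately show ?thesis by blast
qed

lemma ode_exists_global:
  fixes F :: "'a::{banach, real_inner} \<Rightarrow> 'a"
  assumes F: "L-lipschitz_on UNIV F"
  shows "\<exists>x. x 0 = x0 \<and> solves F x UNIV"
proof -
  obtain x where x: "x 0 = x0" "solves F x {0..}"
    using ode_exists_halfline[OF F] by blast
  have "\<exists>L. L-lipschitz_on UNIV (\<lambda>z. (-1) *\<^sub>R F z)" using lipschitz_on_cmult[OF F] by blast
  then obtain y where y: "y 0 = x0" "solves (\<lambda>z. (-1) *\<^sub>R F z) y {0..}"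
    using ode_exists_halfline by blast
  have "solves F (\<lambda>t. y (0 + (-1) * t)) {..0}"
    using solves_subset[OF solves_affine_time[OF y(2), of "-1" 0], of "{..0}"] by (simp add: subset_iff)
  from solves_glue[OF this x(2), of 0] x y
  have "solves F (\<lambda>t. if t \<le> 0 then y (0 + (-1) * t) else x t) ({..0} \<union> {0..})" by simp
  moreover have "{..0} \<union> {0..} = (UNIV :: real set)" by auto
  ultimately show ?thesis
    by (intro exI[of _ "\<lambda>t. if t \<le> 0 then y (0 + (-1) * t) else x t"]) (use y in auto)
qed

section \<open>Returns to a transversal\<close>

lemma solves_near:
  assumes "solves Y z A" "c \<in> A" "open N" "z c \<in> N"
  obtains \<tau> where "\<tau> > 0" "\<And>t. t \<in> A \<Longrightarrow> \<bar>t - c\<bar> < \<tau> \<Longrightarrow> z t \<in> N"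
proof -
  obtain e where e: "e > 0" "ball (z c) e \<subseteq> N" using assms(3,4) open_contains_ball by blast
  obtain \<tau> where "\<tau> > 0" "\<forall>t\<in>A. dist t c < \<tau> \<longrightarrow> dist (z t) (z c) < e"
    using solves_continuous[OF assms(1)] assms(2) e(1) unfolding continuous_on_iff by blast
  with e show thesis by (intro that[of \<tau>]) (auto simp: dist_real_def dist_commute subset_iff)
qed

text \<open>Near the origin the field points to the right and its slope is bounded by \<open>M\<close>, so trajectories move to the right
  inside cones of slope \<open>M\<close>.\<close>

lemma cone_estimate:
  fixes W :: "complex \<Rightarrow> complex"
  assumes W: "\<And>w. norm w < \<rho> \<Longrightarrow> Re (W w) > 0 \<and> \<bar>Im (W w)\<bar> \<le> M * Re (W w)"
    and z: "solves W z {a..c}" and ball: "\<And>t. t \<in> {a..c} \<Longrightarrow> norm (z t) < \<rho>" and ac: "a < c"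
  shows "Re (z a) < Re (z c)" "\<bar>Im (z c) - Im (z a)\<bar> \<le> M * (Re (z c) - Re (z a))"
proof -
  have dz: "(z has_vector_derivative W (z t)) (at t)" if "a < t" "t < c" for t
    by (rule solves_at[OF z, of "{a<..<c}"]) (use that in auto)
  have dR: "((\<lambda>t. Re (z t)) has_real_derivative Re (W (z t))) (at t)"
    and dI: "((\<lambda>t. Im (z t)) has_real_derivative Im (W (z t))) (at t)" if "a < t" "t < c" for t
    using bounded_linear.has_vector_derivative[OF bounded_linear_Re dz[OF that]]
      bounded_linear.has_vector_derivative[OF bounded_linear_Im dz[OF that]]
    by (auto simp: has_real_derivative_iff_has_vector_derivative)
  have cont: "continuous_on {a..c} z" using z by (rule solves_continuous)
  have Wz: "Re (W (z t)) > 0" "\<bar>Im (W (z t))\<bar> \<le> M * Re (W (z t))" if "a < t" "t < c" for t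
    using W[OF ball[of t]] that by auto
  show "Re (z a) < Re (z c)"
    by (rule DERIV_pos_imp_increasing_open[OF ac])
       (use dR Wz in \<open>auto intro!: continuous_intros cont\<close>)
  have "(\<lambda>t. M * Re (z t) - Im (z t)) a \<le> (\<lambda>t. M * Re (z t) - Im (z t)) c"
  proof (rule DERIV_nonneg_imp_increasing_open[where f = "\<lambda>t. M * Re (z t) - Im (z t)"])
    fix t assume t: "a < t" "t < c"
    show "\<exists>D. DERIV (\<lambda>t. M * Re (z t) - Im (z t)) t :> D \<and> 0 \<le> D"
      by (intro exI[of _ "M * Re (W (z t)) - Im (W (z t))"] conjI DERIV_diff DERIV_cmult dR dI t)
         (use Wz(2)[OF t] in linarith)
  qed (use ac in \<open>auto intro!: continuous_intros cont\<close>)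
  moreover have "(\<lambda>t. M * Re (z t) + Im (z t)) a \<le> (\<lambda>t. M * Re (z t) + Im (z t)) c"
  proof (rule DERIV_nonneg_imp_increasing_open[where f = "\<lambda>t. M * Re (z t) + Im (z t)"])
    fix t assume t: "a < t" "t < c"
    show "\<exists>D. DERIV (\<lambda>t. M * Re (z t) + Im (z t)) t :> D \<and> 0 \<le> D"
      by (intro exI[of _ "M * Re (W (z t)) + Im (W (z t))"] conjI DERIV_add DERIV_cmult dR dI t)
         (use Wz(2)[OF t] in linarith)
  qed (use ac in \<open>auto intro!: continuous_intros cont\<close>)
  ultimately show "\<bar>Im (z c) - Im (z a)\<bar> \<le> M * (Re (z c) - Re (z a))"
    by (simp add: algebra_simps abs_le_iff)
qed

text \<open>The Poincare-Bendixson argument, with the imaginary axis as transversal. The trajectory starts at \<open>0\<close>, and \<open>t1\<close> is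
  its first return to the segment between \<open>- \<i> s1\<close> and \<open>\<i> s1\<close>, at the upper end. The arc from \<open>0\<close> to \<open>\<i> s1\<close>
  closed by the segment \<open>L\<close> between these points is a Jordan curve \<open>J\<close>. The trajectory crosses the open segment
  \<open>L\<close> from left to right only. After \<open>t1\<close> it is on the component of the complement of \<open>J\<close> that touches \<open>L\<close>
  from the right. It cannot leave this component: it does not meet its own past, and \<open>L\<close> can only be
  crossed coming from the other component. The points of the transversal between \<open>- \<i> s1\<close> and \<open>0\<close> belong to that other component too, so no
  later return is closer to \<open>0\<close>.\<close>

lemma no_closer_return_above:
  fixes W :: "complex \<Rightarrow> complex"
  assumes W: "\<And>w. norm w < \<rho> \<Longrightarrow> Re (W w) > 0 \<and> \<bar>Im (W w)\<bar> \<le> M * Re (W w)"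
    and M: "M \<ge> 0" and z: "solves W z {0..b}" and z0: "z 0 = 0" and inj: "inj_on z {0..b}"
    and t1: "0 < t1" "t1 < b" and s1: "z t1 = \<i> * of_real s1" "0 < s1" "s1 < \<rho>"
    and first: "\<And>t. 0 < t \<Longrightarrow> t < t1 \<Longrightarrow> Re (z t) = 0 \<Longrightarrow> \<bar>Im (z t)\<bar> > s1"
    and zb: "Re (z b) = 0" "\<bar>Im (z b)\<bar> < s1"
  shows False
proof -
  have \<rho>: "\<rho> > 0" using s1 by simp
  have cont: "continuous_on {0..b} z" using z by (rule solves_continuous)
  have near: "\<exists>\<tau>>0. \<forall>t\<in>{0..b}. \<bar>t - c\<bar> < \<tau> \<longrightarrow> z t \<in> N" if "c \<in> {0..b}" "open N" "z c \<in> N" for c N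
    using solves_near[OF z that] by metis
  have opb: "open {w::complex. norm w < \<rho>}" by (intro open_Collect_less continuous_intros)
  obtain \<tau>0 where \<tau>0: "\<tau>0 > 0" "\<And>t. t \<in> {0..b} \<Longrightarrow> \<bar>t\<bar> < \<tau>0 \<Longrightarrow> norm (z t) < \<rho>"
    using near[OF _ opb, of 0] z0 \<rho> t1 by auto
  obtain \<tau>1 where \<tau>1: "\<tau>1 > 0" "\<And>t. t \<in> {0..b} \<Longrightarrow> \<bar>t - t1\<bar> < \<tau>1 \<Longrightarrow> norm (z t) < \<rho>"
    using near[OF _ opb, of t1] s1 t1 by (auto simp: norm_mult)
  \<comment> \<open>The arc is split into a starting piece and a final piece, which are controlled by cones, and a middle
    piece, which has positive distance from the transversal segment.\<close>
  define e where "e = min (min \<tau>0 \<tau>1) t1 / 2"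
  have e: "e > 0" "e < \<tau>0" "e < \<tau>1" "e < t1" using \<tau>0 \<tau>1 t1 by (auto simp: e_def)
  define mid where "mid = z ` {e..t1-e}"
  define L' where "L' = closed_segment (\<i> * of_real (-s1)) (\<i> * of_real s1)"
  define L where "L = closed_segment (\<i> * of_real s1) 0"
  have L': "w \<in> L' \<longleftrightarrow> Re w = 0 \<and> \<bar>Im w\<bar> \<le> s1" for w
  proof
    assume "w \<in> L'"
    then obtain u where u: "0 \<le> u" "u \<le> 1" "w = (1 - u) *\<^sub>R (\<i> * of_real (-s1)) + u *\<^sub>R (\<i> * of_real s1)"
      by (auto simp: L'_def in_segment)
    have "u * s1 \<le> s1" "u * s1 \<ge> 0" using u s1 by (auto intro: mult_left_le_one_le)
    moreover have "Re w = 0" "Im w = (1 - u) * (-s1) + u * s1" by (simp_all add: u(3))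
    ultimately show "Re w = 0 \<and> \<bar>Im w\<bar> \<le> s1" by (auto simp: algebra_simps)
  next
    assume "Re w = 0 \<and> \<bar>Im w\<bar> \<le> s1"
    then show "w \<in> L'" unfolding L'_def in_segment using s1
      by (intro exI[of _ "(Im w + s1) / (2 * s1)"]) (auto simp: complex_eq_iff field_simps)
  qed
  have L: "w \<in> L \<longleftrightarrow> Re w = 0 \<and> 0 \<le> Im w \<and> Im w \<le> s1" for w
  proof
    assume "w \<in> L"
    then obtain u where u: "0 \<le> u" "u \<le> 1" "w = (1 - u) *\<^sub>R (\<i> * of_real s1) + u *\<^sub>R 0"
      unfolding L_def in_segment by blast
    have "u * s1 \<le> s1" "u * s1 \<ge> 0" using u s1 by (auto intro: mult_left_le_one_le)
    moreover have "Re w = 0" "Im w = (1 - u) * s1" by (simp_all add: u(3))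
    ultimately show "Re w = 0 \<and> 0 \<le> Im w \<and> Im w \<le> s1" by (auto simp: algebra_simps)
  next
    assume "Re w = 0 \<and> 0 \<le> Im w \<and> Im w \<le> s1"
    then show "w \<in> L" unfolding L_def in_segment using s1
      by (intro exI[of _ "1 - Im w / s1"]) (auto simp: complex_eq_iff field_simps)
  qed
  have "z t \<notin> L'" if "t \<in> {e..t1-e}" for t
    using first[of t] e that by (auto simp: L')
  then have "mid \<inter> L' = {}" by (auto simp: mid_def)
  moreover have "compact mid"
    unfolding mid_def
    by (intro compact_continuous_image continuous_on_subset[OF cont]) (use e t1 in auto)
  ultimately obtain d where d: "d > 0" "\<And>x y. x \<in> mid \<Longrightarrow> y \<in> L' \<Longrightarrow> d \<le> dist x y"
    using separate_compact_closed[of mid L'] by (force simp: L'_def)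
  \<comment> \<open>The width \<open>\<delta>\<close> of the strips around the segment: small against the distance \<open>d\<close> to the middle piece, and small
    enough for cones of slope \<open>M\<close> over the base \<open>\<delta>\<close> to be lower than half of \<open>L\<close>.\<close>
  define \<delta> where "\<delta> = min (d / 2) (s1 / (2 * (M + 1)))"
  have \<delta>: "\<delta> > 0" "2 * \<delta> \<le> d" "(M + 1) * \<delta> \<le> s1 / 2"
  proof -
    show "\<delta> > 0" "2 * \<delta> \<le> d" using d s1 M by (auto simp: \<delta>_def)
    have "(M + 1) * \<delta> \<le> (M + 1) * (s1 / (2 * (M + 1)))"
      using M by (intro mult_left_mono) (auto simp: \<delta>_def)
    also have "\<dots> = s1 / 2" using M by (simp add: divide_simps)
    finally show "(M + 1) * \<delta> \<le> s1 / 2" .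
  qed
  have M\<delta>: "M * \<delta> \<ge> 0" "M * \<delta> + \<delta> \<le> s1 / 2" using M \<delta> by (auto simp: algebra_simps)
  have notmid: "w \<notin> mid" if "\<bar>Re w\<bar> < \<delta>" "-s1-\<delta> < Im w" "Im w < s1 + \<delta>" for w
  proof
    assume w: "w \<in> mid"
    define y where "y = \<i> * of_real (max (-s1) (min s1 (Im w)))"
    have "y \<in> L'" using s1 by (auto simp: L' y_def)
    then have "d \<le> dist w y" using d(2) w by blast
    also have "\<dots> \<le> \<bar>Re (w - y)\<bar> + \<bar>Im (w - y)\<bar>" unfolding dist_norm by (rule cmod_le)
    also have "\<dots> < \<delta> + \<delta>" using that s1 \<delta> by (intro add_strict_mono) (auto simp: y_def)
    finally show False using \<delta> by simp
  qed
  \<comment> \<open>\<open>R\<close> lies to the right of \<open>L\<close>, above the cone that contains the departing arc. \<open>F1\<close> lies to the left of \<open>L\<close>,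
    below the cone that contains the arriving arc, and \<open>F2\<close> surrounds the part of the transversal between \<open>- \<i> s1\<close> and \<open>0\<close>. All three
    avoid \<open>J\<close>, and \<open>F1\<close> and \<open>F2\<close> overlap, so each of \<open>R\<close> and \<open>F1 \<union> F2\<close> lies in one component.\<close>
  define R where "R = {w. 0 < Re w \<and> Re w < \<delta> \<and> M * Re w < Im w \<and> Im w < s1 + \<delta>}"
  define F1 where "F1 = {w. -\<delta> < Re w \<and> Re w < 0 \<and> -\<delta> < Im w \<and> Im w < s1 + M * Re w}"
  define F2 where "F2 = {w. -\<delta> < Re w \<and> Re w < \<delta> \<and> -s1 < Im w \<and> Im w < - (M * Re w) \<and> Im w < M * Re w}"
  define J where "J = z ` {0..t1} \<union> L"
  have J_cases: "w \<in> mid \<or> (0 \<le> Re w \<and> \<bar>Im w\<bar> \<le> M * Re w) \<or> (Re w \<le> 0 \<and> \<bar>Im w - s1\<bar> \<le> M * (- Re w)) \<or> w \<in> L"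
    if wJ: "w \<in> J" for w
  proof (cases "w \<in> L")
    case False
    then obtain t where t: "t \<in> {0..t1}" "w = z t" using wJ by (auto simp: J_def)
    consider "t = 0" | "0 < t" "t \<le> e" | "e \<le> t" "t \<le> t1 - e" | "t1 - e \<le> t" "t < t1" | "t = t1"
      using t by fastforce
    then show ?thesis
    proof cases
      case 2
      have nb: "norm (z s) < \<rho>" if "s \<in> {0..t}" for s
        using \<tau>0(2)[of s] that 2 t1 e by auto
      have "Re (z 0) < Re (z t)"
        by (rule cone_estimate(1)[OF W solves_subset[OF z] nb]) (use 2 t1 e in auto)
      moreover have "\<bar>Im (z t) - Im (z 0)\<bar> \<le> M * (Re (z t) - Re (z 0))"
        by (rule cone_estimate(2)[OF W solves_subset[OF z] nb]) (use 2 t1 e in auto)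
      ultimately show ?thesis using t z0 by simp
    next
      case 4
      have nb: "norm (z s) < \<rho>" if "s \<in> {t..t1}" for s
        using \<tau>1(2)[of s] that 4 t1 t e by auto
      have "Re (z t) < Re (z t1)"
        by (rule cone_estimate(1)[OF W solves_subset[OF z] nb]) (use 4 t t1 e in auto)
      moreover have "\<bar>Im (z t1) - Im (z t)\<bar> \<le> M * (Re (z t1) - Re (z t))"
        by (rule cone_estimate(2)[OF W solves_subset[OF z] nb]) (use 4 t t1 e in auto)
      ultimately show ?thesis using t s1 by (simp add: abs_minus_commute)
    qed (use t z0 s1 in \<open>auto simp: mid_def\<close>)
  qed auto
  have RJ: "R \<inter> J = {}"
  proof (rule ccontr)
    assume "R \<inter> J \<noteq> {}"
    then obtain w where w: "w \<in> R" "w \<in> J" by blast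
    have "w \<notin> mid" by (rule notmid) (use w s1 \<delta> mult_nonneg_nonneg[OF M, of "Re w"] in \<open>auto simp: R_def\<close>)
    with J_cases[OF w(2)] w(1) L show False by (auto simp: R_def)
  qed
  have F1J: "F1 \<inter> J = {}"
  proof (rule ccontr)
    assume "F1 \<inter> J \<noteq> {}"
    then obtain w where w: "w \<in> F1" "w \<in> J" by blast
    have "w \<notin> mid" by (rule notmid) (use w s1 \<delta> mult_nonneg_nonneg[OF M, of "- Re w"] in \<open>auto simp: F1_def\<close>)
    with J_cases[OF w(2)] w(1) L show False by (auto simp: F1_def)
  qed
  have F2J: "F2 \<inter> J = {}"
  proof (rule ccontr)
    assume "F2 \<inter> J \<noteq> {}"
    then obtain w where w: "w \<in> F2" "w \<in> J" by blast
    have neg: "Im w < 0"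
      using w(1) mult_nonneg_nonneg[OF M, of "Re w"] mult_nonneg_nonneg[OF M, of "- Re w"]
      by (cases "Re w \<ge> 0") (auto simp: F2_def)
    have "w \<notin> mid" by (rule notmid) (use w s1 \<delta> neg in \<open>auto simp: F2_def\<close>)
    with J_cases[OF w(2)] w(1) L neg s1 show False by (auto simp: F2_def)
  qed
  have convR: "convex R"
  proof -
    have "R = {w. 0 < Re w} \<inter> {w. Re w < \<delta>} \<inter> {w. M * Re w - Im w < 0} \<inter> {w. Im w < s1 + \<delta>}"
      by (auto simp: R_def)
    moreover have "{w. M * Re w - Im w < 0} = {w. inner (Complex M (-1)) w < 0}" by (simp add: inner_complex_def)
    ultimately show ?thesis
      by (auto intro!: convex_Int convex_halfspace_Re_gt convex_halfspace_Re_lt convex_halfspace_Im_lt convex_halfspace_lt)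
  qed
  have convF1: "convex F1"
  proof -
    have "F1 = {w. -\<delta> < Re w} \<inter> {w. Re w < 0} \<inter> {w. -\<delta> < Im w} \<inter> {w. inner (Complex (-M) 1) w < s1}"
      by (auto simp: F1_def inner_complex_def)
    then show ?thesis
      by (auto intro!: convex_Int convex_halfspace_Re_gt convex_halfspace_Re_lt convex_halfspace_Im_gt convex_halfspace_lt)
  qed
  have convF2: "convex F2"
  proof -
    have "F2 = {w. -\<delta> < Re w} \<inter> {w. Re w < \<delta>} \<inter> {w. -s1 < Im w} \<inter> {w. inner (Complex M 1) w < 0}
        \<inter> {w. inner (Complex (-M) 1) w < 0}"
      by (auto simp: F2_def inner_complex_def)
    then show ?thesis
      by (auto intro!: convex_Int convex_halfspace_Re_gt convex_halfspace_Re_lt convex_halfspace_Im_gt convex_halfspace_lt)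
  qed
  define F where "F = F1 \<union> F2"
  have FJ: "F \<inter> J = {}" using F1J F2J by (auto simp: F_def)
  have connF: "connected F"
  proof -
    define x where "x = \<delta> / (2 * (M + 1))"
    have x: "0 < x" "x \<le> \<delta> / 2" "M * x < \<delta> / 2"
      using \<delta> M by (auto simp: x_def divide_simps algebra_simps)
    have Mx: "M * x \<ge> 0" using x M by simp
    have \<delta>s1: "2 * \<delta> \<le> s1" using M\<delta> by linarith
    have "Complex (-x) (-\<delta>/2) \<in> F1 \<inter> F2"
      using x \<delta>(1) M\<delta>(2) \<delta>s1 Mx s1 by (simp add: F1_def F2_def)
    then show ?thesis unfolding F_def
      using convF1 convF2 by (intro connected_Un convex_connected) auto
  qed
  define g where "g = (\<lambda>u. z (t1 * u))"
  define c where "c = g +++ linepath (\<i> * of_real s1) 0"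
  have pg: "path_image g = z ` {0..t1}"
  proof -
    have "(\<lambda>u. t1 * u) ` {0..1} = {0..t1}" using t1 by (simp add: image_mult_atLeastAtMost)
    then show ?thesis unfolding path_image_def g_def by (metis image_image)
  qed
  have scaled: "t1 * u \<in> {0..b}" if "u \<in> {0..1}" for u
  proof -
    have "t1 * u \<le> t1 * 1" using t1 that by (intro mult_left_mono) auto
    moreover have "0 \<le> t1 * u" using t1 that by simp
    ultimately show ?thesis unfolding atLeastAtMost_iff using t1 by linarith
  qed
  have arcg: "arc g"
    unfolding arc_def path_def g_def
  proof
    show "continuous_on {0..1} (\<lambda>u. z (t1 * u))"
      by (rule continuous_on_compose2[OF cont]) (use scaled in \<open>auto intro!: continuous_intros\<close>)
    show "inj_on (\<lambda>u. z (t1 * u)) {0..1}"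
    proof (rule inj_onI)
      fix u v :: real assume uv: "u \<in> {0..1}" "v \<in> {0..1}" "z (t1 * u) = z (t1 * v)"
      then have "t1 * u \<in> {0..b}" "t1 * v \<in> {0..b}"
        using scaled[of u] scaled[of v] by auto
      then have "t1 * u = t1 * v" using inj uv(3) by (auto dest: inj_onD)
      then show "u = v" using t1 by simp
    qed
  qed
  have gL: "path_image g \<inter> L \<subseteq> {z 0, z t1}"
  proof
    fix w assume "w \<in> path_image g \<inter> L"
    then obtain t where t: "t \<in> {0..t1}" "w = z t" "w \<in> L" by (auto simp: pg)
    then have "Re (z t) = 0" "\<bar>Im (z t)\<bar> \<le> s1" using L by auto
    then have "\<not> (0 < t \<and> t < t1)" using first[of t] by auto
    then have "t = 0 \<or> t = t1" using t by auto
    then show "w \<in> {z 0, z t1}" using t by auto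
  qed
  have gs: "pathstart g = z 0" "pathfinish g = z t1" by (simp_all add: pathstart_def pathfinish_def g_def)
  have sc: "simple_path c" unfolding c_def
  proof (rule simple_path_join_loop[OF arcg])
    show "arc (linepath (\<i> * of_real s1) (0::complex))" using s1 by (intro arc_linepath) auto
    show "path_image g \<inter> path_image (linepath (\<i> * of_real s1) 0) \<subseteq> {pathstart g, pathstart (linepath (\<i> * of_real s1) 0)}"
      using gL s1 z0 by (simp add: L_def gs)
  qed (simp_all add: gs s1 z0)
  have pc: "path_image c = J"
    unfolding c_def J_def
    by (subst path_image_join) (simp_all add: pg L_def gs s1)
  have "pathfinish c = pathstart c"
    by (simp add: c_def gs z0)
  note JIO = Jordan_inside_outside[OF sc this, unfolded pc]
  have split: "S \<subseteq> inside J \<or> S \<subseteq> outside J" if "connected S" "S \<inter> J = {}" for S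
    using connectedD[OF that(1), of "inside J" "outside J"] JIO that(2) by blast
  \<comment> \<open>The two components are different: both have the midpoint of \<open>L\<close> in their frontier, and a small ball
    around it is covered by \<open>R\<close>, \<open>F\<close> and \<open>J\<close>.\<close>
  have "\<exists>U V. R \<subseteq> U \<and> F \<subseteq> V \<and> open U \<and> open V \<and> U \<inter> V = {} \<and> U \<union> V = - J"
  proof -
    define m where "m = \<i> * of_real (s1 / 2)"
    have m: "m \<in> J" using s1 by (auto simp: J_def L m_def)
    have ball: "w \<in> R \<union> F \<union> J" if "dist m w < \<delta>" for w
    proof -
      have Re: "\<bar>Re w\<bar> < \<delta>"
        using le_less_trans[OF abs_Re_le_cmod[of "m - w"]] that by (simp add: dist_norm m_def)
      have Im: "\<bar>Im w - s1/2\<bar> < \<delta>"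
        using le_less_trans[OF abs_Im_le_cmod[of "m - w"]] that by (simp add: dist_norm m_def abs_minus_commute)
      have le: "M * \<bar>Re w\<bar> \<le> M * \<delta>" using Re M by (intro mult_left_mono) auto
      consider "Re w > 0" | "Re w = 0" | "Re w < 0" by linarith
      then show ?thesis
      proof cases
        case 1 then have "w \<in> R" using Re Im le M\<delta> \<delta> s1 by (auto simp: R_def abs_less_iff)
        then show ?thesis by simp
      next
        case 2 then have "w \<in> L" using Re Im le M\<delta> \<delta> s1 unfolding L abs_less_iff by auto
        then show ?thesis by (simp add: J_def)
      next
        case 3 then have "w \<in> F1" using Re Im le M\<delta> \<delta> s1 by (auto simp: F1_def abs_less_iff)
        then show ?thesis by (simp add: F_def)
      qed
    qed
    have "inside J \<inter> (R \<union> F) \<noteq> {}"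
    proof -
      have "m \<in> closure (inside J)" using m JIO frontier_def by blast
      then obtain w where "w \<in> inside J" "dist w m < \<delta>" using \<delta> closure_approachable by blast
      moreover from this have "w \<notin> J" using JIO by blast
      ultimately show ?thesis using ball[of w] by (auto simp: dist_commute)
    qed
    moreover have "outside J \<inter> (R \<union> F) \<noteq> {}"
    proof -
      have "m \<in> closure (outside J)" using m JIO frontier_def by blast
      then obtain w where "w \<in> outside J" "dist w m < \<delta>" using \<delta> closure_approachable by blast
      moreover from this have "w \<notin> J" using JIO by blast
      ultimately show ?thesis using ball[of w] by (auto simp: dist_commute)
    qed
    moreover have "R \<subseteq> inside J \<or> R \<subseteq> outside J" using split[OF convex_connected[OF convR] RJ] .
    moreover have "F \<subseteq> inside J \<or> F \<subseteq> outside J" using split[OF connF FJ] .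
    ultimately consider "R \<subseteq> inside J" "F \<subseteq> outside J" | "R \<subseteq> outside J" "F \<subseteq> inside J"
      using JIO by blast
    then show ?thesis
    proof cases
      case 1 then show ?thesis using JIO by (intro exI[of _ "inside J"] exI[of _ "outside J"]) simp
    next
      case 2 then show ?thesis using JIO
        by (intro exI[of _ "outside J"] exI[of _ "inside J"]) (simp add: Int_commute Un_commute)
    qed
  qed
  then obtain U V where UV: "R \<subseteq> U" "F \<subseteq> V" "open U" "open V" "U \<inter> V = {}" "U \<union> V = - J" by blast
  define N where "N = {w. norm w < \<rho> \<and> Re w < \<delta> \<and> M * Re w < Im w \<and> Im w < s1 + \<delta>}"
  have "open N" unfolding N_def by (intro open_Collect_conj open_Collect_less continuous_intros)
  moreover have "z t1 \<in> N" using s1 \<delta> by (auto simp: N_def norm_mult)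
  ultimately obtain \<tau> where \<tau>: "\<tau> > 0" "\<And>t. t \<in> {0..b} \<Longrightarrow> \<bar>t - t1\<bar> < \<tau> \<Longrightarrow> z t \<in> N"
    using near[of t1 N] t1 by auto
  \<comment> \<open>Right after \<open>t1\<close> the trajectory is in \<open>U\<close>, whereas \<open>z b\<close> is not. The contradiction arises at the first time \<open>t2\<close>
    at which it is not in \<open>U\<close>, where it must meet \<open>L\<close>, coming from \<open>F1\<close>.\<close>
  have startR: "z t \<in> R" if t: "t1 < t" "t < t1 + \<tau>" "t \<le> b" for t
  proof -
    have "Re (z t1) < Re (z t)"
      by (rule cone_estimate(1)[OF W solves_subset[OF z]]) (use t t1 \<tau> in \<open>auto simp: N_def\<close>)
    then show ?thesis using \<tau>(2)[of t] t t1 s1 by (auto simp: N_def R_def)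
  qed
  define h where "h = t1 + min \<tau> (b - t1) / 2"
  have h: "t1 < h" "h < t1 + \<tau>" "h \<le> b" using \<tau> t1 by (auto simp: h_def min_def field_simps)
  have zbU: "z b \<notin> U"
  proof (cases "Im (z b) \<ge> 0")
    case True
    then have "z b \<in> L" using zb unfolding L by auto
    then show ?thesis using UV by (auto simp: J_def)
  next
    case False
    then have "z b \<in> F2" using zb \<delta> by (auto simp: F2_def)
    then show ?thesis using UV by (auto simp: F_def)
  qed
  define E where "E = {h..b} \<inter> z -` (- U)"
  have "closed E" unfolding E_def
    by (intro continuous_closed_preimage continuous_on_subset[OF cont]) (use UV h t1 in auto)
  moreover have "b \<in> E" using zbU h by (auto simp: E_def)
  moreover have bdd: "bdd_below E" by (auto simp: E_def intro!: bdd_belowI[of _ h])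
  ultimately have t2E: "Inf E \<in> E" by (intro closed_contains_Inf) auto
  define t2 where "t2 = Inf E"
  have t2: "h \<le> t2" "t2 \<le> b" "z t2 \<notin> U" using t2E by (auto simp: E_def t2_def)
  have hU: "z h \<in> U" using startR[OF h] UV by auto
  then have t2h: "h < t2" using t2 by (cases "h = t2") auto
  have before: "z t \<in> U" if "h \<le> t" "t < t2" for t
  proof (rule ccontr)
    assume "z t \<notin> U"
    then have "t \<in> E" using that t2 by (auto simp: E_def)
    then show False using cInf_lower[OF _ bdd] that t2_def by fastforce
  qed
  have leftU: "\<exists>t. h \<le> t \<and> t < t2 \<and> t2 - t < \<epsilon>" if "\<epsilon> > 0" for \<epsilon>
    using that t2h by (intro exI[of _ "max h (t2 - \<epsilon> / 2)"]) auto
  have "z t2 \<notin> V"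
  proof
    assume "z t2 \<in> V"
    then obtain \<epsilon> where \<epsilon>: "\<epsilon> > 0" "\<forall>t\<in>{0..b}. \<bar>t - t2\<bar> < \<epsilon> \<longrightarrow> z t \<in> V"
      using near[of t2 V] UV t2 h t1 by auto
    then obtain t where "h \<le> t" "t < t2" "t2 - t < \<epsilon>" using leftU by blast
    then have "z t \<in> U" "z t \<in> V" using before[of t] \<epsilon> t2 h t1 by auto
    then show False using UV by auto
  qed
  then have "z t2 \<in> J" using t2 UV by blast
  moreover have "z t2 \<notin> z ` {0..t1}"
    using inj t2 h t1 by (auto dest!: inj_onD)
  ultimately have t2L: "z t2 \<in> L" by (auto simp: J_def)
  have "z t2 \<noteq> z t1" using inj_onD[OF inj, of t2 t1] t2 h t1 by auto
  then have "Im (z t2) \<noteq> s1" using t2L s1 by (auto simp: L complex_eq_iff)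
  then have Im2: "Re (z t2) = 0" "0 \<le> Im (z t2)" "Im (z t2) < s1" using t2L by (auto simp: L)
  define N' where "N' = {w. norm w < \<rho> \<and> -\<delta> < Re w \<and> -\<delta> < Im w \<and> Im w < s1 + M * Re w}"
  have "open N'" unfolding N'_def by (intro open_Collect_conj open_Collect_less continuous_intros)
  moreover have "z t2 \<in> N'"
    using Im2 s1 \<delta> cmod_le[of "z t2"] by (auto simp: N'_def)
  ultimately obtain \<epsilon> where \<epsilon>: "\<epsilon> > 0" "\<forall>t\<in>{0..b}. \<bar>t - t2\<bar> < \<epsilon> \<longrightarrow> z t \<in> N'"
    using near[of t2 N'] t2 h t1 by auto
  then obtain t where t: "h \<le> t" "t < t2" "t2 - t < \<epsilon>" using leftU by blast
  have "Re (z t) < Re (z t2)"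
    by (rule cone_estimate(1)[OF W solves_subset[OF z]]) (use t t2 h t1 \<epsilon> in \<open>auto simp: N'_def\<close>)
  then have "z t \<in> F1" using \<epsilon>(2) t t2 h t1 Im2 by (auto simp: N'_def F1_def)
  then show False using before[of t] t UV by (auto simp: F_def)
qed

text \<open>Complex conjugation reduces a first return below the origin to one above it.\<close>

lemma no_closer_return:
  fixes W :: "complex \<Rightarrow> complex"
  assumes W: "\<And>w. norm w < \<rho> \<Longrightarrow> Re (W w) > 0 \<and> \<bar>Im (W w)\<bar> \<le> M * Re (W w)"
    and M: "M \<ge> 0" and z: "solves W z {0..b}" and z0: "z 0 = 0" and inj: "inj_on z {0..b}"
    and t1: "0 < t1" "t1 < b" and zt1: "Re (z t1) = 0" "\<bar>Im (z t1)\<bar> < \<rho>"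
    and first: "\<And>t. 0 < t \<Longrightarrow> t < t1 \<Longrightarrow> Re (z t) = 0 \<Longrightarrow> \<bar>Im (z t)\<bar> > \<bar>Im (z t1)\<bar>"
    and zb: "Re (z b) = 0" "\<bar>Im (z b)\<bar> < \<bar>Im (z t1)\<bar>"
  shows False
proof (cases "Im (z t1) > 0")
  case True
  show False
  proof (rule no_closer_return_above[where ?s1.0 = "Im (z t1)", OF W M z z0 inj t1])
    show "z t1 = \<i> * of_real (Im (z t1))" using zt1 by (simp add: complex_eq_iff)
    show "Im (z t1) < \<bar>Im (z t)\<bar>" if "0 < t" "t < t1" "Re (z t) = 0" for t
      using first[OF that] True by simp
    show "0 < Im (z t1)" by (rule True)
    show "Im (z t1) < \<rho>" using True zt1(2) by simp
    show "Re (z b) = 0" by (rule zb(1))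
    show "\<bar>Im (z b)\<bar> < Im (z t1)" using zb(2) True by simp
  qed
next
  case False
  then have neg: "Im (z t1) < 0" using zb(2) by auto
  have c: "solves (\<lambda>w. cnj (W (cnj w))) (\<lambda>t. cnj (z t) + 0) {0..b}"
    by (rule solves_affine_image[OF z bounded_linear_cnj]) simp
  show False
  proof (rule no_closer_return_above[where ?s1.0 = "- Im (z t1)" and \<rho> = \<rho>, OF _ M c _ _ t1])
    show "Re (cnj (W (cnj w))) > 0 \<and> \<bar>Im (cnj (W (cnj w)))\<bar> \<le> M * Re (cnj (W (cnj w)))"
      if "norm w < \<rho>" for w
      using W[of "cnj w"] that by simp
    show "inj_on (\<lambda>t. cnj (z t) + 0) {0..b}" 
      by (rule inj_onI) (use inj_onD[OF inj] in simp)
    show "cnj (z t1) + 0 = \<i> * of_real (- Im (z t1))" using zt1 by (simp add: complex_eq_iff)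
    show "- Im (z t1) < \<bar>Im (cnj (z t) + 0)\<bar>" if "0 < t" "t < t1" "Re (cnj (z t) + 0) = 0" for t
      using first[of t] that neg by simp
    show "cnj (z 0) + 0 = 0" using z0 by simp
    show "0 < - Im (z t1)" using neg by simp
    show "- Im (z t1) < \<rho>" using neg zt1(2) by simp
    show "Re (cnj (z b) + 0) = 0" using zb(1) by simp
    show "\<bar>Im (cnj (z b) + 0)\<bar> < - Im (z t1)" using zb(2) neg by simp
  qed
qed

lemma solves_speed_bound:
  fixes x :: "real \<Rightarrow> 'a::euclidean_space"
  assumes x: "solves F x {a..c}" and B: "\<And>t. t \<in> {a..c} \<Longrightarrow> norm (F (x t)) \<le> B"
    and s: "s \<in> {a..c}" and t: "t \<in> {a..c}"
  shows "norm (x t - x s) \<le> B * \<bar>t - s\<bar>"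
proof -
  have "norm (x t - x s) \<le> B * norm (t - s)"
  proof (rule differentiable_bound[OF convex_real_interval(5)])
    show "(x has_derivative (\<lambda>h. h *\<^sub>R F (x u))) (at u within {a..c})" if "u \<in> {a..c}" for u
      using x that by (simp add: solves_def has_vector_derivative_def)
    show "onorm (\<lambda>h. h *\<^sub>R F (x u)) \<le> B" if "u \<in> {a..c}" for u
      using B[OF that] by (intro onorm_le) (simp add: mult.commute[of B] mult_left_mono)
  qed (use s t in auto)
  then show ?thesis by simp
qed

text \<open>Precomposing with the projection to a ball makes a locally Lipschitz field globally Lipschitz and does not
  change it on the ball. Its solutions exist for all time and solve the original equation as long as they stay in the ball.\<close>

lemma lipschitz_clamp:
  fixes Y :: "'a::euclidean_space \<Rightarrow> 'a"
  assumes Y: "locally_lipschitz Y" and r: "r > 0"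
  obtains L where "L-lipschitz_on UNIV (\<lambda>x. Y (closest_point (cball p r) x))"
proof -
  obtain L where L: "L-lipschitz_on (cball 0 (norm p + r)) Y"
    using Y unfolding locally_lipschitz_def by blast
  have sub: "cball p r \<subseteq> cball 0 (norm p + r)"
  proof
    fix x assume "x \<in> cball p r"
    then have "norm (x - p) \<le> r" by (simp add: dist_norm norm_minus_commute)
    then show "x \<in> cball 0 (norm p + r)" using norm_triangle_sub[of x p] by simp
  qed
  have cp: "closest_point (cball p r) x \<in> cball p r" for x
    using r by (intro closest_point_in_set) auto
  have "L-lipschitz_on UNIV (\<lambda>x. Y (closest_point (cball p r) x))"
  proof (rule lipschitz_onI)
    show "L \<ge> 0" using L by (rule lipschitz_on_nonneg)
    fix x y
    have "dist (Y (closest_point (cball p r) x)) (Y (closest_point (cball p r) y))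
        \<le> L * dist (closest_point (cball p r) x) (closest_point (cball p r) y)"
      by (rule lipschitz_onD[OF L subsetD[OF sub cp] subsetD[OF sub cp]])
    also have "\<dots> \<le> L * dist x y"
      using r \<open>L \<ge> 0\<close> by (intro mult_left_mono closest_point_lipschitz) auto
    finally show "dist (Y (closest_point (cball p r) x)) (Y (closest_point (cball p r) y)) \<le> L * dist x y" .
  qed
  then show thesis by (rule that)
qed

lemma clamped_global_solution:
  fixes Y :: "'a::euclidean_space \<Rightarrow> 'a"
  assumes "locally_lipschitz Y" "r > 0"
  shows "\<exists>x. x 0 = q \<and> solves (\<lambda>x. Y (closest_point (cball p r) x)) x UNIV"
proof -
  obtain L where "L-lipschitz_on UNIV (\<lambda>x. Y (closest_point (cball p r) x))"
    by (rule lipschitz_clamp[OF assms])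
  then show ?thesis by (rule ode_exists_global)
qed

lemma locally_lipschitz_clamp:
  fixes Y :: "'a::euclidean_space \<Rightarrow> 'a"
  assumes "locally_lipschitz Y" "r > 0"
  shows "locally_lipschitz (\<lambda>x. Y (closest_point (cball p r) x))"
proof -
  obtain L where "L-lipschitz_on UNIV (\<lambda>x. Y (closest_point (cball p r) x))"
    by (rule lipschitz_clamp[OF assms])
  then have "L-lipschitz_on (cball 0 R) (\<lambda>x. Y (closest_point (cball p r) x))" for R
    by (rule lipschitz_on_subset) simp
  then show ?thesis unfolding locally_lipschitz_def by blast
qed

text \<open>The time \<open>T\<close> of existence is the same for all starting points in the half-sized ball: moving with speed at most \<open>B\<close>,
  the solution of the clamped equation needs longer than that to leave the ball.\<close>

lemma local_solution:
  fixes Y :: "'a::euclidean_space \<Rightarrow> 'a"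
  assumes Y: "locally_lipschitz Y" and r: "r > 0" and B: "B > 0" "\<And>x. x \<in> cball p r \<Longrightarrow> norm (Y x) \<le> B"
    and q: "norm (q - p) < r / 2" and T: "0 < T" "T \<le> r / (2 * B)"
  obtains x where "x 0 = q" "solves Y x {-T..T}" "\<And>t. t \<in> {-T..T} \<Longrightarrow> norm (x t - p) < r"
proof -
  define F where "F = (\<lambda>x. Y (closest_point (cball p r) x))"
  have cp: "closest_point (cball p r) x \<in> cball p r" for x
    using r by (intro closest_point_in_set) auto
  obtain x where x: "x 0 = q" "solves F x UNIV"
    unfolding F_def using clamped_global_solution[OF Y r, of q p] by (elim exE conjE)
  have near: "norm (x t - p) < r" if t: "t \<in> {-T..T}" for t
  proof -
    have "norm (x t - x 0) \<le> B * \<bar>t - 0\<bar>"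
      by (rule solves_speed_bound[OF solves_subset[OF x(2)], of "-T" T])
         (use t T B(2)[OF cp] in \<open>auto simp: F_def\<close>)
    also have "\<dots> \<le> B * T" using t B by (intro mult_left_mono) auto
    also have "\<dots> \<le> r / 2" using T B by (simp add: field_simps)
    finally have "norm (x t - q) \<le> r / 2" using x by simp
    then show ?thesis using q norm_triangle_ineq[of "x t - q" "q - p"] by simp
  qed
  have "solves Y x {-T..T}"
    unfolding solves_def
  proof
    fix t assume t: "t \<in> {-T..T}"
    have "x t \<in> cball p r" using near[OF t] by (simp add: dist_norm norm_minus_commute)
    then have "F (x t) = Y (x t)" by (simp add: F_def closest_point_self)
    moreover have "(x has_vector_derivative F (x t)) (at t within {-T..T})"
      using solves_subset[OF x(2), of "{-T..T}"] t by (simp add: solves_def)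
    ultimately show "(x has_vector_derivative Y (x t)) (at t within {-T..T})" by simp
  qed
  then show thesis by (rule that[of x, OF x(1) _ near])
qed

text \<open>Returns arbitrarily close to \<open>0\<close> are impossible without periodicity. The solutions \<open>v\<close> may be different for different \<open>\<rho>'\<close>, but by
  uniqueness all of them continue each other. One return determines a first return \<open>t1\<close> to a segment, and a
  return closer than that contradicts \<open>no_closer_return\<close>.\<close>

lemma first_return_contradiction:
  fixes W :: "complex \<Rightarrow> complex"
  assumes lip: "locally_lipschitz W"
    and W: "\<And>w. norm w < \<rho> \<Longrightarrow> Re (W w) > 0 \<and> \<bar>Im (W w)\<bar> \<le> M * Re (W w)"
    and M: "M \<ge> 0" and \<rho>: "\<rho> > 0"
    and returns: "\<And>\<rho>'. \<rho>' > 0 \<Longrightarrow> \<exists>v b. b > 0 \<and> solves W v {0..b} \<and> v 0 = 0 \<and> inj_on v {0..b} \<and>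
        Re (v b) = 0 \<and> \<bar>Im (v b)\<bar> < \<rho>'"
  shows False
proof -
  obtain v1 b1 where v1: "b1 > 0" "solves W v1 {0..b1}" "v1 0 = 0" "inj_on v1 {0..b1}"
      "Re (v1 b1) = 0" "\<bar>Im (v1 b1)\<bar> < \<rho>"
    using returns[OF \<rho>] by blast
  have cont: "continuous_on {0..b1} v1" using v1(2) by (rule solves_continuous)
  have "open {w::complex. norm w < \<rho>}" by (intro open_Collect_less continuous_intros)
  then obtain \<tau> where \<tau>: "\<tau> > 0" "\<And>t. t \<in> {0..b1} \<Longrightarrow> \<bar>t - 0\<bar> < \<tau> \<Longrightarrow> v1 t \<in> {w. norm w < \<rho>}"
    using solves_near[OF v1(2), of 0 "{w. norm w < \<rho>}"] v1 \<rho> by auto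
  have pos: "Re (v1 t) > 0" if t: "0 < t" "t < \<tau>" "t \<le> b1" for t
    using cone_estimate(1)[OF W solves_subset[OF v1(2), of "{0..t}"]] \<tau>(2) t v1(3) by auto
  define E where "E = {t\<in>{\<tau>/2..b1}. Re (v1 t) = 0 \<and> \<bar>Im (v1 t)\<bar> \<le> \<bar>Im (v1 b1)\<bar>}"
  have "closed E"
  proof -
    have "closed {w. Re w = 0 \<and> \<bar>Im w\<bar> \<le> \<bar>Im (v1 b1)\<bar>}"
      by (intro closed_Collect_conj closed_Collect_eq closed_Collect_le continuous_intros)
    then have "closed ({\<tau>/2..b1} \<inter> v1 -` {w. Re w = 0 \<and> \<bar>Im w\<bar> \<le> \<bar>Im (v1 b1)\<bar>})"
      by (intro continuous_closed_preimage continuous_on_subset[OF cont]) (use \<tau> in auto)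
    moreover have "E = {\<tau>/2..b1} \<inter> v1 -` {w. Re w = 0 \<and> \<bar>Im w\<bar> \<le> \<bar>Im (v1 b1)\<bar>}"
      by (auto simp: E_def)
    ultimately show ?thesis by simp
  qed
  have small: "t \<ge> \<tau>/2" if "0 < t" "t \<le> b1" "Re (v1 t) = 0" for t
    using pos[of t] that \<tau> by (cases "t < \<tau>/2") auto
  have "b1 \<in> E" using small[of b1] v1 by (simp add: E_def)
  have bdd: "bdd_below E" by (auto simp: E_def intro!: bdd_belowI[of _ "\<tau>/2"])
  define t1 where "t1 = Inf E"
  have "t1 \<in> E" unfolding t1_def using \<open>closed E\<close> \<open>b1 \<in> E\<close> bdd by (intro closed_contains_Inf) auto
  then have t1: "0 < t1" "t1 \<le> b1" "Re (v1 t1) = 0" "\<bar>Im (v1 t1)\<bar> \<le> \<bar>Im (v1 b1)\<bar>"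
    using \<tau> by (auto simp: E_def)
  have first: "\<bar>Im (v1 t)\<bar> > \<bar>Im (v1 t1)\<bar>" if t: "0 < t" "t < t1" "Re (v1 t) = 0" for t
  proof (rule ccontr)
    assume "\<not> \<bar>Im (v1 t)\<bar> > \<bar>Im (v1 t1)\<bar>"
    then have "t \<in> E" using small[of t] t t1 by (auto simp: E_def)
    then show False using cInf_lower[OF _ bdd, of t] t t1_def by simp
  qed
  have "v1 t1 \<noteq> v1 0" using inj_onD[OF v1(4), of t1 0] t1 by auto
  then have s1: "\<bar>Im (v1 t1)\<bar> > 0" using t1 v1 by (auto simp: complex_eq_iff)
  obtain v2 b2 where v2: "b2 > 0" "solves W v2 {0..b2}" "v2 0 = 0" "inj_on v2 {0..b2}"
      "Re (v2 b2) = 0" "\<bar>Im (v2 b2)\<bar> < \<bar>Im (v1 t1)\<bar>"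
    using returns[OF s1] by blast
  have eq: "v2 t = v1 t" if "0 \<le> t" "t \<le> b1" "t \<le> b2" for t
    by (rule solves_unique_forward[OF lip solves_subset[OF v2(2)] solves_subset[OF v1(2)], of 0 "min b1 b2"])
       (use that v1 v2 in auto)
  have "t1 < b2"
  proof (rule ccontr)
    assume "\<not> t1 < b2"
    then have b2: "b2 \<le> t1" by simp
    then have "v2 b2 = v1 b2" using eq[of b2] v2 t1 by simp
    then show False using first[of b2] v2 b2 by (cases "b2 = t1") auto
  qed
  then show False
    by (intro no_closer_return[OF W M v2(2,3,4) t1(1)])
       (use eq t1 v1 v2 first in auto)
qed

text \<open>Suppose that points of \<open>K\<close> that can be reached from \<open>0\<close> accumulate at \<open>0\<close>. Cutting off everything before the last visit to \<open>0\<close> makes a solution that reaches a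
  point \<open>q\<close> of \<open>K\<close> injective, so that periodic orbits need no separate treatment. If \<open>q\<close> is close to \<open>0\<close>, then following the field
  for a short time, forwards or backwards, leads from \<open>q\<close> to the transversal. This does not lead to \<open>0\<close>
  itself, as otherwise \<open>q\<close> would lie on the local arc. Thus there are returns arbitrarily close to \<open>0\<close>.\<close>

lemma no_forward_return:
  fixes W :: "complex \<Rightarrow> complex"
  assumes lip: "locally_lipschitz W" and W0: "Re (W 0) > 0"
    and x0: "h0 > 0" "solves W x0 {-h0..h0}" "x0 0 = 0" "\<And>t. t \<in> {-h0..h0} \<Longrightarrow> x0 t \<notin> K"
  shows "0 \<notin> closure ({q. \<exists>\<gamma> b. b \<ge> 0 \<and> solves W \<gamma> {0..b} \<and> \<gamma> 0 = 0 \<and> \<gamma> b = q} \<inter> K)"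
proof
  assume clos: "0 \<in> closure ({q. \<exists>\<gamma> b. b \<ge> 0 \<and> solves W \<gamma> {0..b} \<and> \<gamma> 0 = 0 \<and> \<gamma> b = q} \<inter> K)"
  have contW: "continuous_on (cball 0 1) W"
    using lip lipschitz_on_continuous_on unfolding locally_lipschitz_def by blast
  define c where "c = Re (W 0) / 2"
  define B where "B = norm (W 0) + c"
  have c: "c > 0" using W0 by (simp add: c_def)
  have B: "B > 0" using c by (simp add: B_def add_nonneg_pos)
  have "\<exists>d>0. \<forall>w\<in>cball 0 1. dist w 0 < d \<longrightarrow> dist (W w) (W 0) < c"
    using contW[unfolded continuous_on_iff, rule_format, of 0 c] c by simp
  then obtain d where d: "d > 0" "\<And>w. norm w \<le> 1 \<Longrightarrow> norm w < d \<Longrightarrow> norm (W w - W 0) < c"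
    by (auto simp: dist_norm)
  define \<rho> where "\<rho> = min 1 d / 2"
  have \<rho>: "\<rho> > 0" using d by (simp add: \<rho>_def)
  have Wd: "norm (W w - W 0) < c" if "norm w \<le> \<rho>" for w
    using d(2)[of w] that d(1) by (auto simp: \<rho>_def)
  have WRe: "Re (W w) \<ge> c" and WB: "norm (W w) \<le> B" if "norm w \<le> \<rho>" for w
  proof -
    show "Re (W w) \<ge> c"
      using Wd[OF that] abs_Re_le_cmod[of "W w - W 0"] by (simp add: c_def)
    show "norm (W w) \<le> B"
      using Wd[OF that] norm_triangle_sub[of "W w" "W 0"] by (simp add: B_def)
  qed
  have WC: "Re (W w) > 0 \<and> \<bar>Im (W w)\<bar> \<le> (B / c) * Re (W w)" if "norm w < \<rho>" for w
  proof -
    have "\<bar>Im (W w)\<bar> \<le> B" using WB[of w] abs_Im_le_cmod[of "W w"] that by simp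
    also have "\<dots> = B / c * c" using c by simp
    also have "\<dots> \<le> B / c * Re (W w)" using WRe[of w] that B c by (intro mult_left_mono) auto
    finally show ?thesis using WRe[of w] that c by auto
  qed
  define \<tau> where "\<tau> = min h0 (\<rho> / (2 * B))"
  have \<tau>: "0 < \<tau>" "\<tau> \<le> h0" "\<tau> \<le> \<rho> / (2 * B)" using x0(1) \<rho> B by (auto simp: \<tau>_def)
  show False
  proof (rule first_return_contradiction[OF lip WC _ \<rho>])
    show "B / c \<ge> 0" using B c by simp
    fix \<rho>' :: real assume \<rho>': "\<rho>' > 0"
    \<comment> \<open>Starting within \<open>\<rho>1\<close> of the origin, the transversal is reached in time at most \<open>\<rho>1 / c\<close>, at speed at most \<open>B\<close>,
      hence within \<open>k \<rho>1 \<le> \<rho>'\<close> of the origin.\<close>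
    define k where "k = 1 + B / c"
    have k: "k \<ge> 1" using B c by (simp add: k_def)
    define \<rho>1 where "\<rho>1 = min (\<rho> / 2) (min (\<rho>' / k) (c * \<tau>))"
    have "\<rho>1 \<le> \<rho> / 2" "\<rho>1 \<le> min (\<rho>' / k) (c * \<tau>)"
      unfolding \<rho>1_def by (rule min.cobounded1 min.cobounded2)+
    moreover have "\<rho>1 > 0" using \<rho> \<rho>' k c \<tau> by (simp add: \<rho>1_def)
    ultimately have \<rho>1: "\<rho>1 > 0" "\<rho>1 \<le> \<rho> / 2" "\<rho>1 \<le> \<rho>' / k" "\<rho>1 \<le> c * \<tau>"
      by simp_all
    obtain q \<gamma> b0 where q: "q \<in> K" "norm q < \<rho>1"
      and \<gamma>: "b0 \<ge> 0" "solves W \<gamma> {0..b0}" "\<gamma> 0 = 0" "\<gamma> b0 = q"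
    proof -
      have "\<exists>y\<in>{q. \<exists>\<gamma> b. b \<ge> 0 \<and> solves W \<gamma> {0..b} \<and> \<gamma> 0 = 0 \<and> \<gamma> b = q} \<inter> K. dist y 0 < \<rho>1"
        using clos \<rho>1(1) unfolding closure_approachable by blast
      then show thesis using that by auto
    qed
    have qx0: "x0 t \<noteq> q" if "t \<in> {-h0..h0}" for t using x0(4)[OF that] q by auto
    \<comment> \<open>The last visit to \<open>0\<close> before reaching \<open>q\<close>.\<close>
    define Z where "Z = {0..b0} \<inter> \<gamma> -` {0}"
    have "closed Z" unfolding Z_def
      by (intro continuous_closed_preimage solves_continuous[OF \<gamma>(2)]) auto
    moreover have "0 \<in> Z" using \<gamma> by (auto simp: Z_def)
    moreover have bdd: "bdd_above Z" by (auto simp: Z_def intro!: bdd_aboveI[of _ b0])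
    ultimately have "Sup Z \<in> Z" by (intro closed_contains_Sup) auto
    define a where "a = Sup Z"
    have a: "0 \<le> a" "a \<le> b0" "\<gamma> a = 0" using \<open>Sup Z \<in> Z\<close> by (auto simp: Z_def a_def)
    have last: "\<gamma> t \<noteq> 0" if "a < t" "t \<le> b0" for t
    proof
      assume "\<gamma> t = 0"
      then have "t \<in> Z" using that a by (auto simp: Z_def)
      then show False using cSup_upper[OF _ bdd, of t] that by (simp add: a_def)
    qed
    define b1 where "b1 = b0 - a"
    define v0 where "v0 t = \<gamma> (a + t)" for t
    have v0: "solves W v0 {0..b1}"
      unfolding v0_def[abs_def] by (rule solves_shift[OF \<gamma>(2)]) (use a in \<open>auto simp: b1_def\<close>)
    have v00: "v0 0 = 0" "v0 b1 = q" "b1 \<ge> 0" using a \<gamma> by (auto simp: v0_def b1_def)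
    have v0nz: "v0 t \<noteq> 0" if "0 < t" "t \<le> b1" for t
      using last[of "a + t"] that by (auto simp: v0_def b1_def)
    \<comment> \<open>Within time \<open>h0\<close> the solution still runs along the local arc, which does not contain \<open>q\<close>.\<close>
    have b1h: "h0 < b1"
    proof (rule ccontr)
      assume "\<not> h0 < b1"
      then have "b1 \<le> h0" by simp
      have "v0 b1 = x0 b1"
        by (rule solves_unique_forward[OF lip v0 solves_subset[OF x0(2)]]) (use v00 x0 \<open>b1 \<le> h0\<close> in auto)
      then show False using qx0[of b1] v00 x0 \<open>\<not> h0 < b1\<close> by auto
    qed
    obtain x where x: "x 0 = q" "solves W x {-\<tau>..\<tau>}" "\<And>t. t \<in> {-\<tau>..\<tau>} \<Longrightarrow> norm (x t) < \<rho>"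
    proof (rule local_solution[where p = 0 and q = q and T = \<tau>, OF lip \<rho> B])
      show "norm (W w) \<le> B" if "w \<in> cball 0 \<rho>" for w using WB[of w] that by simp
      show "norm (q - 0) < \<rho> / 2" using q \<rho>1 by simp
    qed (use \<tau> that in auto)
    have xnz: "x s \<noteq> 0" if s: "0 < s" "s \<le> \<tau>" for s
    proof
      assume xs: "x s = 0"
      have A: "solves W (\<lambda>r. x (s + r)) {-s..0}"
        by (rule solves_shift[OF x(2)]) (use s in auto)
      have "x (s + (-s)) = x0 (-s)"
        by (rule solves_unique[OF lip A solves_subset[OF x0(2)], of 0]) (use s \<tau> xs x0 in auto)
      then show False using qx0[of "-s"] x(1) s \<tau> by auto
    qed
    \<comment> \<open>The solution is continued beyond \<open>q\<close> by the local solution \<open>x\<close>, because the transversal may lie ahead of \<open>q\<close>.\<close>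
    define v where "v t = (if t \<le> b1 then v0 t else x (- b1 + t))" for t
    have xs: "solves W (\<lambda>t. x (- b1 + t)) {b1..b1 + \<tau>}"
      by (rule solves_shift[OF x(2)]) (use \<tau> in auto)
    have v: "solves W v {0..b1 + \<tau>}"
    proof -
      have "solves W v ({0..b1} \<union> {b1..b1+\<tau>})"
        unfolding v_def[abs_def]
        by (rule solves_glue[OF v0 xs]) (use v00 x \<tau> in auto)
      moreover have "{0..b1} \<union> {b1..b1+\<tau>} = {0..b1+\<tau>}" using v00 \<tau> by auto
      ultimately show ?thesis by simp
    qed
    have v_win: "v (b1 + s) = x s" if "s \<in> {-\<tau>..\<tau>}" for s
    proof -
      have A: "solves W (\<lambda>s. v (b1 + s)) {-\<tau>..\<tau>}"
        by (rule solves_shift[OF v]) (use b1h \<tau> in auto)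
      show ?thesis
        by (rule solves_unique[OF lip A x(2), of 0]) (use that \<tau> v00 x in \<open>auto simp: v_def\<close>)
    qed
    have vnz: "v t \<noteq> 0" if "0 < t" "t \<le> b1 + \<tau>" for t
      using v0nz[of t] xnz[of "t - b1"] that by (auto simp: v_def algebra_simps)
    have incr: "c * (t - s) \<le> Re (x t) - Re (x s)" if st: "-\<tau> \<le> s" "s \<le> t" "t \<le> \<tau>" for s t
    proof -
      have cx: "continuous_on {s..t} x"
        by (rule solves_continuous[OF solves_subset[OF x(2)]]) (use st in auto)
      have "Re (x s) - c * s \<le> Re (x t) - c * t"
      proof (rule DERIV_nonneg_imp_increasing_open[where f = "\<lambda>r. Re (x r) - c * r"])
        fix r assume r: "s < r" "r < t"
        have "(x has_vector_derivative W (x r)) (at r)"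
          by (rule solves_at[OF x(2), of "{s<..<t}"]) (use r st in auto)
        then have "((\<lambda>r. Re (x r)) has_real_derivative Re (W (x r))) (at r)"
          using bounded_linear.has_vector_derivative[OF bounded_linear_Re]
          by (simp add: has_real_derivative_iff_has_vector_derivative)
        then have "DERIV (\<lambda>r. Re (x r) - c * r) r :> Re (W (x r)) - c * 1"
          by (intro DERIV_diff DERIV_cmult DERIV_ident)
        moreover have "Re (W (x r)) \<ge> c" using WRe[of "x r"] x(3)[of r] r st by auto
        ultimately show "\<exists>D. DERIV (\<lambda>r. Re (x r) - c * r) r :> D \<and> 0 \<le> D" by fastforce
      qed (use st cx in \<open>auto intro!: continuous_intros\<close>)
      then show ?thesis by (simp add: algebra_simps)
    qed
    define s' where "s' = \<bar>Re q\<bar> / c"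
    have s': "0 \<le> s'" "s' < \<tau>"
    proof -
      show "0 \<le> s'" using c by (simp add: s'_def)
      have "\<bar>Re q\<bar> < c * \<tau>" using abs_Re_le_cmod[of q] q \<rho>1 by linarith
      then show "s' < \<tau>" using c by (simp add: s'_def field_simps)
    qed
    have cs': "c * s' = \<bar>Re q\<bar>" using c by (simp add: s'_def)
    have contx: "continuous_on {-s'..s'} (\<lambda>s. Re (x s))"
      by (intro continuous_intros solves_continuous[OF solves_subset[OF x(2)]]) (use s' in auto)
    have "Re (x (-s')) \<le> 0" "0 \<le> Re (x s')"
      using incr[of "-s'" 0] incr[of 0 s'] s' x(1) cs' by auto
    then obtain s where s: "-s' \<le> s" "s \<le> s'" "Re (x s) = 0"
      using IVT'[of "\<lambda>s. Re (x s)" "-s'" 0 s'] contx s' by auto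
    have xsmall: "norm (x s) < \<rho>'"
    proof -
      have "norm (x s - x 0) \<le> B * \<bar>s - 0\<bar>"
      proof (rule solves_speed_bound[OF x(2)])
        show "norm (W (x t)) \<le> B" if "t \<in> {-\<tau>..\<tau>}" for t
          using WB[of "x t"] x(3)[OF that] by simp
      qed (use s s' in auto)
      also have "\<dots> \<le> B * (\<bar>Re q\<bar> / c)" using s B by (intro mult_left_mono) (auto simp: s'_def)
      also have "\<dots> \<le> B * (norm q / c)" using B c by (intro mult_left_mono divide_right_mono abs_Re_le_cmod) auto
      finally have "norm (x s) \<le> norm q + B * (norm q / c)"
        using norm_triangle_sub[of "x s" "x 0"] x(1) by simp
      also have "\<dots> = k * norm q" by (simp add: k_def algebra_simps)
      also have "\<dots> < k * \<rho>1" using q k by (intro mult_strict_left_mono) auto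
      also have "\<dots> \<le> k * (\<rho>' / k)" using \<rho>1 k by (intro mult_left_mono) auto
      finally show ?thesis using k by simp
    qed
    define b where "b = b1 + s"
    have b: "0 < b" "b \<le> b1 + \<tau>" using s s' \<tau> b1h by (auto simp: b_def)
    have vb: "v b = x s" using v_win[of s] s s' by (simp add: b_def)
    have inj: "inj_on v {0..b}"
    proof (rule linorder_inj_onI)
      fix t t' assume tt: "t < t'" "t \<in> {0..b}" "t' \<in> {0..b}"
      show "v t \<noteq> v t'"
      proof
        assume eq: "v t = v t'"
        have A: "solves W (\<lambda>r. v ((t' - t) + r)) {0..t}"
          by (rule solves_shift[OF v]) (use tt b in auto)
        have "v ((t' - t) + 0) = v 0"
          by (rule solves_unique[OF lip A solves_subset[OF v], of t]) (use tt b eq in auto)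
        moreover have "v 0 = 0" using v00 by (simp add: v_def)
        ultimately show False using vnz[of "t' - t"] tt b by auto
      qed
    qed auto
    show "\<exists>v b. b > 0 \<and> solves W v {0..b} \<and> v 0 = 0 \<and> inj_on v {0..b} \<and> Re (v b) = 0 \<and> \<bar>Im (v b)\<bar> < \<rho>'"
    proof (intro exI[of _ v] exI[of _ b] conjI)
      show "solves W v {0..b}" by (rule solves_subset[OF v]) (use b in auto)
      show "v 0 = 0" using v00 by (simp add: v_def)
      show "\<bar>Im (v b)\<bar> < \<rho>'" using xsmall abs_Im_le_cmod[of "x s"] vb by simp
    qed (use b inj vb s in auto)
  qed
qed

section \<open>The leading form of an analytic field at a zero\<close>

definition det2 :: "real^2 \<Rightarrow> real^2 \<Rightarrow> real" where
  "det2 a b = a $ 1 * b $ 2 - a $ 2 * b $ 1"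

lemma det2_scaleR [simp]: "det2 (s *\<^sub>R a) b = s * det2 a b" "det2 a (s *\<^sub>R b) = s * det2 a b"
  by (simp_all add: det2_def algebra_simps)

lemma det2_add: "det2 (a + b) c = det2 a c + det2 b c" "det2 a (b + c) = det2 a b + det2 a c"
  by (simp_all add: det2_def algebra_simps)

lemma det2_diff: "det2 (a - b) c = det2 a c - det2 b c" "det2 a (b - c) = det2 a b - det2 a c"
  by (simp_all add: det2_def algebra_simps)

lemma det2_self [simp]: "det2 a a = 0"
  by (simp add: det2_def)

lemma continuous_on_det2 [continuous_intros]:
  "continuous_on A f \<Longrightarrow> continuous_on A g \<Longrightarrow> continuous_on A (\<lambda>x. det2 (f x) (g x))"
  unfolding det2_def by (intro continuous_intros)

lemma tendsto_det2 [tendsto_intros]: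
  "(f \<longlongrightarrow> a) F \<Longrightarrow> (g \<longlongrightarrow> b) F \<Longrightarrow> ((\<lambda>x. det2 (f x) (g x)) \<longlongrightarrow> det2 a b) F"
  unfolding det2_def by (intro tendsto_intros)

lemma bounded_linear_det2: "bounded_linear (det2 a)"
  unfolding det2_def
  by (intro bounded_linear_sub bounded_linear_const_mult bounded_linear_vec_nth)

lemma norm_vec2: "(norm (v :: real^2))\<^sup>2 = (v $ 1)\<^sup>2 + (v $ 2)\<^sup>2"
  unfolding power2_norm_eq_inner inner_vec_def by (simp add: sum_2 power2_eq_square)

lemma inner_vec2: "(a :: real^2) \<bullet> b = a $ 1 * b $ 1 + a $ 2 * b $ 2"
  by (simp add: inner_vec_def sum_2)

lemma lagrange_identity: "(a \<bullet> b)\<^sup>2 + (det2 a b)\<^sup>2 = (norm a)\<^sup>2 * (norm b)\<^sup>2"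
  unfolding inner_vec2 det2_def norm_vec2 by (simp add: power2_eq_square algebra_simps)

lemma abs_det2_le: "\<bar>det2 a b\<bar> \<le> norm a * norm b"
proof -
  have "(det2 a b)\<^sup>2 \<le> (norm a * norm b)\<^sup>2"
    using lagrange_identity[of a b] zero_le_power2[of "a \<bullet> b"]
    unfolding power_mult_distrib by linarith
  then show ?thesis by (simp add: abs_le_square_iff[symmetric] abs_mult)
qed

text \<open>The homogeneous part of degree \<open>n\<close> of the double power series with coefficients \<open>c\<close>.\<close>

definition form :: "(nat \<Rightarrow> nat \<Rightarrow> 'b::real_vector) \<Rightarrow> nat \<Rightarrow> real^2 \<Rightarrow> 'b" where
  "form c n v = (\<Sum>i\<le>n. ((v $ 1) ^ i * (v $ 2) ^ (n - i)) *\<^sub>R c i (n - i))"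

lemma form_scaleR: "form c n (s *\<^sub>R v) = s ^ n *\<^sub>R form c n v"
  unfolding form_def scaleR_sum_right
proof (rule sum.cong)
  fix i assume "i \<in> {..n}"
  then have "s ^ n = s ^ i * s ^ (n - i)" by (simp flip: power_add)
  then show "((s *\<^sub>R v) $ 1 ^ i * (s *\<^sub>R v) $ 2 ^ (n - i)) *\<^sub>R c i (n - i) =
      s ^ n *\<^sub>R ((v $ 1 ^ i * v $ 2 ^ (n - i)) *\<^sub>R c i (n - i))"
    by (simp add: power_mult_distrib mult_ac)
qed simp

lemma continuous_on_form [continuous_intros]:
  fixes c :: "nat \<Rightarrow> nat \<Rightarrow> 'b::real_normed_vector"
  shows "continuous_on A (form c n)"
  unfolding form_def by (intro continuous_intros)

lemma form_component: "form c n v $ k = form (\<lambda>i j. c i j $ k) n v"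
  by (simp add: form_def)

lemma form_polynomial: "\<exists>P. \<forall>x. form (c :: nat \<Rightarrow> nat \<Rightarrow> real) n (vector [x, b]) = poly P x"
  by (intro exI[of _ "\<Sum>i\<le>n. monom (b ^ (n - i) * c i (n - i)) i"])
     (simp add: form_def poly_sum poly_monom mult_ac)

text \<open>On a suitable horizontal line \<open>F\<close> is a polynomial with infinitely many zeros, hence zero on that line. Homogeneity carries this to all
  points off the horizontal axis, and continuity to the axis.\<close>

lemma homogeneous_vanishing:
  fixes F :: "real^2 \<Rightarrow> real"
  assumes hom: "\<And>s v. F (s *\<^sub>R v) = s ^ n * F v"
    and cont: "continuous_on UNIV F"
    and pol: "\<And>b. \<exists>P. \<forall>x. F (vector [x, b]) = poly P x"
    and U: "open U" "U \<noteq> {}" "\<And>v. v \<in> U \<Longrightarrow> F v = 0"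
  shows "F v = 0"
proof -
  obtain v0 where v0: "v0 \<in> U" using U by blast
  obtain e where e: "e > 0" "ball v0 e \<subseteq> U" using U(1) v0 open_contains_ball by blast
  \<comment> \<open>The height of the horizontal line must not be zero.\<close>
  define b where "b = (if v0 $ 2 = 0 then e / 2 else v0 $ 2)"
  have b: "b \<noteq> 0" "\<bar>b - v0 $ 2\<bar> \<le> e / 2" using e by (auto simp: b_def)
  obtain P where P: "\<And>x. F (vector [x, b]) = poly P x" using pol by blast
  have "P = 0"
  proof (rule ccontr)
    assume "P \<noteq> 0"
    then have fin: "finite {x. poly P x = 0}" by (rule poly_roots_finite)
    have "poly P x = 0" if "x \<in> {v0 $ 1<..<v0 $ 1 + e / 2}" for x
    proof -
      have "norm (v0 - vector [x, b]) \<le> \<bar>v0 $ 1 - x\<bar> + \<bar>v0 $ 2 - b\<bar>"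
        using norm_le_l1_cart[of "v0 - vector [x, b]"] by (simp add: sum_2)
      also have "\<dots> < e" using that b by (auto simp: abs_minus_commute)
      finally have "vector [x, b] \<in> U" using e by (auto simp: dist_norm)
      then show ?thesis using U(3)[of "vector [x, b]"] P[of x] by simp
    qed
    then have "{v0 $ 1<..<v0 $ 1 + e / 2} \<subseteq> {x. poly P x = 0}" by blast
    then have "finite {v0 $ 1<..<v0 $ 1 + e / 2}" using fin finite_subset by blast
    then show False using e infinite_Ioo[of "v0 $ 1" "v0 $ 1 + e / 2"] by simp
  qed
  have zero: "F w = 0" if w: "w $ 2 \<noteq> 0" for w
  proof -
    have "w = (w $ 2 / b) *\<^sub>R vector [w $ 1 * b / w $ 2, b]"
      using w b by (simp add: vec_eq_iff forall_2)
    then have "F w = (w $ 2 / b) ^ n * F (vector [w $ 1 * b / w $ 2, b])" by (metis hom)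
    then show ?thesis using P \<open>P = 0\<close> by simp
  qed
  show "F v = 0"
  proof (cases "v $ 2 = 0")
    case True
    define g where "g k = v + inverse (real (Suc k)) *\<^sub>R axis 2 (1::real)" for k
    have "g \<longlonglongrightarrow> v + 0 *\<^sub>R axis 2 1"
      unfolding g_def by (intro tendsto_intros LIMSEQ_inverse_real_of_nat)
    then have "(\<lambda>k. F (g k)) \<longlonglongrightarrow> F v"
      using cont by (intro continuous_on_tendsto_compose[of UNIV F]) auto
    moreover have "F (g k) = 0" for k
      by (rule zero) (use True in \<open>simp add: g_def axis_def\<close>)
    ultimately show ?thesis by (simp add: LIMSEQ_const_iff)
  qed (rule zero)
qed

lemma form_vanishing:
  fixes c :: "nat \<Rightarrow> nat \<Rightarrow> real"
  assumes U: "open U" "U \<noteq> {}" "\<And>v. v \<in> U \<Longrightarrow> form c n v = 0" and i: "i \<le> n"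
  shows "c i (n - i) = 0"
proof -
  have zero: "form c n v = 0" for v
    by (rule homogeneous_vanishing[OF _ continuous_on_form form_polynomial U, of n])
       (simp_all add: form_scaleR)
  have "(\<Sum>i\<le>n. c i (n - i) * x ^ i) = 0" for x
    using zero[of "vector [x, 1]"] by (simp add: form_def mult.commute)
  then have "\<forall>i\<le>n. c i (n - i) = 0" using polyfun_eq_0[of "\<lambda>i. c i (n - i)" n] by simp
  then show ?thesis using i by blast
qed

lemma det2_form_vanishing:
  fixes c :: "nat \<Rightarrow> nat \<Rightarrow> real^2"
  assumes U: "open U" "U \<noteq> {}" "\<And>v. v \<in> U \<Longrightarrow> det2 v (form c n v) = 0"
  shows "det2 v (form c n v) = 0"
proof (rule homogeneous_vanishing[where F = "\<lambda>v. det2 v (form c n v)" and n = "Suc n" and U = U])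
  show "det2 (s *\<^sub>R v) (form c n (s *\<^sub>R v)) = s ^ Suc n * det2 v (form c n v)" for s v
    by (simp add: form_scaleR)
  show "continuous_on UNIV (\<lambda>v. det2 v (form c n v))" by (intro continuous_intros)
  show "\<exists>P. \<forall>x. det2 (vector [x, b]) (form c n (vector [x, b])) = poly P x" for b
  proof -
    obtain P where P: "\<forall>x. form (\<lambda>i j. c i j $ 1) n (vector [x, b]) = poly P x" using form_polynomial by blast
    obtain Q where Q: "\<forall>x. form (\<lambda>i j. c i j $ 2) n (vector [x, b]) = poly Q x" using form_polynomial by blast
    show ?thesis
      by (intro exI[of _ "[:0, 1:] * Q - smult b P"]) (simp add: det2_def form_component P Q)
  qed
qed (use U in auto)

lemma power_series_remainder:
  fixes c :: "nat \<Rightarrow> nat \<Rightarrow> real" and g :: "real^2 \<Rightarrow> real"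
  assumes r: "r > 0" and g: "\<And>x. x \<in> ball p r \<Longrightarrow>
      ((\<lambda>(i, j). ((x $ 1 - p $ 1) ^ i * (x $ 2 - p $ 2) ^ j) * c i j) has_sum g x) UNIV"
    and low: "\<And>i j. i + j < m \<Longrightarrow> c i j = 0"
  obtains C s where "s > 0" "C \<ge> 0" "\<And>v. norm v \<le> s \<Longrightarrow> \<bar>g (p + v) - form c m v\<bar> \<le> C * norm v ^ Suc m"
proof -
  define s where "s = r / 3"
  have s: "s > 0" using r by (simp add: s_def)
  define x0 where "x0 = p + vector [s, s]"
  have "norm (x0 - p) \<le> s + s"
    using norm_le_l1_cart[of "x0 - p"] s by (simp add: sum_2 x0_def)
  also have "\<dots> < r" using r by (simp add: s_def)
  finally have "x0 \<in> ball p r" by (simp add: dist_norm norm_minus_commute)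
  from g[OF this] have "(\<lambda>(i, j). (s ^ i * s ^ j) * c i j) summable_on UNIV"
    by (auto simp: x0_def dest: has_sum_imp_summable)
  then have "(\<lambda>x. norm (case x of (i, j) \<Rightarrow> (s ^ i * s ^ j) * c i j)) summable_on UNIV"
    by (simp only: summable_on_iff_abs_summable_on_real[symmetric])
  then obtain S where "((\<lambda>x. norm (case x of (i, j) \<Rightarrow> (s ^ i * s ^ j) * c i j)) has_sum S) UNIV"
    by (auto simp: summable_on_def)
  then have S: "((\<lambda>(i, j). s ^ (i + j) * \<bar>c i j\<bar>) has_sum S) UNIV"
    using s by (simp add: case_prod_unfold abs_mult power_add mult_ac)
  have S0: "S \<ge> 0" by (rule has_sum_nonneg[OF S]) (use s in auto)
  define D where "D = (\<lambda>i. (i, m - i)) ` {..m}"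
  have D: "finite D" "x \<in> D \<longleftrightarrow> fst x + snd x = m" for x
    by (auto simp: D_def image_iff prod_eq_iff)
  have inj: "inj_on (\<lambda>i. (i, m - i)) {..m}" by (auto simp: inj_on_def)
  show thesis
  proof (rule that[OF s, of "S / s ^ Suc m"])
    show "S / s ^ Suc m \<ge> 0" using S0 s by simp
    fix v :: "real^2" assume v: "norm v \<le> s"
    define t where "t = (\<lambda>(i, j). (v $ 1 ^ i * v $ 2 ^ j) * c i j)"
    have "p + v \<in> ball p r" using v s by (simp add: dist_norm s_def)
    from g[OF this] have t: "(t has_sum g (p + v)) UNIV" by (simp add: t_def)
    have tD: "(t has_sum form c m v) D"
    proof -
      have "sum t D = form c m v"
        unfolding D_def sum.reindex[OF inj] by (simp add: t_def form_def)
      then show ?thesis using has_sum_finite[OF D(1), of t] by simp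
    qed
    have "(t has_sum (g (p + v) - form c m v)) (UNIV - D)"
      by (rule has_sum_Diff[OF t tD]) simp
    then have rem: "((\<lambda>x. if x \<in> D then 0 else t x) has_sum (g (p + v) - form c m v)) UNIV"
      by (subst has_sum_cong_neutral[where T = UNIV and g = "\<lambda>x. if x \<in> D then 0 else t x", symmetric]) auto
    have bnd: "((\<lambda>x. (norm v / s) ^ Suc m * (case x of (i, j) \<Rightarrow> s ^ (i + j) * \<bar>c i j\<bar>)) has_sum
        (norm v / s) ^ Suc m * S) UNIV"
      by (rule has_sum_cmult_right[OF S])
    have "norm (g (p + v) - form c m v) \<le> (norm v / s) ^ Suc m * S"
    proof (rule norm_infsum_le[OF rem bnd])
      fix x :: "nat \<times> nat"
      obtain i j where x: "x = (i, j)" by force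
      show "norm (if x \<in> D then 0 else t x) \<le> (norm v / s) ^ Suc m * (case x of (i, j) \<Rightarrow> s ^ (i + j) * \<bar>c i j\<bar>)"
      proof (cases "i + j \<le> m")
        case True
        then show ?thesis using D(2)[of x] low[of i j] s x by (auto simp: t_def)
      next
        case False
        have "\<bar>t x\<bar> \<le> \<bar>c i j\<bar> * norm v ^ (i + j)"
          using monomial_bound[of "v $ 1" "norm v" "v $ 2" "c i j" i j, OF component_le_norm_cart component_le_norm_cart]
          by (simp add: t_def x mult.commute)
        also have "\<dots> = (norm v / s) ^ (i + j) * (s ^ (i + j) * \<bar>c i j\<bar>)"
          using s by (simp add: power_divide)
        also have "\<dots> \<le> (norm v / s) ^ Suc m * (s ^ (i + j) * \<bar>c i j\<bar>)"
          using False v s by (intro mult_right_mono power_decreasing) auto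
        finally show ?thesis using D(2)[of x] False x by auto
      qed
    qed
    also have "\<dots> = S / s ^ Suc m * norm v ^ Suc m" by (simp only: power_divide) simp
    finally show "\<bar>g (p + v) - form c m v\<bar> \<le> S / s ^ Suc m * norm v ^ Suc m" by simp
  qed
qed

text \<open>If some coefficient of the power series of \<open>Y\<close> at \<open>p\<close> is nonzero, let \<open>m\<close> be the least degree in which this happens. Compared with
  its values on a fixed square, the tail of the series beyond degree \<open>m\<close> carries at least the factor \<open>norm v ^ Suc m\<close>.\<close>

lemma leading_form:
  fixes Y :: "real^2 \<Rightarrow> real^2"
  assumes Y: "analytic_plane Y" and Yp: "Y p = 0"
  obtains r where "r > 0" "\<And>x. x \<in> ball p r \<Longrightarrow> Y x = 0"
  | m c C s where "m \<ge> 1" "s > 0" "C > 0" "\<And>v. norm v \<le> s \<Longrightarrow> norm (Y (p + v) - form c m v) \<le> C * norm v ^ Suc m"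
      "\<And>U. open U \<Longrightarrow> U \<noteq> {} \<Longrightarrow> \<exists>v\<in>U. form c m v \<noteq> 0"
proof -
  obtain r c where r: "r > 0" and c: "\<And>x. x \<in> ball p r \<Longrightarrow>
      ((\<lambda>(i, j). ((x $ 1 - p $ 1) ^ i * (x $ 2 - p $ 2) ^ j) *\<^sub>R c i j) has_sum Y x) UNIV"
    using Y unfolding analytic_plane_def by meson
  have ck: "((\<lambda>(i, j). ((x $ 1 - p $ 1) ^ i * (x $ 2 - p $ 2) ^ j) * (c i j $ k)) has_sum Y x $ k) UNIV"
    if "x \<in> ball p r" for x k
    using has_sum_bounded_linear[OF bounded_linear_vec_nth c[OF that]]
    by (simp add: case_prod_unfold o_def)
  show thesis
  proof (cases "\<forall>i j. c i j = 0")
    case True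
    have "Y x = 0" if "x \<in> ball p r" for x
    proof -
      have "((\<lambda>_. 0) has_sum Y x) (UNIV :: (nat \<times> nat) set)"
        using c[OF that] True by (simp add: case_prod_unfold)
      then show ?thesis by (rule has_sum_unique) (rule has_sum_0, simp)
    qed
    then show thesis using that(1) r by blast
  next
    case False
    define m where "m = (LEAST n. \<exists>i j. i + j = n \<and> c i j \<noteq> 0)"
    obtain i1 j1 where "c i1 j1 \<noteq> 0" using False by blast
    then have "\<exists>i j. i + j = i1 + j1 \<and> c i j \<noteq> 0" by blast
    then have "\<exists>i j. i + j = m \<and> c i j \<noteq> 0" unfolding m_def by (rule LeastI)
    then obtain i0 j0 where ij: "i0 + j0 = m" "c i0 j0 \<noteq> 0" by (elim exE conjE)
    have low: "c i j = 0" if "i + j < m" for i j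
      using not_less_Least[OF that[unfolded m_def]] by blast
    obtain C1 s1 where 1: "s1 > 0" "C1 \<ge> 0"
        "\<And>v. norm v \<le> s1 \<Longrightarrow> \<bar>Y (p + v) $ 1 - form (\<lambda>i j. c i j $ 1) m v\<bar> \<le> C1 * norm v ^ Suc m"
      by (rule power_series_remainder[where m = m and c = "\<lambda>i j. c i j $ 1", OF r ck[where k = 1]])
         (use low in simp_all)
    obtain C2 s2 where 2: "s2 > 0" "C2 \<ge> 0"
        "\<And>v. norm v \<le> s2 \<Longrightarrow> \<bar>Y (p + v) $ 2 - form (\<lambda>i j. c i j $ 2) m v\<bar> \<le> C2 * norm v ^ Suc m"
      by (rule power_series_remainder[where m = m and c = "\<lambda>i j. c i j $ 2", OF r ck[where k = 2]])
         (use low in simp_all)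
    have est: "norm (Y (p + v) - form c m v) \<le> (C1 + C2 + 1) * norm v ^ Suc m" if "norm v \<le> min s1 s2" for v
    proof -
      have "norm (Y (p + v) - form c m v) \<le> \<bar>(Y (p + v) - form c m v) $ 1\<bar> + \<bar>(Y (p + v) - form c m v) $ 2\<bar>"
        using norm_le_l1_cart[of "Y (p + v) - form c m v"] by (simp add: sum_2)
      also have "\<dots> \<le> C1 * norm v ^ Suc m + C2 * norm v ^ Suc m"
        using 1(3)[of v] 2(3)[of v] that by (intro add_mono) (auto simp: form_component)
      also have "\<dots> \<le> (C1 + C2 + 1) * norm v ^ Suc m" by (simp add: algebra_simps)
      finally show ?thesis .
    qed
    have nv: "\<exists>v\<in>U. form c m v \<noteq> 0" if U: "open U" "U \<noteq> {}" for U
    proof (rule ccontr)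
      assume *: "\<not> (\<exists>v\<in>U. form c m v \<noteq> 0)"
      have "c i0 (m - i0) $ k = 0" for k
        by (rule form_vanishing[OF U, of "\<lambda>i j. c i j $ k" m])
           (use * ij in \<open>auto simp: form_component[symmetric]\<close>)
      moreover have "m - i0 = j0" using ij by simp
      ultimately show False using ij(2) by (simp add: vec_eq_iff)
    qed
    have "m \<ge> 1"
    proof (rule ccontr)
      assume "\<not> m \<ge> 1"
      then have m: "m = 0" by simp
      have "form c m 0 = Y p" using est[of 0] 1(1) 2(1) by simp
      then have "form c m 0 = 0" using Yp by simp
      then have "c 0 0 = 0" by (simp add: m form_def)
      then show False using ij m by simp
    qed
    then show thesis
      by (rule that(2)[of m "min s1 s2" "C1 + C2 + 1" c]) (use est nv 1 2 in auto)
  qed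
qed

section \<open>Convergence of the direction of an orbit\<close>

lemma one_way_crossing:
  fixes D :: "real \<Rightarrow> real"
  assumes der: "\<And>t. t \<ge> T \<Longrightarrow> (D has_real_derivative D' t) (at t)"
    and pos: "\<And>t. t \<ge> T \<Longrightarrow> D t = 0 \<Longrightarrow> D' t > 0"
  shows "(\<forall>\<^sub>F t in at_top. D t > 0) \<or> (\<forall>\<^sub>F t in at_top. D t < 0)"
proof (cases "\<forall>t\<ge>T. D t < 0")
  case True
  then show ?thesis using eventually_at_top_linorder by blast
next
  case False
  then obtain t1 where t1: "t1 \<ge> T" "D t1 \<ge> 0" by force
  have "D t2 > 0" if t2: "t1 < t2" for t2
  proof (rule ccontr)
    assume neg: "\<not> D t2 > 0"
    obtain a where a: "t1 \<le> a" "a < t2" "D a > 0"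
    proof (cases "D t1 > 0")
      case True then show ?thesis using that[of t1] t2 by simp
    next
      case False
      then have "D t1 = 0" using t1 by simp
      then obtain d where d: "d > 0" "\<And>h. 0 < h \<Longrightarrow> h < d \<Longrightarrow> D t1 < D (t1 + h)"
        using DERIV_pos_inc_right[OF der[OF t1(1)] pos[OF t1(1)]] by blast
      define h where "h = min d (t2 - t1) / 2"
      have h: "0 < h" "h < d" "t1 + h < t2" using d(1) t2 by (auto simp: h_def min_def field_simps)
      have "D (t1 + h) > 0" using d(2)[OF h(1,2)] \<open>D t1 = 0\<close> by simp
      then show ?thesis using that[of "t1 + h"] h by simp
    qed
    have cont: "continuous_on {a..t2} D"
      by (rule DERIV_continuous_on, rule has_field_derivative_at_within, rule der) (use a t1 in auto)
    define E where "E = {a..t2} \<inter> D -` {..0}"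
    have "closed E" unfolding E_def by (intro continuous_closed_preimage cont) auto
    moreover have "t2 \<in> E" using neg a by (auto simp: E_def)
    moreover have bdd: "bdd_below E" by (auto simp: E_def intro!: bdd_belowI[of _ a])
    ultimately have cE: "Inf E \<in> E" by (intro closed_contains_Inf) auto
    define c where "c = Inf E"
    have c: "a \<le> c" "c \<le> t2" "D c \<le> 0" using cE by (auto simp: E_def c_def)
    have before: "D t > 0" if "a \<le> t" "t < c" for t
    proof (rule ccontr)
      assume "\<not> D t > 0"
      then have "t \<in> E" using that c by (auto simp: E_def)
      then show False using cInf_lower[OF _ bdd, of t] that by (simp add: c_def)
    qed
    have ac: "a < c" using c a by (cases "a = c") auto
    have "D c \<ge> 0"
    proof (rule ccontr)
      assume "\<not> D c \<ge> 0"
      then have "\<exists>x. a \<le> x \<and> x \<le> c \<and> D x = 0"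
        by (intro IVT2' continuous_on_subset[OF cont]) (use a c in auto)
      then obtain x where "a \<le> x" "x \<le> c" "D x = 0" by blast
      then show False using before[of x] \<open>\<not> D c \<ge> 0\<close> by (cases "x = c") auto
    qed
    then have Dc: "D c = 0" using c by simp
    have cT: "c \<ge> T" using a c t1 by simp
    obtain d where d: "d > 0" "\<And>h. 0 < h \<Longrightarrow> h < d \<Longrightarrow> D (c - h) < D c"
      using DERIV_pos_inc_left[OF der[OF cT] pos[OF cT Dc]] by blast
    have "D (c - min d (c - a) / 2) < 0" using d(2)[of "min d (c - a) / 2"] d(1) ac Dc by auto
    moreover have "D (c - min d (c - a) / 2) > 0" using before[of "c - min d (c - a) / 2"] d(1) ac by (auto simp: min_def field_simps)
    ultimately show False by simp
  qed
  then have "\<forall>\<^sub>F t in at_top. D t > 0" using eventually_gt_at_top[of t1] by (rule eventually_mono[rotated])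
  then show ?thesis ..
qed

lemma eventually_const_sign:
  fixes D :: "real \<Rightarrow> real"
  assumes der: "\<And>t. t \<ge> T \<Longrightarrow> (D has_real_derivative D' t) (at t)"
    and sgn: "s \<noteq> 0" "\<And>t. t \<ge> T \<Longrightarrow> D t = 0 \<Longrightarrow> s * D' t > 0"
  shows "(\<forall>\<^sub>F t in at_top. D t > 0) \<or> (\<forall>\<^sub>F t in at_top. D t < 0)"
proof -
  have "(\<forall>\<^sub>F t in at_top. s * D t > 0) \<or> (\<forall>\<^sub>F t in at_top. s * D t < 0)"
    by (rule one_way_crossing[where D' = "\<lambda>t. s * D' t" and T = T])
       (use der sgn in \<open>auto intro: DERIV_cmult\<close>)
  then show ?thesis using sgn(1)
    by (cases "s > 0") (auto simp: zero_less_mult_iff mult_less_0_iff)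
qed

lemma sphere_limit_point:
  fixes u :: "real \<Rightarrow> 'a::euclidean_space"
  assumes "\<exists>\<^sub>F t in at_top. P t" "\<And>t. P t \<Longrightarrow> norm (u t) = 1"
  obtains a \<tau> where "filterlim \<tau> at_top sequentially" "\<And>k. P (\<tau> k)" "(\<lambda>k. u (\<tau> k)) \<longlonglongrightarrow> a"
proof -
  have "\<exists>t. t \<ge> real k \<and> P t" for k
    using assms(1) unfolding frequently_def eventually_at_top_linorder by blast
  then obtain \<sigma> where \<sigma>: "\<And>k. \<sigma> k \<ge> real k" "\<And>k. P (\<sigma> k)" by metis
  have "compact (sphere (0::'a) 1)" by simp
  moreover have "\<forall>k. u (\<sigma> k) \<in> sphere 0 1" using assms(2) \<sigma> by simp
  ultimately have "\<exists>l\<in>sphere 0 1. \<exists>\<rho>::nat \<Rightarrow> nat. strict_mono \<rho> \<and> ((\<lambda>k. u (\<sigma> k)) \<circ> \<rho>) \<longlonglongrightarrow> l"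
    unfolding compact_def by (elim allE[of _ "\<lambda>k. u (\<sigma> k)"] impE) simp_all
  then obtain a \<rho> where \<rho>: "strict_mono (\<rho> :: nat \<Rightarrow> nat)" "((\<lambda>k. u (\<sigma> k)) \<circ> \<rho>) \<longlonglongrightarrow> a"
    by blast
  have "filterlim \<sigma> at_top sequentially"
    by (rule filterlim_at_top_mono[OF filterlim_real_sequentially]) (use \<sigma> in auto)
  then have "filterlim (\<lambda>k. \<sigma> (\<rho> k)) at_top sequentially"
    by (rule filterlim_compose[OF _ filterlim_subseq[OF \<rho>(1)]])
  then show thesis using that[of "\<lambda>k. \<sigma> (\<rho> k)" a] \<sigma> \<rho>(2) by (simp add: o_def)
qed

text \<open>The sum \<open>a + b\<close> separates \<open>a\<close> from \<open>b\<close> unless these are opposite. In that case both are orthogonal to \<open>n\<close>, and \<open>n\<close> itself separates them.\<close>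

lemma separating_direction:
  fixes a b n :: "real^2"
  assumes ab: "norm a = 1" "norm b = 1" "a \<noteq> b" and n: "n \<noteq> 0" "n \<bullet> a \<ge> 0" "n \<bullet> b \<ge> 0"
  obtains v where "n \<bullet> v > 0" "det2 v a * det2 v b < 0"
proof (cases "b = - a")
  case True
  then have na: "n \<bullet> a = 0" using n by simp
  have "(det2 n a)\<^sup>2 = (norm n)\<^sup>2" using lagrange_identity[of n a] na ab by simp
  then have "det2 n a \<noteq> 0" using n by auto
  then have "det2 n a * det2 n a > 0" by (simp add: zero_less_mult_iff linorder_neq_iff disj_commute)
  moreover have "det2 n b = - det2 n a" using True by (simp add: det2_def)
  ultimately have "det2 n a * det2 n b < 0" by simp
  then show thesis using that[of n] n by simp
next
  case False
  have d: "det2 a b \<noteq> 0"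
  proof
    assume "det2 a b = 0"
    then have "(a \<bullet> b)\<^sup>2 = 1" using lagrange_identity[of a b] ab by simp
    then have "a \<bullet> b = 1 \<or> a \<bullet> b = -1" by (simp add: power2_eq_1_iff)
    moreover have "(norm (a - b))\<^sup>2 = 2 - 2 * (a \<bullet> b)" "(norm (a + b))\<^sup>2 = 2 + 2 * (a \<bullet> b)"
      using ab by (simp_all add: power2_norm_eq_inner inner_diff inner_add inner_commute norm_eq_1)
    ultimately show False using ab(3) False by (auto simp: add_eq_0_iff)
  qed
  have "n \<bullet> (a + b) > 0"
  proof (rule ccontr)
    assume "\<not> n \<bullet> (a + b) > 0"
    then have z: "n \<bullet> a = 0" "n \<bullet> b = 0" using n by (auto simp: inner_add_right)
    have "n $ 1 * det2 a b = (n \<bullet> a) * b $ 2 - (n \<bullet> b) * a $ 2" "n $ 2 * det2 a b = (n \<bullet> b) * a $ 1 - (n \<bullet> a) * b $ 1"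
      by (simp_all add: inner_vec2 det2_def algebra_simps)
    then have "n $ 1 = 0" "n $ 2 = 0" using z d by auto
    then show False using n(1) by (simp add: vec_eq_iff forall_2)
  qed
  moreover have "det2 (a + b) a * det2 (a + b) b < 0"
  proof -
    have "det2 (a + b) a = - det2 a b" "det2 (a + b) b = det2 a b" by (simp_all add: det2_def algebra_simps)
    then show ?thesis using d by (simp add: mult_neg_pos zero_less_mult_iff power2_eq_square[symmetric])
  qed
  ultimately show thesis by (rule that)
qed

text \<open>An orbit that tends to \<open>p\<close> and asymptotically stays in a half plane has a limit direction, provided
  that \<open>det2 v (H v)\<close> vanishes on no open set. If \<open>det2 v (H v) \<noteq> 0\<close>, the orbit crosses the ray through \<open>v\<close> close to \<open>p\<close> in one sense
  only, so it eventually stays on one side of it. For \<open>n \<bullet> v > 0\<close> it does not meet the opposite ray, which lies outside the half plane. Two different cluster points of the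
  direction could be separated by such a \<open>v\<close>, because separating them is an open condition.\<close>

lemma direction_converges:
  fixes Y H :: "real^2 \<Rightarrow> real^2" and \<gamma> :: "real \<Rightarrow> real^2"
  assumes hom: "\<And>s v. H (s *\<^sub>R v) = s ^ m *\<^sub>R H v"
    and est: "s0 > 0" "\<And>v. norm v \<le> s0 \<Longrightarrow> norm (Y (p + v) - H v) \<le> C * norm v ^ Suc m"
    and nondeg: "\<And>U. open U \<Longrightarrow> U \<noteq> {} \<Longrightarrow> \<exists>v\<in>U. det2 v (H v) \<noteq> 0"
    and sol: "\<forall>\<^sub>F t in at_top. (\<gamma> has_vector_derivative Y (\<gamma> t)) (at t) \<and> \<gamma> t \<noteq> p"
    and lim: "(\<gamma> \<longlongrightarrow> p) at_top"
    and n: "n \<noteq> 0" and half: "\<And>\<epsilon>. \<epsilon> > 0 \<Longrightarrow> \<forall>\<^sub>F t in at_top. n \<bullet> (\<gamma> t - p) \<ge> - \<epsilon> * norm (\<gamma> t - p)"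
  shows "\<exists>u. ((\<lambda>t. (\<gamma> t - p) /\<^sub>R norm (\<gamma> t - p)) \<longlongrightarrow> u) at_top"
proof -
  define w where "w t = \<gamma> t - p" for t
  define u where "u t = w t /\<^sub>R norm (w t)" for t
  have nz: "\<forall>\<^sub>F t in at_top. w t \<noteq> 0" using sol by eventually_elim (simp add: w_def)
  have w0: "(w \<longlongrightarrow> 0) at_top" unfolding w_def using lim by (simp add: LIM_zero)
  have sign: "(\<forall>\<^sub>F t in at_top. det2 v (w t) > 0) \<or> (\<forall>\<^sub>F t in at_top. det2 v (w t) < 0)"
    if v: "n \<bullet> v > 0" "det2 v (H v) \<noteq> 0" for v
  proof -
    \<comment> \<open>For \<open>w t = l *\<^sub>R v\<close> with \<open>l > 0\<close> the derivative of \<open>det2 v (w t)\<close> is \<open>l\<^sup>m A\<close> up to an error of order \<open>l ^ Suc m\<close>.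
      The radius \<open>r\<close> makes the error smaller than the main term, and \<open>\<epsilon>\<close> excludes \<open>l < 0\<close>.\<close>
    define A where "A = det2 v (H v)"
    have v0: "v \<noteq> 0" using v by auto
    define \<epsilon> where "\<epsilon> = (n \<bullet> v) / (2 * norm v)"
    have \<epsilon>: "\<epsilon> > 0" using v v0 by (simp add: \<epsilon>_def)
    define r where "r = min s0 (\<bar>A\<bar> / ((\<bar>C\<bar> + 1) * norm v ^ (m + 2)) * norm v)"
    have r: "r > 0" using est v v0 by (auto simp: r_def A_def)
    have "\<forall>\<^sub>F t in at_top. norm (w t) < r" using tendstoD[OF w0 r] by (simp add: dist_norm)
    with half[OF \<epsilon>] sol have "\<forall>\<^sub>F t in at_top. norm (w t) < r \<and> n \<bullet> w t \<ge> - \<epsilon> * norm (w t) \<and>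
        (\<gamma> has_vector_derivative Y (\<gamma> t)) (at t) \<and> w t \<noteq> 0"
      by eventually_elim (simp add: w_def)
    then obtain T where T: "\<And>t. t \<ge> T \<Longrightarrow> norm (w t) < r" "\<And>t. t \<ge> T \<Longrightarrow> n \<bullet> w t \<ge> - \<epsilon> * norm (w t)"
        "\<And>t. t \<ge> T \<Longrightarrow> (\<gamma> has_vector_derivative Y (\<gamma> t)) (at t)" "\<And>t. t \<ge> T \<Longrightarrow> w t \<noteq> 0"
      unfolding eventually_at_top_linorder by blast
    show ?thesis
    proof (rule eventually_const_sign[where s = A and D' = "\<lambda>t. det2 v (Y (\<gamma> t))" and T = T])
      show "A \<noteq> 0" using v by (simp add: A_def)
      fix t assume t: "t \<ge> T"
      have "(w has_vector_derivative Y (\<gamma> t)) (at t)"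
        unfolding w_def using T(3)[OF t] by (simp add: has_vector_derivative_diff_const)
      then show "((\<lambda>t. det2 v (w t)) has_real_derivative det2 v (Y (\<gamma> t))) (at t)"
        using bounded_linear.has_vector_derivative[OF bounded_linear_det2]
        by (simp add: has_real_derivative_iff_has_vector_derivative)
      assume d0: "det2 v (w t) = 0"
      define l where "l = (v \<bullet> w t) / (norm v)\<^sup>2"
      have wl: "w t = l *\<^sub>R v"
      proof -
        have "(norm v)\<^sup>2 *\<^sub>R w t = (v \<bullet> w t) *\<^sub>R v"
        proof -
          have d: "v $ 1 * w t $ 2 = v $ 2 * w t $ 1" using d0 by (simp add: det2_def)
          have "((v $ 1)\<^sup>2 + (v $ 2)\<^sup>2) * w t $ 1 = (v $ 1 * w t $ 1 + v $ 2 * w t $ 2) * v $ 1"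
               "((v $ 1)\<^sup>2 + (v $ 2)\<^sup>2) * w t $ 2 = (v $ 1 * w t $ 1 + v $ 2 * w t $ 2) * v $ 2"
            using d by algebra+
          then show ?thesis unfolding vec_eq_iff forall_2 norm_vec2 inner_vec2 by simp
        qed
        then have "inverse ((norm v)\<^sup>2) *\<^sub>R ((norm v)\<^sup>2 *\<^sub>R w t) = inverse ((norm v)\<^sup>2) *\<^sub>R ((v \<bullet> w t) *\<^sub>R v)" by simp
        then show ?thesis using v0 by (simp add: l_def divide_inverse mult.commute)
      qed
      have l0: "l > 0"
      proof (rule ccontr)
        assume "\<not> l > 0"
        then have l: "l < 0" using wl T(4)[OF t] by (cases "l = 0") auto
        have "l * (n \<bullet> v) \<ge> - \<epsilon> * (- l * norm v)"
          using T(2)[OF t] l by (simp add: wl)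
        also have "- \<epsilon> * (- l * norm v) = l * (n \<bullet> v) / 2" using v0 by (simp add: \<epsilon>_def)
        finally have "l * (n \<bullet> v) \<ge> 0" by simp
        then show False using l v by (simp add: zero_le_mult_iff)
      qed
      define R where "R = Y (\<gamma> t) - H (w t)"
      have small: "norm (w t) < s0" "norm (w t) < \<bar>A\<bar> / ((\<bar>C\<bar> + 1) * norm v ^ (m + 2)) * norm v"
        using T(1)[OF t] by (auto simp: r_def)
      have "norm R \<le> C * norm (w t) ^ Suc m"
        using est(2)[of "w t"] small(1) by (simp add: R_def w_def)
      also have "\<dots> \<le> (\<bar>C\<bar> + 1) * norm (w t) ^ Suc m" by (intro mult_right_mono) auto
      finally have nR: "norm R \<le> (\<bar>C\<bar> + 1) * norm (w t) ^ Suc m" .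
      have "det2 v (Y (\<gamma> t)) = l ^ m * A + det2 v R"
        using hom[of l v] by (simp add: R_def det2_diff wl A_def)
      moreover have "\<bar>det2 v R\<bar> < l ^ m * \<bar>A\<bar>"
      proof -
        have "\<bar>det2 v R\<bar> \<le> norm v * ((\<bar>C\<bar> + 1) * norm (w t) ^ Suc m)"
          using abs_det2_le[of v R] nR mult_left_mono[OF nR, of "norm v"] by simp
        also have "\<dots> = (\<bar>C\<bar> + 1) * norm v ^ (m + 2) * l * l ^ m"
          using l0 by (simp add: wl power_mult_distrib mult_ac)
        also have "\<dots> < \<bar>A\<bar> * l ^ m"
        proof (rule mult_strict_right_mono)
          define K where "K = (\<bar>C\<bar> + 1) * norm v ^ (m + 2)"
          have "K > 0" unfolding K_def using v0 by (intro mult_pos_pos) auto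
          have "norm (w t) < \<bar>A\<bar> / K * norm v" using small(2) by (simp only: K_def)
          then have "l * norm v < \<bar>A\<bar> / K * norm v" using l0 by (simp only: wl norm_scaleR abs_of_pos)
          then have "l < \<bar>A\<bar> / K" by (rule mult_right_less_imp_less) simp
          then have "K * l < \<bar>A\<bar>" using \<open>K > 0\<close> by (simp add: pos_less_divide_eq mult.commute)
          then show "(\<bar>C\<bar> + 1) * norm v ^ (m + 2) * l < \<bar>A\<bar>"
            by (simp only: K_def)
        qed (use l0 in simp)
        finally show ?thesis by (simp add: mult.commute)
      qed
      ultimately have "sgn (det2 v (Y (\<gamma> t))) = sgn A"
        using l0 v by (cases "A > 0") (auto simp: sgn_if A_def abs_if mult_less_0_iff split: if_splits)
      then show "A * det2 v (Y (\<gamma> t)) > 0"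
        using v by (auto simp: A_def sgn_if zero_less_mult_iff split: if_splits)
    qed
  qed
  have unorm: "norm (u t) = 1" if "w t \<noteq> 0" for t using that by (simp add: u_def)
  have limhalf: "n \<bullet> a \<ge> 0" if \<tau>: "filterlim \<tau> at_top sequentially" "(\<lambda>k. u (\<tau> k)) \<longlonglongrightarrow> a" for a \<tau>
  proof (rule field_le_epsilon)
    fix \<epsilon> :: real assume \<epsilon>: "\<epsilon> > 0"
    have "\<forall>\<^sub>F t in at_top. n \<bullet> u t \<ge> - \<epsilon>"
      using half[OF \<epsilon>] nz by eventually_elim (simp add: u_def w_def[symmetric] field_simps)
    then have "\<forall>\<^sub>F k in sequentially. n \<bullet> u (\<tau> k) \<ge> - \<epsilon>"
      by (rule eventually_compose_filterlim[OF _ \<tau>(1)])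
    moreover have "(\<lambda>k. n \<bullet> u (\<tau> k)) \<longlonglongrightarrow> n \<bullet> a" by (intro tendsto_intros \<tau>(2))
    ultimately have "- \<epsilon> \<le> n \<bullet> a" by (intro tendsto_lowerbound[where F = sequentially]) auto
    then show "0 \<le> n \<bullet> a + \<epsilon>" by simp
  qed
  have limnorm: "norm a = 1" if "\<And>k. w (\<tau> k) \<noteq> 0" "(\<lambda>k. u (\<tau> k)) \<longlonglongrightarrow> a" for a \<tau>
  proof -
    have "(\<lambda>k. norm (u (\<tau> k))) \<longlonglongrightarrow> norm a" by (intro tendsto_intros that)
    then show ?thesis using that(1) unorm by (simp add: LIMSEQ_const_iff)
  qed
  have "\<exists>\<^sub>F t in at_top. w t \<noteq> 0" using nz by (rule eventually_frequently[rotated]) simp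
  then obtain a \<tau>a where a: "filterlim \<tau>a at_top sequentially" "\<And>k. w (\<tau>a k) \<noteq> 0" "(\<lambda>k. u (\<tau>a k)) \<longlonglongrightarrow> a"
    by (rule sphere_limit_point[of "\<lambda>t. w t \<noteq> 0" u, OF _ unorm]) (assumption, rule that)
  have "(u \<longlongrightarrow> a) at_top"
  proof (rule ccontr)
    assume "\<not> (u \<longlongrightarrow> a) at_top"
    then obtain \<epsilon> where \<epsilon>: "\<epsilon> > 0" "\<not> (\<forall>\<^sub>F t in at_top. dist (u t) a < \<epsilon>)"
      unfolding tendsto_iff by blast
    then have "\<exists>\<^sub>F t in at_top. \<not> dist (u t) a < \<epsilon>" by (simp add: frequently_def)
    then have "\<exists>\<^sub>F t in at_top. \<not> dist (u t) a < \<epsilon> \<and> w t \<noteq> 0"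
      using nz by (rule frequently_eventually_frequently)
    then obtain b \<tau>b where b: "filterlim \<tau>b at_top sequentially"
        "\<And>k. \<not> dist (u (\<tau>b k)) a < \<epsilon> \<and> w (\<tau>b k) \<noteq> 0" "(\<lambda>k. u (\<tau>b k)) \<longlonglongrightarrow> b"
      by (rule sphere_limit_point[of "\<lambda>t. \<not> dist (u t) a < \<epsilon> \<and> w t \<noteq> 0" u]) (use unorm that in blast)+
    have "(\<lambda>k. dist (u (\<tau>b k)) a) \<longlonglongrightarrow> dist b a" by (intro tendsto_intros b)
    then have "dist b a \<ge> \<epsilon>"
      by (rule tendsto_lowerbound) (use b(2) in \<open>auto simp: not_less\<close>)
    then have ab: "a \<noteq> b" using \<epsilon> by auto
    obtain v1 where v1: "n \<bullet> v1 > 0" "det2 v1 a * det2 v1 b < 0"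
      by (rule separating_direction[OF limnorm[OF a(2,3)] limnorm[OF _ b(3)] ab n limhalf[OF a(1,3)] limhalf[OF b(1,3)]])
         (use b(2) in blast)
    define U where "U = {v. n \<bullet> v > 0 \<and> det2 v a * det2 v b < 0}"
    have "open U" unfolding U_def by (intro open_Collect_conj open_Collect_less continuous_intros)
    moreover have "U \<noteq> {}" using v1 by (auto simp: U_def)
    ultimately obtain v where v: "n \<bullet> v > 0" "det2 v a * det2 v b < 0" "det2 v (H v) \<noteq> 0"
      using nondeg[of U] by (auto simp: U_def)
    have lima: "det2 v c \<ge> 0" if "\<forall>\<^sub>F t in at_top. det2 v (w t) > 0" "filterlim \<tau> at_top sequentially" "(\<lambda>k. u (\<tau> k)) \<longlonglongrightarrow> c" for c \<tau>
    proof -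
      have "\<forall>\<^sub>F t in at_top. det2 v (u t) \<ge> 0"
        using that(1) by eventually_elim (simp add: u_def)
      then have "\<forall>\<^sub>F k in sequentially. det2 v (u (\<tau> k)) \<ge> 0"
        by (rule eventually_compose_filterlim[OF _ that(2)])
      moreover have "(\<lambda>k. det2 v (u (\<tau> k))) \<longlonglongrightarrow> det2 v c" by (intro tendsto_intros that)
      ultimately show ?thesis by (intro tendsto_lowerbound[where F = sequentially]) auto
    qed
    have limb: "det2 v c \<le> 0" if "\<forall>\<^sub>F t in at_top. det2 v (w t) < 0" "filterlim \<tau> at_top sequentially" "(\<lambda>k. u (\<tau> k)) \<longlonglongrightarrow> c" for c \<tau>
    proof -
      have "\<forall>\<^sub>F t in at_top. det2 v (u t) \<le> 0"
        using that(1) by eventually_elim (simp add: u_def mult_nonneg_nonpos)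
      then have "\<forall>\<^sub>F k in sequentially. det2 v (u (\<tau> k)) \<le> 0"
        by (rule eventually_compose_filterlim[OF _ that(2)])
      moreover have "(\<lambda>k. det2 v (u (\<tau> k))) \<longlonglongrightarrow> det2 v c" by (intro tendsto_intros that)
      ultimately show ?thesis by (intro tendsto_upperbound[where F = sequentially]) auto
    qed
    from sign[OF v(1,3)] show False
    proof
      assume "\<forall>\<^sub>F t in at_top. det2 v (w t) > 0"
      from lima[OF this a(1,3)] lima[OF this b(1,3)] v(2) show False by (simp add: mult_less_0_iff)
    next
      assume "\<forall>\<^sub>F t in at_top. det2 v (w t) < 0"
      from limb[OF this a(1,3)] limb[OF this b(1,3)] v(2) show False by (simp add: mult_less_0_iff)
    qed
  qed
  then show ?thesis unfolding u_def w_def by blast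
qed

section \<open>Orbits entering a zero with almost radial leading form\<close>

lemma nonincreasing_converges:
  fixes g :: "real \<Rightarrow> real"
  assumes dec: "\<And>s t. T \<le> s \<Longrightarrow> s \<le> t \<Longrightarrow> g t \<le> g s" and bd: "\<And>t. T \<le> t \<Longrightarrow> B \<le> g t"
  shows "\<exists>l. (g \<longlongrightarrow> l) at_top"
proof
  have bdd: "bdd_below (g ` {T..})" using bd by (auto intro!: bdd_belowI[of _ B])
  show "(g \<longlongrightarrow> Inf (g ` {T..})) at_top"
  proof (rule decreasing_tendsto)
    show "\<forall>\<^sub>F t in at_top. Inf (g ` {T..}) \<le> g t"
      using eventually_ge_at_top[of T] by eventually_elim (auto intro!: cInf_lower bdd)
    fix x assume "Inf (g ` {T..}) < x"
    then obtain s where s: "s \<ge> T" "g s < x" using cInf_lessD[of "g ` {T..}" x] by auto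
    show "\<forall>\<^sub>F t in at_top. g t < x"
      using eventually_ge_at_top[of s]
    proof eventually_elim
      case (elim t)
      then show ?case using dec[of s t] s by linarith
    qed
  qed
qed

text \<open>As long as \<open>a\<close> stays above some \<open>e > 0\<close> it decreases at least at the rate \<open>k e\<^sup>m\<close>, which cannot go on forever.\<close>

lemma decreasing_to_zero:
  fixes a :: "real \<Rightarrow> real"
  assumes der: "\<And>t. t \<ge> 0 \<Longrightarrow> (a has_real_derivative a' t) (at t within {0..})"
    and pos: "\<And>t. t \<ge> 0 \<Longrightarrow> a t > 0"
    and rate: "\<And>t. t \<ge> 0 \<Longrightarrow> a' t \<le> - k * a t ^ m" and k: "k > 0"
  shows "(a \<longlongrightarrow> 0) at_top"
    and "\<And>s t. 0 \<le> s \<Longrightarrow> s \<le> t \<Longrightarrow> a t \<le> a s"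
proof -
  have der_at: "(a has_real_derivative a' t) (at t)" if "t > 0" for t
    using der[of t] that at_within_interior[of t "{0..}"] by simp
  have cont: "continuous_on {s..t} a" if "0 \<le> s" for s t
    by (rule continuous_on_subset[OF DERIV_continuous_on[of "{0..}" a a']]) (use der that in auto)
  show dec: "a t \<le> a s" if st: "0 \<le> s" "s \<le> t" for s t
  proof -
    have "- a s \<le> - a t"
    proof (rule DERIV_nonneg_imp_increasing_open[where f = "\<lambda>t. - a t"])
      fix r assume r: "s < r" "r < t"
      have "k * a r ^ m \<ge> 0" using k pos[of r] r st by (intro mult_nonneg_nonneg) auto
      then have "- a' r \<ge> 0" using rate[of r] r st by simp
      then show "\<exists>D. DERIV (\<lambda>t. - a t) r :> D \<and> 0 \<le> D"
        using DERIV_minus[OF der_at[of r]] r st by auto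
    qed (use st cont in \<open>auto intro!: continuous_intros\<close>)
    then show ?thesis by simp
  qed
  show "(a \<longlongrightarrow> 0) at_top"
  proof (rule decreasing_tendsto)
    show "\<forall>\<^sub>F t in at_top. 0 \<le> a t"
      using eventually_ge_at_top[of 0] by eventually_elim (rule less_imp_le[OF pos])
    fix e :: real assume e: "0 < e"
    have "\<exists>t\<ge>0. a t < e"
    proof (rule ccontr)
      assume "\<not> (\<exists>t\<ge>0. a t < e)"
      then have ge: "a t \<ge> e" if "t \<ge> 0" for t using that by force
      define c where "c = k * e ^ m"
      have c: "c > 0" using k e by (simp add: c_def)
      define t where "t = a 0 / c + 1"
      have t: "t > 0" using c pos[of 0] by (simp add: t_def add_pos_pos)
      have "- (a 0 + c * 0) \<le> - (a t + c * t)"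
      proof (rule DERIV_nonneg_imp_increasing_open[where f = "\<lambda>t. - (a t + c * t)"])
        fix r assume r: "0 < r" "r < t"
        have "c \<le> k * a r ^ m" unfolding c_def using ge[of r] e k r by (intro mult_left_mono power_mono) auto
        then have "- (a' r + c * 1) \<ge> 0" using rate[of r] r by simp
        moreover have "DERIV (\<lambda>t. - (a t + c * t)) r :> - (a' r + c * 1)"
          by (intro DERIV_minus DERIV_add DERIV_cmult DERIV_ident der_at r)
        ultimately show "\<exists>D. DERIV (\<lambda>t. - (a t + c * t)) r :> D \<and> 0 \<le> D" by blast
      qed (use t cont in \<open>auto intro!: continuous_intros\<close>)
      then have "a t \<le> a 0 - c * t" by simp
      also have "\<dots> = - c" using c by (simp add: t_def field_simps)
      finally show False using pos[of t] c t by simp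
    qed
    then obtain t where t: "t \<ge> 0" "a t < e" by blast
    show "\<forall>\<^sub>F s in at_top. a s < e"
      using eventually_ge_at_top[of t]
    proof eventually_elim
      case (elim s)
      then show ?case using dec[of t s] t by linarith
    qed
  qed
qed

lemma norm_one_vec2:
  fixes v :: "real^2"
  shows "norm v = 1 \<longleftrightarrow> v $ 1 * v $ 1 + v $ 2 * v $ 2 = 1"
  by (simp add: norm_eq_1 inner_vec2)

lemma eq_scaled_frame:
  fixes v w :: "real^2"
  assumes "norm v = 1"
  shows "w = (v \<bullet> w) *\<^sub>R v + det2 v w *\<^sub>R vector [- v $ 2, v $ 1]"
proof -
  have 1: "v $ 1 * v $ 1 + v $ 2 * v $ 2 = 1"
    using assms by (rule norm_one_vec2[THEN iffD1])
  have "w $ 1 = (v $ 1 * w $ 1 + v $ 2 * w $ 2) * v $ 1 + (v $ 1 * w $ 2 - v $ 2 * w $ 1) * - (v $ 2)"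
    "w $ 2 = (v $ 1 * w $ 1 + v $ 2 * w $ 2) * v $ 2 + (v $ 1 * w $ 2 - v $ 2 * w $ 1) * v $ 1"
    using 1 by algebra+
  then show ?thesis
    unfolding vec_eq_iff forall_2 inner_vec2 det2_def vector_add_component vector_scaleR_component vector_2
      real_scaleR_def by (rule conjI)
qed

text \<open>In the coordinates \<open>a = v0 \<bullet> w\<close> and \<open>b = det2 v0 w\<close> of \<open>w = x - p\<close> consider the slope \<open>\<sigma> = b / a\<close>. Since \<open>H\<close> is radial, only the error
  term of \<open>Y\<close> contributes to the derivative of \<open>\<sigma>\<close>, which is of order \<open>a\<^sup>m\<close>, while \<open>a\<close> decreases at least at a rate of
  the same order. So \<open>\<sigma>\<close> changes at most by a constant multiple \<open>c\<close> of the change of \<open>a\<close>: a solution that starts on the ray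
  through \<open>v0\<close> close to \<open>p\<close> never leaves the thin sector around it, and both \<open>a\<close> and \<open>\<sigma>\<close> converge.\<close>

lemma entering_sector_orbit:
  fixes Y H :: "real^2 \<Rightarrow> real^2"
  assumes lip: "locally_lipschitz Y" and Yp: "Y p = 0"
    and hom: "\<And>s v. H (s *\<^sub>R v) = s ^ m *\<^sub>R H v" and contH: "continuous_on UNIV H"
    and m: "m \<ge> 1" and C: "C > 0"
    and est: "s0 > 0" "\<And>v. norm v \<le> s0 \<Longrightarrow> norm (Y (p + v) - H v) \<le> C * norm v ^ Suc m"
    and radial: "\<And>v. det2 v (H v) = 0"
    and v0: "norm v0 = 1" "v0 \<bullet> H v0 < 0" and n: "n \<bullet> v0 > 0"
  obtains x \<sigma> \<nu> where "solves Y x {0..}" "\<And>t. t \<ge> 0 \<Longrightarrow> Y (x t) \<noteq> 0" "(x \<longlongrightarrow> p) at_top"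
    "((\<lambda>t. (x t - p) /\<^sub>R norm (x t - p)) \<longlongrightarrow> \<sigma>) at_top"
    "\<nu> > 0" "\<And>t. t \<ge> 0 \<Longrightarrow> n \<bullet> (x t - p) \<ge> \<nu> * norm (x t - p)" "\<And>t. t \<ge> 0 \<Longrightarrow> x t \<noteq> p"
proof -
  define e where "e = (vector [- v0 $ 2, v0 $ 1] :: real^2)"
  have v01: "v0 $ 1 * v0 $ 1 + v0 $ 2 * v0 $ 2 = 1"
    using v0(1) by (rule norm_one_vec2[THEN iffD1])
  have e1: "norm e = 1"
    unfolding norm_one_vec2 e_def using v01 by (simp add: add.commute)
  define k where "k = - (v0 \<bullet> H v0) / 4"
  define \<nu> where "\<nu> = (n \<bullet> v0) / 4"
  have k: "k > 0" and \<nu>: "\<nu> > 0" using v0 n by (auto simp: k_def \<nu>_def)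
  obtain \<eta> where \<eta>: "\<eta> > 0" "\<eta> \<le> 1" "\<And>\<sigma>. \<bar>\<sigma>\<bar> \<le> \<eta> \<Longrightarrow> v0 \<bullet> H (v0 + \<sigma> *\<^sub>R e) \<le> - 2 * k"
      "\<And>\<sigma>. \<bar>\<sigma>\<bar> \<le> \<eta> \<Longrightarrow> n \<bullet> (v0 + \<sigma> *\<^sub>R e) \<ge> 2 * \<nu>"
  proof -
    have "isCont (\<lambda>\<sigma>. v0 \<bullet> H (v0 + \<sigma> *\<^sub>R e)) 0" "isCont (\<lambda>\<sigma>. n \<bullet> (v0 + \<sigma> *\<^sub>R e)) 0"
      by (rule continuous_on_interior[of UNIV], auto intro!: continuous_intros continuous_on_compose2[OF contH])+
    then have "\<exists>d>0. \<forall>\<sigma>. dist \<sigma> 0 < d \<longrightarrow> dist (v0 \<bullet> H (v0 + \<sigma> *\<^sub>R e)) (v0 \<bullet> H (v0 + 0 *\<^sub>R e)) < 2 * k"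
        "\<exists>d>0. \<forall>\<sigma>. dist \<sigma> 0 < d \<longrightarrow> dist (n \<bullet> (v0 + \<sigma> *\<^sub>R e)) (n \<bullet> (v0 + 0 *\<^sub>R e)) < 2 * \<nu>"
      unfolding continuous_at_eps_delta using k \<nu> by (simp_all only: mult_pos_pos zero_less_numeral)
    then obtain d1 d2 where d: "d1 > 0" "d2 > 0"
      "\<And>\<sigma>. \<bar>\<sigma>\<bar> < d1 \<Longrightarrow> \<bar>v0 \<bullet> H (v0 + \<sigma> *\<^sub>R e) - v0 \<bullet> H v0\<bar> < 2 * k"
      "\<And>\<sigma>. \<bar>\<sigma>\<bar> < d2 \<Longrightarrow> \<bar>n \<bullet> (v0 + \<sigma> *\<^sub>R e) - n \<bullet> v0\<bar> < 2 * \<nu>"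
      by (auto simp: dist_real_def)
    show ?thesis
    proof (rule that[of "min (min d1 d2 / 2) 1"])
      fix \<sigma> :: real assume s: "\<bar>\<sigma>\<bar> \<le> min (min d1 d2 / 2) 1"
      then have "\<bar>\<sigma>\<bar> < d1" "\<bar>\<sigma>\<bar> < d2" using d by auto
      with d(3,4)[of \<sigma>] show "v0 \<bullet> H (v0 + \<sigma> *\<^sub>R e) \<le> - 2 * k" "n \<bullet> (v0 + \<sigma> *\<^sub>R e) \<ge> 2 * \<nu>"
        by (auto simp: k_def \<nu>_def abs_if field_simps split: if_splits)
    qed (use d in auto)
  qed
  \<comment> \<open>In the sector \<open>norm w \<le> 2 a\<close>, so \<open>C'\<close> is the error constant in terms of \<open>a\<close>. The bound \<open>\<delta>\<close> on \<open>a\<close> keeps the error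
    below half of the radial speed, and keeps the total change of slope below \<open>\<eta>\<close>.\<close>
  define C' where "C' = C * 2 ^ Suc m"
  have C': "C' > 0" using C by (simp add: C'_def)
  define c where "c = 2 * C' / k"
  have c: "c > 0" using C' k by (simp add: c_def)
  define \<delta> where "\<delta> = min (s0 / 2) (min (k / C') (\<eta> / (2 * c)))"
  have \<delta>: "\<delta> > 0" "\<delta> \<le> s0 / 2" "C' * \<delta> \<le> k" "c * \<delta> < \<eta>"
  proof -
    have "\<delta> \<le> s0 / 2" "\<delta> \<le> min (k / C') (\<eta> / (2 * c))"
      unfolding \<delta>_def by (rule min.cobounded1 min.cobounded2)+
    then have le: "\<delta> \<le> s0 / 2" "\<delta> \<le> k / C'" "\<delta> \<le> \<eta> / (2 * c)" by simp_all
    show "\<delta> > 0" using est k C' \<eta> c by (simp add: \<delta>_def)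
    show "\<delta> \<le> s0 / 2" by (rule le)
    show "C' * \<delta> \<le> k" using le(2) C' by (simp add: field_simps)
    have "c * \<delta> \<le> \<eta> / 2" using le(3) c by (simp add: field_simps)
    then show "c * \<delta> < \<eta>" using \<eta> by simp
  qed
  have sector: "v0 \<bullet> Y (p + w) \<le> - k * (v0 \<bullet> w) ^ m"
      "\<bar>det2 w (Y (p + w))\<bar> \<le> 2 * C' * (v0 \<bullet> w) ^ Suc (Suc m)" "norm w \<le> 2 * (v0 \<bullet> w)"
    if w: "0 < v0 \<bullet> w" "v0 \<bullet> w \<le> \<delta>" "\<bar>det2 v0 w\<bar> \<le> \<eta> * (v0 \<bullet> w)" for w
  proof -
    define a where "a = v0 \<bullet> w"
    define \<sigma> where "\<sigma> = det2 v0 w / a"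
    have a: "0 < a" "a \<le> \<delta>" using w by (auto simp: a_def)
    have \<sigma>: "\<bar>\<sigma>\<bar> \<le> \<eta>" using w a by (simp add: \<sigma>_def a_def field_simps)
    have weq: "w = a *\<^sub>R (v0 + \<sigma> *\<^sub>R e)"
      using eq_scaled_frame[OF v0(1), of w] a by (simp add: \<sigma>_def a_def[symmetric] e_def scaleR_add_right)
    have "norm (v0 + \<sigma> *\<^sub>R e) \<le> 1 + \<bar>\<sigma>\<bar>" using norm_triangle_ineq[of v0 "\<sigma> *\<^sub>R e"] v0 e1 by simp
    then have "norm (v0 + \<sigma> *\<^sub>R e) \<le> 2" using \<sigma> \<eta> by simp
    then show nw: "norm w \<le> 2 * (v0 \<bullet> w)" using a by (simp add: weq[symmetric] a_def[symmetric]) (metis abs_of_pos mult.commute mult_left_mono norm_scaleR order_less_imp_le weq)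
    define R where "R = Y (p + w) - H w"
    have "norm w \<le> s0" using nw a \<delta> by (simp add: a_def)
    then have "norm R \<le> C * norm w ^ Suc m" unfolding R_def by (rule est(2))
    also have "\<dots> \<le> C * (2 * a) ^ Suc m" using nw C by (intro mult_left_mono power_mono) (auto simp: a_def)
    also have "\<dots> = C' * a ^ Suc m" by (simp add: C'_def power_mult_distrib mult_ac)
    finally have R: "norm R \<le> C' * a ^ Suc m" .
    have Hw: "H w = a ^ m *\<^sub>R H (v0 + \<sigma> *\<^sub>R e)" using hom[of a "v0 + \<sigma> *\<^sub>R e"] by (simp add: weq[symmetric])
    have "v0 \<bullet> Y (p + w) = v0 \<bullet> H w + v0 \<bullet> R" by (simp add: R_def inner_diff_right)
    also have "v0 \<bullet> H w = a ^ m * (v0 \<bullet> H (v0 + \<sigma> *\<^sub>R e))" by (simp add: Hw)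
    also have "\<dots> \<le> a ^ m * (- 2 * k)" using \<eta>(3)[OF \<sigma>] a by (intro mult_left_mono) auto
    also have "v0 \<bullet> R \<le> norm R" using norm_cauchy_schwarz[of v0 R] v0 by simp
    also have "norm R \<le> a ^ m * k"
    proof -
      have "C' * a ^ Suc m = a ^ m * (C' * a)" by simp
      also have "\<dots> \<le> a ^ m * (C' * \<delta>)" using a C' by (intro mult_left_mono) auto
      also have "\<dots> \<le> a ^ m * k" using \<delta> a by (intro mult_left_mono) auto
      finally show ?thesis using R by linarith
    qed
    finally show "v0 \<bullet> Y (p + w) \<le> - k * (v0 \<bullet> w) ^ m" by (simp add: a_def algebra_simps)
    have "\<bar>det2 w (Y (p + w))\<bar> = \<bar>det2 w R\<bar>" using radial[of w] by (simp add: R_def det2_diff)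
    also have "\<dots> \<le> norm w * norm R" by (rule abs_det2_le)
    also have "\<dots> \<le> (2 * a) * (C' * a ^ Suc m)" using nw R a by (intro mult_mono) (auto simp: a_def)
    finally show "\<bar>det2 w (Y (p + w))\<bar> \<le> 2 * C' * (v0 \<bullet> w) ^ Suc (Suc m)" by (simp add: a_def mult_ac)
  qed
  obtain x where x: "x 0 = p + (\<delta> / 2) *\<^sub>R v0"
      "solves (\<lambda>x. Y (closest_point (cball p s0) x)) x UNIV"
    using clamped_global_solution[OF lip est(1), of "p + (\<delta> / 2) *\<^sub>R v0" p] by (elim exE conjE)
  define F where "F = (\<lambda>x. Y (closest_point (cball p s0) x))"
  have xF: "solves F x UNIV" using x(2) by (simp add: F_def)
  have FY: "F q = Y q" if "norm (q - p) \<le> s0" for q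
    unfolding F_def using that by (subst closest_point_self) (auto simp: dist_norm norm_minus_commute)
  define w where "w t = x t - p" for t
  define a where "a t = v0 \<bullet> w t" for t
  define b where "b t = det2 v0 (w t)" for t
  define \<sigma> where "\<sigma> t = b t / a t" for t
  \<comment> \<open>While \<open>good\<close> holds, the sector estimates apply. The start at distance \<open>\<delta> / 2\<close> leaves room below the bound \<open>\<delta>\<close>, so that \<open>good\<close> is an
    open condition that holds at time \<open>0\<close>.\<close>
  define good where "good t \<longleftrightarrow> \<bar>b t\<bar> < \<eta> * a t \<and> a t < \<delta>" for t
  have a0: "a 0 = \<delta> / 2" "b 0 = 0" using v0 x(1)
    by (auto simp: a_def b_def w_def dot_square_norm)
  have weq: "w t = a t *\<^sub>R v0 + b t *\<^sub>R e" for t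
    unfolding a_def b_def e_def by (rule eq_scaled_frame[OF v0(1)])
  have dw: "(w has_vector_derivative F (x t)) (at t)" for t
    using solves_at[OF xF, of UNIV t] unfolding w_def by (simp add: has_vector_derivative_diff_const)
  have da: "(a has_real_derivative v0 \<bullet> F (x t)) (at t)" for t
    using bounded_linear.has_vector_derivative[OF bounded_linear_inner_right dw, of v0]
    unfolding a_def has_real_derivative_iff_has_vector_derivative .
  have db: "(b has_real_derivative det2 v0 (F (x t))) (at t)" for t
    using bounded_linear.has_vector_derivative[OF bounded_linear_det2 dw, of v0]
    unfolding b_def has_real_derivative_iff_has_vector_derivative .
  have ca: "continuous_on A a" and cb: "continuous_on A b" for A
    using da db by (auto intro!: continuous_at_imp_continuous_on DERIV_isCont)
  have good_pos: "a t > 0" if "good t" for t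
  proof -
    have "0 < \<eta> * a t" using that by (auto simp: good_def)
    then show ?thesis using \<eta>(1) by (simp add: zero_less_mult_iff)
  qed
  have good_est: "v0 \<bullet> F (x t) \<le> - k * a t ^ m" "\<bar>det2 (w t) (F (x t))\<bar> \<le> 2 * C' * a t ^ Suc (Suc m)"
      "norm (w t) \<le> 2 * a t" "norm (x t - p) \<le> s0" if g: "good t" for t
  proof -
    have 1: "0 < v0 \<bullet> w t" "v0 \<bullet> w t \<le> \<delta>" "\<bar>det2 v0 (w t)\<bar> \<le> \<eta> * (v0 \<bullet> w t)"
      using good_pos[OF g] g by (auto simp: good_def a_def b_def)
    show nw: "norm (w t) \<le> 2 * a t" using sector(3)[OF 1] by (simp add: a_def)
    then show ns: "norm (x t - p) \<le> s0" using g \<delta> by (simp add: good_def w_def)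
    have "F (x t) = Y (p + w t)" using FY[OF ns] by (simp add: w_def)
    then show "v0 \<bullet> F (x t) \<le> - k * a t ^ m" "\<bar>det2 (w t) (F (x t))\<bar> \<le> 2 * C' * a t ^ Suc (Suc m)"
      using sector(1,2)[OF 1] by (simp_all add: a_def)
  qed
  have d\<sigma>: "(\<sigma> has_real_derivative det2 (w t) (F (x t)) / (a t * a t)) (at t)" if "a t \<noteq> 0" for t
  proof -
    have "(\<sigma> has_real_derivative (det2 v0 (F (x t)) * a t - b t * (v0 \<bullet> F (x t))) / (a t * a t)) (at t)"
      unfolding \<sigma>_def by (rule DERIV_divide[OF db da that])
    moreover have "det2 v0 (F (x t)) * a t - b t * (v0 \<bullet> F (x t)) =
        (v0 $ 1 * v0 $ 1 + v0 $ 2 * v0 $ 2) * det2 (w t) (F (x t))"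
      by (simp add: a_def b_def det2_def inner_vec2 algebra_simps)
    ultimately show ?thesis by (simp add: v01)
  qed
  \<comment> \<open>Both signs \<open>s'\<close> together say that \<open>\<sigma>\<close> varies by at most \<open>c\<close> times the decrease of \<open>a\<close>.\<close>
  have mono: "a t \<le> a s" "s' * \<sigma> t + c * a t \<le> s' * \<sigma> s + c * a s"
    if st: "s \<le> t" "\<And>r. s \<le> r \<Longrightarrow> r < t \<Longrightarrow> good r" "\<And>r. s \<le> r \<Longrightarrow> r \<le> t \<Longrightarrow> a r > 0" and s': "\<bar>s'\<bar> = 1" for s t s'
  proof -
    have rate: "v0 \<bullet> F (x r) \<le> - k * a r ^ m \<and> 0 \<le> k * a r ^ m" if "s < r" "r < t" for r
      using good_est(1)[OF st(2)] that k st(3)[of r] by auto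
    have "- a s \<le> - a t"
    proof (rule DERIV_nonneg_imp_increasing_open[where f = "\<lambda>t. - a t"])
      fix r assume r: "s < r" "r < t"
      show "\<exists>D. DERIV (\<lambda>t. - a t) r :> D \<and> 0 \<le> D"
        using DERIV_minus[OF da[of r]] rate[OF r] by (intro exI[of _ "- (v0 \<bullet> F (x r))"]) auto
    qed (use st ca in \<open>auto intro!: continuous_intros\<close>)
    then show "a t \<le> a s" by simp
    have "- (s' * \<sigma> s + c * a s) \<le> - (s' * \<sigma> t + c * a t)"
    proof (rule DERIV_nonneg_imp_increasing_open[where f = "\<lambda>t. - (s' * \<sigma> t + c * a t)"])
      show "continuous_on {s..t} (\<lambda>t. - (s' * \<sigma> t + c * a t))"
        unfolding \<sigma>_def using st(3) by (intro continuous_intros ca cb) force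
      fix r assume r: "s < r" "r < t"
      have g: "good r" and ar: "a r > 0" using st r by auto
      define G where "G = det2 (w r) (F (x r)) / (a r * a r)"
      have "\<bar>G\<bar> = \<bar>det2 (w r) (F (x r))\<bar> / (a r * a r)" using ar by (simp add: G_def abs_mult)
      also have "\<dots> \<le> 2 * C' * a r ^ Suc (Suc m) / (a r * a r)"
        using good_est(2)[OF g] ar by (intro divide_right_mono) auto
      also have "\<dots> = 2 * C' * a r ^ m" using ar by simp
      also have "\<dots> = c * (k * a r ^ m)" using k by (simp add: c_def)
      also have "\<dots> \<le> c * (- (v0 \<bullet> F (x r)))" using rate[OF r] c by (intro mult_left_mono) auto
      finally have "\<bar>s' * G\<bar> \<le> c * (- (v0 \<bullet> F (x r)))" using s' by (simp add: abs_mult)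
      then have "- (s' * G + c * (v0 \<bullet> F (x r))) \<ge> 0" by (simp add: abs_le_iff)
      moreover have "DERIV (\<lambda>t. - (s' * \<sigma> t + c * a t)) r :> - (s' * G + c * (v0 \<bullet> F (x r)))"
        unfolding G_def by (intro DERIV_minus DERIV_add DERIV_cmult d\<sigma> da) (use ar in simp)
      ultimately show "\<exists>D. DERIV (\<lambda>t. - (s' * \<sigma> t + c * a t)) r :> D \<and> 0 \<le> D" by blast
    qed (rule st(1))
    then show "s' * \<sigma> t + c * a t \<le> s' * \<sigma> s + c * a s" by simp
  qed
  \<comment> \<open>The equilibrium \<open>p\<close> is not reached in finite time, by uniqueness of solutions.\<close>
  have xp: "x t \<noteq> p" if t: "t \<ge> 0" for t
  proof
    assume xt: "x t = p"
    have L: "locally_lipschitz F"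
      unfolding F_def by (rule locally_lipschitz_clamp[OF lip est(1)])
    have "solves F (\<lambda>_. p) {0..t}" unfolding solves_def using Yp FY[of p] est(1) by simp
    from solves_unique[OF L solves_subset[OF xF] this, of t 0]
    have "x 0 = p" using t xt by simp
    then show False using a0 \<delta> by (simp add: a_def w_def)
  qed
  \<comment> \<open>At the first time at which \<open>good\<close> fails, the monotone quantities still bound the slope strictly below \<open>\<eta>\<close>.\<close>
  have allgood: "good t" if t: "t \<ge> 0" for t
  proof (rule ccontr)
    assume bad: "\<not> good t"
    define E where "E = {0..t} \<inter> {s. \<eta> * a s \<le> \<bar>b s\<bar> \<or> \<delta> \<le> a s}"
    have badE: "s \<in> E \<longleftrightarrow> 0 \<le> s \<and> s \<le> t \<and> \<not> good s" for s by (auto simp: E_def good_def)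
    have "closed E" unfolding E_def
      by (intro closed_Int closed_Collect_disj closed_Collect_le continuous_intros ca cb closed_atLeastAtMost)
    moreover have "t \<in> E" using bad t by (simp add: badE)
    moreover have bdd: "bdd_below E" by (auto simp: E_def intro!: bdd_belowI[of _ 0])
    ultimately have tE: "Inf E \<in> E" by (intro closed_contains_Inf) auto
    define T where "T = Inf E"
    have T: "0 \<le> T" "\<not> good T" using tE by (auto simp: badE T_def)
    have before: "good s" if s: "0 \<le> s" "s < T" for s
    proof (rule ccontr)
      assume "\<not> good s"
      then have "s \<in> E" using s tE by (auto simp: badE T_def)
      then show False using cInf_lower[OF _ bdd, of s] s by (simp add: T_def)
    qed
    have "good 0" using a0 \<delta> \<eta> by (simp add: good_def)
    then have T0: "T > 0" using T by (cases "T = 0") auto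
    have lim: "P T" if "\<And>s. 0 \<le> s \<Longrightarrow> s < T \<Longrightarrow> P s" "closed {s. P s}" for P
    proof -
      have "T \<in> closure {0..<T}" using T0 by simp
      also have "\<dots> \<subseteq> {s. P s}" using that by (intro closure_minimal) auto
      finally show ?thesis by simp
    qed
    have aT0: "a T \<ge> 0"
      by (rule lim) (use before good_pos in \<open>auto intro!: closed_Collect_le continuous_intros ca simp: less_imp_le\<close>)
    have bT: "\<bar>b T\<bar> \<le> \<eta> * a T"
    proof (rule lim)
      show "\<bar>b s\<bar> \<le> \<eta> * a s" if "0 \<le> s" "s < T" for s using before[OF that] by (simp add: good_def)
    qed (intro closed_Collect_le continuous_intros ca cb)
    have aT: "a T > 0"
    proof (rule ccontr)
      assume "\<not> a T > 0"
      then have "a T = 0" "b T = 0" using aT0 bT by auto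
      then have "x T = p" using weq[of T] by (simp add: w_def)
      then show False using xp T by blast
    qed
    have pos: "a r > 0" if "0 \<le> r" "r \<le> T" for r
      using good_pos[OF before] aT that by (cases "r = T") auto
    have m1: "a T \<le> a 0" "1 * \<sigma> T + c * a T \<le> 1 * \<sigma> 0 + c * a 0"
      by (rule mono[of 0 T 1]; use T before pos in simp)+
    have m2: "-1 * \<sigma> T + c * a T \<le> -1 * \<sigma> 0 + c * a 0"
      by (rule mono(2)[of 0 T "-1"]; use T before pos in simp)
    have "\<bar>\<sigma> T\<bar> \<le> c * (\<delta> / 2)"
      using m1 m2 a0 mult_pos_pos[OF c aT] by (simp add: \<sigma>_def abs_le_iff)
    also have "\<dots> < \<eta>" using \<delta>(4) mult_pos_pos[OF c \<delta>(1)] by linarith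
    finally have "\<bar>b T\<bar> < \<eta> * a T" using aT by (simp add: \<sigma>_def field_simps)
    moreover have "a T < \<delta>" using m1 a0 \<delta> by simp
    ultimately show False using T by (simp add: good_def)
  qed
  have pos: "a t > 0" if "t \<ge> 0" for t using good_pos allgood that by blast
  have xY: "solves Y x {0..}"
    unfolding solves_def
  proof
    fix t :: real assume t: "t \<in> {0..}"
    have "(x has_vector_derivative F (x t)) (at t within {0..})"
      using solves_subset[OF xF, of "{0..}"] t by (simp add: solves_def)
    then show "(x has_vector_derivative Y (x t)) (at t within {0..})"
      using FY[OF good_est(4)[OF allgood]] t by simp
  qed
  have Ynz: "Y (x t) \<noteq> 0" if t: "t \<ge> 0" for t
  proof -
    have "v0 \<bullet> F (x t) < 0"
      using good_est(1)[OF allgood[OF t]] mult_pos_pos[OF k zero_less_power[OF pos[OF t], of m]] by linarith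
    then show ?thesis using FY[OF good_est(4)[OF allgood[OF t]]] by auto
  qed
  have alim: "(a \<longlongrightarrow> 0) at_top"
    by (rule decreasing_to_zero(1)[of a "\<lambda>t. v0 \<bullet> F (x t)" k m])
       (use da pos good_est(1) allgood k in \<open>auto intro: has_field_derivative_at_within\<close>)
  have "\<exists>l. ((\<lambda>t. 1 * \<sigma> t + c * a t) \<longlongrightarrow> l) at_top"
  proof (rule nonincreasing_converges[where T = 0 and B = "- \<eta>"])
    show "1 * \<sigma> t + c * a t \<le> 1 * \<sigma> s + c * a s" if "0 \<le> s" "s \<le> t" for s t
      by (rule mono(2)) (use that allgood pos in auto)
    show "- \<eta> \<le> 1 * \<sigma> t + c * a t" if "0 \<le> t" for t
    proof -
      have "\<bar>\<sigma> t\<bar> < \<eta>" using allgood[OF that] pos[OF that] by (simp add: good_def \<sigma>_def field_simps)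
      then show ?thesis using mult_pos_pos[OF c pos[OF that]] by linarith
    qed
  qed
  then obtain l where "((\<lambda>t. \<sigma> t + c * a t) \<longlongrightarrow> l) at_top" by auto
  from tendsto_diff[OF this tendsto_mult_left[OF alim, of c]]
  have \<sigma>lim: "(\<sigma> \<longlongrightarrow> l) at_top" by simp
  have weq': "w t = a t *\<^sub>R (v0 + \<sigma> t *\<^sub>R e)" if "t \<ge> 0" for t
    using weq[of t] pos[OF that] by (simp add: \<sigma>_def scaleR_add_right)
  have "((\<lambda>t. a t *\<^sub>R (v0 + \<sigma> t *\<^sub>R e)) \<longlongrightarrow> 0 *\<^sub>R (v0 + l *\<^sub>R e)) at_top"
    by (intro tendsto_intros alim \<sigma>lim)
  moreover have "\<forall>\<^sub>F t in at_top. a t *\<^sub>R (v0 + \<sigma> t *\<^sub>R e) = w t"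
    using eventually_ge_at_top[of 0] by eventually_elim (simp add: weq')
  ultimately have "(w \<longlongrightarrow> 0) at_top" using tendsto_cong by force
  then have xlim: "(x \<longlongrightarrow> p) at_top" unfolding w_def by (simp add: LIM_zero_iff)
  have v0e: "v0 \<bullet> e = 0" by (simp add: e_def inner_vec2)
  have nz: "v0 + l *\<^sub>R e \<noteq> 0"
  proof
    assume "v0 + l *\<^sub>R e = 0"
    then have "v0 \<bullet> (v0 + l *\<^sub>R e) = 0" by simp
    then show False using v0 v0e by (simp add: inner_add_right dot_square_norm)
  qed
  have "((\<lambda>t. (v0 + \<sigma> t *\<^sub>R e) /\<^sub>R norm (v0 + \<sigma> t *\<^sub>R e)) \<longlongrightarrow> (v0 + l *\<^sub>R e) /\<^sub>R norm (v0 + l *\<^sub>R e)) at_top"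
    using nz by (intro tendsto_intros \<sigma>lim) auto
  moreover have "\<forall>\<^sub>F t in at_top. (v0 + \<sigma> t *\<^sub>R e) /\<^sub>R norm (v0 + \<sigma> t *\<^sub>R e) = (x t - p) /\<^sub>R norm (x t - p)"
    using eventually_ge_at_top[of 0]
  proof eventually_elim
    case (elim t)
    have "w t /\<^sub>R norm (w t) = (v0 + \<sigma> t *\<^sub>R e) /\<^sub>R norm (v0 + \<sigma> t *\<^sub>R e)"
      using pos[OF elim] by (simp add: weq'[OF elim])
    then show ?case by (simp add: w_def)
  qed
  ultimately have dir: "((\<lambda>t. (x t - p) /\<^sub>R norm (x t - p)) \<longlongrightarrow> (v0 + l *\<^sub>R e) /\<^sub>R norm (v0 + l *\<^sub>R e)) at_top"
    by (rule Lim_transform_eventually)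
  have half: "n \<bullet> (x t - p) \<ge> \<nu> * norm (x t - p)" if t: "t \<ge> 0" for t
  proof -
    have s: "\<bar>\<sigma> t\<bar> \<le> \<eta>" using allgood[OF t] pos[OF t] by (simp add: good_def \<sigma>_def field_simps)
    have "\<nu> * norm (w t) \<le> \<nu> * (2 * a t)" using good_est(3)[OF allgood[OF t]] \<nu> by (intro mult_left_mono) auto
    also have "\<dots> = a t * (2 * \<nu>)" by simp
    also have "\<dots> \<le> a t * (n \<bullet> (v0 + \<sigma> t *\<^sub>R e))" using \<eta>(4)[OF s] pos[OF t] by (intro mult_left_mono) auto
    also have "\<dots> = n \<bullet> w t" using weq'[OF t] by simp
    finally show ?thesis by (simp add: w_def)
  qed
  show thesis by (rule that[OF xY Ynz xlim dir \<nu> half xp])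
qed

section \<open>Trajectories of analytic fields in the plane\<close>

lemma locally_majorised_continuous:
  assumes "locally_majorised g"
  shows "continuous_on A g"
  using locally_majorised_differentiable[OF assms] differentiable_imp_continuous_within
  by (meson continuous_at_imp_continuous_on)

lemma locally_majorised_lipschitz:
  assumes g: "locally_majorised g"
  shows "\<exists>L. L-lipschitz_on (cball 0 R) g"
proof -
  have "bounded (partial i g ` cball 0 R)" for i
    by (intro compact_imp_bounded compact_continuous_image locally_majorised_continuous
        locally_majorised_partial g) simp
  then have "\<exists>B. \<forall>x\<in>cball 0 R. \<bar>partial i g x\<bar> \<le> B" for i
    unfolding bounded_iff by simp
  then obtain B where B: "\<And>i x. x \<in> cball 0 R \<Longrightarrow> \<bar>partial i g x\<bar> \<le> B i" by metis
  define L where "L = \<bar>B 1\<bar> + \<bar>B 2\<bar>"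
  have "L-lipschitz_on (cball 0 R) g"
  proof (rule lipschitz_onI)
    show "L \<ge> 0" by (simp add: L_def)
    fix x y :: "real^2" assume xy: "x \<in> cball 0 R" "y \<in> cball 0 R"
    have "norm (g x - g y) \<le> L * norm (x - y)"
    proof (rule differentiable_bound[where f' = "\<lambda>z h. partial 1 g z * h $ 1 + partial 2 g z * h $ 2",
          OF convex_cball _ _ xy])
      show "(g has_derivative (\<lambda>h. partial 1 g z * h $ 1 + partial 2 g z * h $ 2)) (at z within cball 0 R)" for z
        using has_derivative_partial[OF locally_majorised_differentiable[OF g]]
        by (rule has_derivative_at_withinI)
      show "onorm (\<lambda>h::real^2. partial 1 g z * h $ 1 + partial 2 g z * h $ 2) \<le> L" if "z \<in> cball 0 R" for z
      proof (rule onorm_le)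
        fix h :: "real^2"
        have "\<bar>partial 1 g z * h $ 1 + partial 2 g z * h $ 2\<bar> \<le> \<bar>partial 1 g z\<bar> * \<bar>h $ 1\<bar> + \<bar>partial 2 g z\<bar> * \<bar>h $ 2\<bar>"
          by (rule order_trans[OF abs_triangle_ineq]) (simp add: abs_mult)
        also have "\<dots> \<le> \<bar>B 1\<bar> * norm h + \<bar>B 2\<bar> * norm h"
          using B[OF that, of 1] B[OF that, of 2]
          by (intro add_mono mult_mono component_le_norm_cart) auto
        finally show "norm (partial 1 g z * h $ 1 + partial 2 g z * h $ 2) \<le> L * norm h"
          by (simp add: L_def algebra_simps)
      qed
    qed
    then show "dist (g x) (g y) \<le> L * dist x y" by (simp add: dist_norm)
  qed
  then show ?thesis by blast
qed

lemma locally_lipschitz_majorised: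
  fixes Y :: "real^2 \<Rightarrow> real^2"
  assumes Y: "\<And>i. locally_majorised (\<lambda>x. Y x $ i)"
  shows "locally_lipschitz Y"
  unfolding locally_lipschitz_def
proof
  fix R
  obtain L1 where L1: "L1-lipschitz_on (cball 0 R) (\<lambda>x. Y x $ 1)" using locally_majorised_lipschitz[OF Y] by blast
  obtain L2 where L2: "L2-lipschitz_on (cball 0 R) (\<lambda>x. Y x $ 2)" using locally_majorised_lipschitz[OF Y] by blast
  have "(L1 + L2)-lipschitz_on (cball 0 R) Y"
  proof (rule lipschitz_onI)
    show "L1 + L2 \<ge> 0" using lipschitz_on_nonneg[OF L1] lipschitz_on_nonneg[OF L2] by simp
    fix x y :: "real^2" assume xy: "x \<in> cball 0 R" "y \<in> cball 0 R"
    have "dist (Y x) (Y y) \<le> \<bar>(Y x - Y y) $ 1\<bar> + \<bar>(Y x - Y y) $ 2\<bar>"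
      using norm_le_l1_cart[of "Y x - Y y"] by (simp add: sum_2 dist_norm)
    also have "\<dots> \<le> L1 * dist x y + L2 * dist x y"
      using lipschitz_onD[OF L1 xy] lipschitz_onD[OF L2 xy] by (simp add: dist_real_def)
    finally show "dist (Y x) (Y y) \<le> (L1 + L2) * dist x y" by (simp add: algebra_simps)
  qed
  then show "\<exists>L. L-lipschitz_on (cball 0 R) Y" by blast
qed

text \<open>The complex coordinate \<open>\<phi>\<close> is centred at \<open>p\<close> and turned such that the field at \<open>p\<close> points along the positive real axis.\<close>

lemma no_forward_return_plane:
  fixes Y :: "real^2 \<Rightarrow> real^2"
  assumes lip: "locally_lipschitz Y" and Yp: "Y p \<noteq> 0"
    and x0: "h0 > 0" "solves Y x0 {-h0..h0}" "x0 0 = p" "\<And>t. t \<in> {-h0..h0} \<Longrightarrow> x0 t \<notin> K"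
  shows "p \<notin> closure ({q. \<exists>\<gamma> b. b \<ge> 0 \<and> solves Y \<gamma> {0..b} \<and> \<gamma> 0 = p \<and> \<gamma> b = q} \<inter> K)"
    (is "p \<notin> closure (?S \<inter> K)")
proof
  assume clos: "p \<in> closure (?S \<inter> K)"
  define v where "v = Y p"
  define L where "L u = Complex (v \<bullet> u) (det2 v u)" for u
  define J where "J = (vector [- v $ 2, v $ 1] :: real^2)"
  define \<phi> where "\<phi> x = L x + (- L p)" for x
  define \<psi> where "\<psi> w = p + (Re w / (v \<bullet> v)) *\<^sub>R v + (Im w / (v \<bullet> v)) *\<^sub>R J" for w
  define W where "W w = L (Y (\<psi> w))" for w
  have vv: "v \<bullet> v > 0" using Yp by (simp add: v_def)
  have nJ: "norm J = norm v" by (simp add: norm_eq_sqrt_inner J_def inner_vec2 add.commute)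
  have linL: "linear L"
    by (rule linearI) (simp_all add: L_def complex_eq_iff inner_add_right det2_add)
  have blL: "bounded_linear L" using linL by (simp add: linear_conv_bounded_linear)
  have nL: "norm (L u) = norm v * norm u" for u
  proof -
    have "(norm (L u))\<^sup>2 = (norm v * norm u)\<^sup>2"
      using lagrange_identity[of v u] by (simp add: L_def cmod_power2 power_mult_distrib)
    then show ?thesis by simp
  qed
  have \<psi>\<phi>: "\<psi> (\<phi> x) = x" for x
  proof -
    have "(v \<bullet> v) *\<^sub>R u = (v \<bullet> u) *\<^sub>R v + det2 v u *\<^sub>R J" for u
      by (simp add: vec_eq_iff forall_2 J_def inner_vec2 det2_def algebra_simps)
    then have "(v \<bullet> v) *\<^sub>R (x - p) = (v \<bullet> (x - p)) *\<^sub>R v + det2 v (x - p) *\<^sub>R J" .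
    then have "inverse (v \<bullet> v) *\<^sub>R ((v \<bullet> v) *\<^sub>R (x - p)) = inverse (v \<bullet> v) *\<^sub>R ((v \<bullet> (x - p)) *\<^sub>R v + det2 v (x - p) *\<^sub>R J)"
      by simp
    moreover have "\<phi> x = L (x - p)" using linear_diff[OF linL] by (simp add: \<phi>_def)
    ultimately show ?thesis using vv
      by (simp add: \<psi>_def L_def scaleR_add_right divide_inverse mult.commute) (metis add.assoc diff_add_cancel add.commute)
  qed
  have W0: "Re (W 0) > 0"
    using vv by (simp add: W_def \<psi>_def L_def v_def[symmetric])
  have lipW: "locally_lipschitz W"
    unfolding locally_lipschitz_def
  proof
    fix R
    have \<psi>L: "norm (\<psi> w - \<psi> w') \<le> 2 / norm v * norm (w - w')" for w w'
    proof -
      have "\<psi> w - \<psi> w' = (Re (w - w') / (v \<bullet> v)) *\<^sub>R v + (Im (w - w') / (v \<bullet> v)) *\<^sub>R J"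
        by (simp add: \<psi>_def algebra_simps diff_divide_distrib)
      also have "norm \<dots> \<le> \<bar>Re (w - w')\<bar> / (v \<bullet> v) * norm v + \<bar>Im (w - w')\<bar> / (v \<bullet> v) * norm v"
        using norm_triangle_ineq[of "(Re (w - w') / (v \<bullet> v)) *\<^sub>R v" "(Im (w - w') / (v \<bullet> v)) *\<^sub>R J"] nJ vv
        by (simp add: abs_of_pos)
      also have "\<dots> \<le> norm (w - w') / (v \<bullet> v) * norm v + norm (w - w') / (v \<bullet> v) * norm v"
        using vv by (intro add_mono mult_right_mono divide_right_mono abs_Re_le_cmod abs_Im_le_cmod) auto
      also have "\<dots> = 2 / norm v * norm (w - w')"
        using vv by (simp add: dot_square_norm power2_eq_square)
      finally show ?thesis .
    qed
    define R' where "R' = norm p + 2 / norm v * R"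
    obtain l where l: "l-lipschitz_on (cball 0 R') Y" using lip unfolding locally_lipschitz_def by blast
    have "(norm v * (l * (2 / norm v)))-lipschitz_on (cball 0 R) W"
    proof (rule lipschitz_onI)
      show "norm v * (l * (2 / norm v)) \<ge> 0" using lipschitz_on_nonneg[OF l] by simp
      fix w w' :: complex assume w: "w \<in> cball 0 R" "w' \<in> cball 0 R"
      have in_R': "\<psi> u \<in> cball 0 R'" if "u \<in> cball 0 R" for u
      proof -
        have "\<psi> 0 = p" by (simp add: \<psi>_def)
        then have "norm (\<psi> u - p) \<le> 2 / norm v * norm u" using \<psi>L[of u 0] by simp
        also have "\<dots> \<le> 2 / norm v * R" using that by (intro mult_left_mono) auto
        finally show ?thesis using norm_triangle_sub[of "\<psi> u" p] by (simp add: R'_def)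
      qed
      have "dist (W w) (W w') = norm v * norm (Y (\<psi> w) - Y (\<psi> w'))"
        using nL[of "Y (\<psi> w) - Y (\<psi> w')"] linear_diff[OF linL] by (simp add: W_def dist_norm)
      also have "\<dots> \<le> norm v * (l * norm (\<psi> w - \<psi> w'))"
        using lipschitz_onD[OF l in_R'[OF w(1)] in_R'[OF w(2)]] by (intro mult_left_mono) (auto simp: dist_norm)
      also have "\<dots> \<le> norm v * (l * (2 / norm v * norm (w - w')))"
        using \<psi>L lipschitz_on_nonneg[OF l] by (intro mult_left_mono) auto
      finally show "dist (W w) (W w') \<le> norm v * (l * (2 / norm v)) * dist w w'"
        by (simp only: dist_norm mult.assoc)
    qed
    then show "\<exists>L. L-lipschitz_on (cball 0 R) W" by blast
  qed
  have sol: "solves W (\<lambda>t. \<phi> (x t)) A" if "solves Y x A" for x A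
    unfolding \<phi>_def by (rule solves_affine_image[OF that blL]) (simp only: W_def \<psi>\<phi>[unfolded \<phi>_def])
  have \<phi>p: "\<phi> p = 0" by (simp add: \<phi>_def)
  have cont\<phi>: "continuous_on UNIV \<phi>"
    unfolding \<phi>_def by (intro continuous_intros linear_continuous_on blL)
  have inj: "\<phi> x = \<phi> y \<Longrightarrow> x = y" for x y using \<psi>\<phi> by metis
  have notin: "0 \<notin> closure ({q. \<exists>\<gamma> b. b \<ge> 0 \<and> solves W \<gamma> {0..b} \<and> \<gamma> 0 = 0 \<and> \<gamma> b = q} \<inter> \<phi> ` K)"
    (is "0 \<notin> closure ?T")
  proof (rule no_forward_return[OF lipW W0 x0(1) sol[OF x0(2)]])
    show "\<phi> (x0 0) = 0" using x0(3) \<phi>p by simp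
    show "\<phi> (x0 t) \<notin> \<phi> ` K" if "t \<in> {-h0..h0}" for t using x0(4)[OF that] inj by blast
  qed
  have sub: "\<phi> ` (?S \<inter> K) \<subseteq> ?T"
  proof
    fix y assume "y \<in> \<phi> ` (?S \<inter> K)"
    then obtain \<gamma> b where g: "b \<ge> 0" "solves Y \<gamma> {0..b}" "\<gamma> 0 = p" "\<gamma> b \<in> K" "y = \<phi> (\<gamma> b)" by blast
    have "b \<ge> 0 \<and> solves W (\<lambda>t. \<phi> (\<gamma> t)) {0..b} \<and> \<phi> (\<gamma> 0) = 0 \<and> \<phi> (\<gamma> b) = y"
      using g sol[OF g(2)] \<phi>p by simp
    moreover have "y \<in> \<phi> ` K" using g by blast
    ultimately show "y \<in> ?T" by (intro IntI CollectI exI[of _ "\<lambda>t. \<phi> (\<gamma> t)"] exI[of _ b])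
  qed
  have "\<phi> ` closure (?S \<inter> K) \<subseteq> closure (\<phi> ` (?S \<inter> K))"
    by (rule image_closure_subset[OF continuous_on_subset[OF cont\<phi> subset_UNIV] closed_closure closure_subset])
  then have "\<phi> p \<in> closure (\<phi> ` (?S \<inter> K))" using clos by (rule subsetD[OF _ imageI])
  then have "\<phi> p \<in> closure ?T" by (rule subsetD[OF closure_mono[OF sub]])
  then show False unfolding \<phi>p by (rule notE[OF notin])
qed

lemma regular_trajectory_reverse:
  assumes "regular_trajectory (\<lambda>x. - Y x) \<gamma> I"
  shows "regular_trajectory Y (\<lambda>t. \<gamma> (- t)) (uminus ` I)"
proof -
  have I: "open I" "is_interval I"
    and der: "\<And>t. t \<in> I \<Longrightarrow> (\<gamma> has_vector_derivative - Y (\<gamma> t)) (at t)" "\<And>t. t \<in> I \<Longrightarrow> Y (\<gamma> t) \<noteq> 0"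
    using assms by (auto simp: regular_trajectory_def)
  show ?thesis
    unfolding regular_trajectory_def
  proof (intro conjI ballI)
    show "open (uminus ` I)" using I(1) by (rule open_negations)
    show "is_interval (uminus ` I)" using I(2) by simp
    fix t assume "t \<in> uminus ` I"
    then have t: "- t \<in> I" by auto
    have "(uminus has_vector_derivative (-1)) (at t)"
      unfolding has_real_derivative_iff_has_vector_derivative[symmetric] by (auto intro!: derivative_eq_intros)
    from vector_diff_chain_at[OF this der(1)[OF t]]
    show "((\<lambda>t. \<gamma> (- t)) has_vector_derivative Y (\<gamma> (- t))) (at t)" by (simp add: o_def)
    show "Y (\<gamma> (- t)) \<noteq> 0" by (rule der(2)[OF t])
  qed
qed

text \<open>Reversal of time exchanges the two ends of a trajectory. This and the neighbouring lemmas let the arguments below speak about \<open>at_top\<close> only.\<close>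

lemma tends_to_point_reverse:
  "tends_to_point (\<lambda>t. \<gamma> (- t)) (uminus ` I) p at_bot \<longleftrightarrow> tends_to_point \<gamma> I p at_top"
  "tends_to_point (\<lambda>t. \<gamma> (- t)) (uminus ` I) p at_top \<longleftrightarrow> tends_to_point \<gamma> I p at_bot"
proof -
  have mem: "- t \<in> uminus ` I \<longleftrightarrow> t \<in> I" for t by auto
  show "tends_to_point (\<lambda>t. \<gamma> (- t)) (uminus ` I) p at_bot \<longleftrightarrow> tends_to_point \<gamma> I p at_top"
    unfolding tends_to_point_def at_bot_mirror eventually_filtermap filterlim_filtermap mem minus_minus ..
  show "tends_to_point (\<lambda>t. \<gamma> (- t)) (uminus ` I) p at_top \<longleftrightarrow> tends_to_point \<gamma> I p at_bot"
    unfolding tends_to_point_def at_top_mirror eventually_filtermap filterlim_filtermap mem minus_minus ..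
qed

lemma characteristic_orbit_reverse:
  assumes "characteristic_orbit (\<lambda>x. - Y x) p \<gamma> I"
  shows "characteristic_orbit Y p (\<lambda>t. \<gamma> (- t)) (uminus ` I)"
proof -
  obtain u F where F: "F \<in> {at_top, at_bot}" "tends_to_point \<gamma> I p F"
      "((\<lambda>t. (\<gamma> t - p) /\<^sub>R norm (\<gamma> t - p)) \<longlongrightarrow> u) F"
    using assms unfolding characteristic_orbit_def by blast
  have "\<exists>F\<in>{at_top, at_bot}. tends_to_point (\<lambda>t. \<gamma> (- t)) (uminus ` I) p F \<and>
      ((\<lambda>t. (\<gamma> (- t) - p) /\<^sub>R norm (\<gamma> (- t) - p)) \<longlongrightarrow> u) F"
  proof (cases "F = at_top")
    case True
    have "((\<lambda>t. (\<gamma> (- t) - p) /\<^sub>R norm (\<gamma> (- t) - p)) \<longlongrightarrow> u) at_bot"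
      using F(3) unfolding True at_bot_mirror filterlim_filtermap minus_minus .
    then show ?thesis using F(2) True tends_to_point_reverse(1) by blast
  next
    case False
    then have Fb: "F = at_bot" using F(1) by simp
    have "((\<lambda>t. (\<gamma> (- t) - p) /\<^sub>R norm (\<gamma> (- t) - p)) \<longlongrightarrow> u) at_top"
      using F(3) unfolding Fb at_top_mirror filterlim_filtermap minus_minus .
    then show ?thesis using F(2) Fb tends_to_point_reverse(2) by blast
  qed
  moreover have "regular_trajectory Y (\<lambda>t. \<gamma> (- t)) (uminus ` I)"
    using assms regular_trajectory_reverse unfolding characteristic_orbit_def by blast
  ultimately show ?thesis unfolding characteristic_orbit_def by blast
qed

lemma has_characteristic_orbit_in_reverse:
  assumes "has_characteristic_orbit_in (\<lambda>x. - Y x) K p"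
  shows "has_characteristic_orbit_in Y K p"
proof -
  obtain \<gamma> I V where "characteristic_orbit (\<lambda>x. - Y x) p \<gamma> I" "open V" "p \<in> V" "\<gamma> ` I \<inter> V \<subseteq> V \<inter> K"
    using assms unfolding has_characteristic_orbit_in_def by blast
  moreover from this(1) have "characteristic_orbit Y p (\<lambda>t. \<gamma> (- t)) (uminus ` I)"
    by (rule characteristic_orbit_reverse)
  moreover have "(\<lambda>t. \<gamma> (- t)) ` uminus ` I = \<gamma> ` I" by (simp add: image_image)
  ultimately have "characteristic_orbit Y p (\<lambda>t. \<gamma> (- t)) (uminus ` I) \<and> open V \<and> p \<in> V \<and>
      (\<lambda>t. \<gamma> (- t)) ` uminus ` I \<inter> V \<subseteq> V \<inter> K" by simp
  then show ?thesis unfolding has_characteristic_orbit_in_def by (intro exI)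
qed

lemma analytic_plane_minus:
  fixes g :: "real^2 \<Rightarrow> 'b::real_normed_vector"
  assumes "analytic_plane g"
  shows "analytic_plane (\<lambda>x. - g x)"
  unfolding analytic_plane_def
proof
  fix p
  obtain r c where r: "r > 0" and c: "\<And>x. x \<in> ball p r \<Longrightarrow>
      ((\<lambda>(i, j). ((x $ 1 - p $ 1) ^ i * (x $ 2 - p $ 2) ^ j) *\<^sub>R c i j) has_sum g x) UNIV"
    using assms unfolding analytic_plane_def by meson
  have "((\<lambda>(k, j). ((x $ 1 - p $ 1) ^ k * (x $ 2 - p $ 2) ^ j) *\<^sub>R (- c k j)) has_sum - g x) UNIV"
    if "x \<in> ball p r" for x
    using c[OF that] by (simp add: case_prod_unfold has_sum_uminus)
  then show "\<exists>r>0. \<exists>c. \<forall>x\<in>ball p r.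
     ((\<lambda>(i, j). ((x $ 1 - p $ 1) ^ i * (x $ 2 - p $ 2) ^ j) *\<^sub>R c i j) has_sum - g x) UNIV"
    using r by (intro exI[of _ r] conjI exI[of _ "\<lambda>k j. - c k j"]) auto
qed

text \<open>Close to \<open>p\<close> the component of the velocity in the direction \<open>Y p\<close> is bounded below by \<open>c > 0\<close>, so that component of the position is unbounded.\<close>

lemma no_tending_trajectory_top:
  fixes Y :: "real^2 \<Rightarrow> real^2"
  assumes cont: "continuous_on UNIV Y" and Yp: "Y p \<noteq> 0"
    and reg: "regular_trajectory Y \<gamma> I" and tends: "tends_to_point \<gamma> I p at_top"
  shows False
proof -
  define c where "c = (Y p \<bullet> Y p) / 2"
  define D where "D t = Y p \<bullet> \<gamma> t" for t
  have c: "c > 0" using Yp by (simp add: c_def)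
  have lim: "(\<gamma> \<longlongrightarrow> p) at_top" using tends by (simp add: tends_to_point_def)
  have "((\<lambda>t. Y (\<gamma> t)) \<longlongrightarrow> Y p) at_top"
    by (rule continuous_on_tendsto_compose[OF cont lim]) auto
  then have "((\<lambda>t. Y p \<bullet> Y (\<gamma> t)) \<longlongrightarrow> Y p \<bullet> Y p) at_top" by (intro tendsto_intros)
  then have "\<forall>\<^sub>F t in at_top. Y p \<bullet> Y (\<gamma> t) > c"
    by (rule order_tendstoD) (use c in \<open>simp add: c_def\<close>)
  moreover have "(D \<longlongrightarrow> Y p \<bullet> p) at_top" unfolding D_def by (intro tendsto_intros lim)
  then have "\<forall>\<^sub>F t in at_top. D t < Y p \<bullet> p + 1" by (rule order_tendstoD) simp
  moreover have "\<forall>\<^sub>F t in at_top. t \<in> I" using tends by (simp add: tends_to_point_def)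
  ultimately have "\<forall>\<^sub>F t in at_top. Y p \<bullet> Y (\<gamma> t) > c \<and> D t < Y p \<bullet> p + 1 \<and> t \<in> I"
    by eventually_elim simp
  then obtain T where T: "\<And>t. t \<ge> T \<Longrightarrow> Y p \<bullet> Y (\<gamma> t) > c \<and> D t < Y p \<bullet> p + 1 \<and> t \<in> I"
    unfolding eventually_at_top_linorder by blast
  have dD: "(D has_real_derivative Y p \<bullet> Y (\<gamma> t)) (at t)" if "t \<ge> T" for t
  proof -
    have "(\<gamma> has_vector_derivative Y (\<gamma> t)) (at t)"
      using reg T[OF that] by (simp add: regular_trajectory_def)
    then show ?thesis
      using bounded_linear.has_vector_derivative[OF bounded_linear_inner_right]
      unfolding D_def has_real_derivative_iff_has_vector_derivative by blast
  qed
  define h where "h = (Y p \<bullet> p + 1 - D T) / c"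
  have h: "h > 0" using T[of T] c by (simp add: h_def)
  have "D T - c * T \<le> D (T + h) - c * (T + h)"
  proof (rule DERIV_nonneg_imp_increasing_open[where f = "\<lambda>t. D t - c * t"])
    fix t assume t: "T < t" "t < T + h"
    have "DERIV (\<lambda>t. D t - c * t) t :> Y p \<bullet> Y (\<gamma> t) - c * 1"
      by (intro DERIV_diff DERIV_cmult DERIV_ident dD) (use t in simp)
    moreover have "0 \<le> Y p \<bullet> Y (\<gamma> t) - c * 1" using T[of t] t by simp
    ultimately show "\<exists>y. DERIV (\<lambda>t. D t - c * t) t :> y \<and> 0 \<le> y" by blast
    next
    have "continuous_on {T..T + h} D"
      by (rule DERIV_continuous_on, rule has_field_derivative_at_within, rule dD) simp
    then show "continuous_on {T..T + h} (\<lambda>t. D t - c * t)" by (intro continuous_intros)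
  qed (use h in simp)
  then have "D (T + h) \<ge> D T + c * h" by (simp add: algebra_simps)
  also have "D T + c * h = Y p \<bullet> p + 1" using c by (simp add: h_def)
  finally show False using T[of "T + h"] h by simp
qed

lemma no_tending_trajectory:
  fixes Y :: "real^2 \<Rightarrow> real^2"
  assumes cont: "continuous_on UNIV Y" and Yp: "Y p \<noteq> 0"
  shows "\<not> trajectory_tending Y K p"
proof
  assume "trajectory_tending Y K p"
  then obtain \<gamma> I where reg: "regular_trajectory Y \<gamma> I"
    and "tends_to_point \<gamma> I p at_top \<or> tends_to_point \<gamma> I p at_bot"
    unfolding trajectory_tending_def by blast
  then show False
  proof (elim disjE)
    assume b: "tends_to_point \<gamma> I p at_bot"
    have "regular_trajectory (\<lambda>x. - Y x) (\<lambda>t. \<gamma> (- t)) (uminus ` I)"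
      using regular_trajectory_reverse[of "\<lambda>x. - Y x"] reg by simp
    then show False
      by (rule no_tending_trajectory_top[rotated 2])
         (use b tends_to_point_reverse(2) cont Yp in \<open>auto intro: continuous_intros\<close>)
  qed (rule no_tending_trajectory_top[OF cont Yp reg])
qed

lemma regular_trajectory_solves:
  "regular_trajectory Y \<gamma> I \<Longrightarrow> solves Y \<gamma> I"
  unfolding regular_trajectory_def solves_def by (blast intro: has_vector_derivative_at_within)

text \<open>The part of the trajectory after \<open>t0\<close> consists of points that can be reached from \<open>p\<close> along \<open>Y\<close>, the part before \<open>t0\<close> of
  points that can be reached along \<open>- Y\<close>. Neither part accumulates at \<open>p\<close> within \<open>K\<close>.\<close>

lemma not_through_if_arc_avoids:
  fixes Y :: "real^2 \<Rightarrow> real^2"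
  assumes lip: "locally_lipschitz Y" and Yp: "Y p \<noteq> 0"
    and reg: "regular_trajectory Y \<gamma> I" "t0 \<in> I" "\<gamma> t0 = p"
    and h: "h > 0" "{t0 - h..t0 + h} \<subseteq> I" "\<And>t. \<bar>t - t0\<bar> \<le> h \<Longrightarrow> \<gamma> t \<notin> K"
  shows "p \<notin> closure (\<gamma> ` I \<inter> K)"
proof -
  have sol: "solves Y \<gamma> I" by (rule regular_trajectory_solves[OF reg(1)])
  have I: "is_interval I" using reg(1) by (simp add: regular_trajectory_def)
  let ?S = "\<lambda>Y. {q. \<exists>\<gamma> b. b \<ge> 0 \<and> solves Y \<gamma> {0..b} \<and> \<gamma> 0 = p \<and> \<gamma> b = q}"
  have fwd: "solves Y (\<lambda>t. \<gamma> (t0 + t)) B" if "\<And>t. t \<in> B \<Longrightarrow> t0 + t \<in> I" for B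
    by (rule solves_shift[OF sol that])
  have bwd: "solves (\<lambda>x. (-1) *\<^sub>R Y x) (\<lambda>t. \<gamma> (t0 + (-1) * t)) B" if "\<And>t. t \<in> B \<Longrightarrow> t0 - t \<in> I" for B
    by (rule solves_subset[OF solves_affine_time[OF sol]]) (use that in auto)
  have inI: "s \<in> I" if "t \<in> I" "min t t0 \<le> s" "s \<le> max t t0" for s t
  proof (cases "t \<le> t0")
    case True
    then show ?thesis using that by (intro mem_is_interval_1_I[OF I that(1) reg(2)]) auto
  next
    case False
    then show ?thesis using that by (intro mem_is_interval_1_I[OF I reg(2) that(1)]) auto
  qed
  have F: "p \<notin> closure (?S Y \<inter> K)"
    by (rule no_forward_return_plane[OF lip Yp h(1) fwd]) (use h reg(3) in auto)
  have B: "p \<notin> closure (?S (\<lambda>x. (-1) *\<^sub>R Y x) \<inter> K)"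
    by (rule no_forward_return_plane[OF locally_lipschitz_scaleR[OF lip] _ h(1) bwd]) (use h reg(3) Yp in auto)
  have "\<gamma> ` I \<inter> K \<subseteq> (?S Y \<inter> K) \<union> (?S (\<lambda>x. (-1) *\<^sub>R Y x) \<inter> K)"
  proof
    fix q assume "q \<in> \<gamma> ` I \<inter> K"
    then obtain t where t: "t \<in> I" "q = \<gamma> t" "q \<in> K" by blast
    show "q \<in> (?S Y \<inter> K) \<union> (?S (\<lambda>x. (-1) *\<^sub>R Y x) \<inter> K)"
    proof (cases "t0 \<le> t")
      case True
      have "solves Y (\<lambda>s. \<gamma> (t0 + s)) {0..t - t0}"
        by (rule fwd, rule inI[OF t(1)]) (use True in auto)
      then have "q \<in> ?S Y"
        by (intro CollectI exI[of _ "\<lambda>s. \<gamma> (t0 + s)"] exI[of _ "t - t0"]) (use True t reg(3) in simp)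
      then show ?thesis using t by blast
    next
      case False
      have "solves (\<lambda>x. (-1) *\<^sub>R Y x) (\<lambda>s. \<gamma> (t0 + (-1) * s)) {0..t0 - t}"
        by (rule bwd, rule inI[OF t(1)]) (use False in auto)
      then have "q \<in> ?S (\<lambda>x. (-1) *\<^sub>R Y x)"
        by (intro CollectI exI[of _ "\<lambda>s. \<gamma> (t0 + (-1) * s)"] exI[of _ "t0 - t"]) (use False t reg(3) in simp)
      then show ?thesis using t by blast
    qed
  qed
  then have "closure (\<gamma> ` I \<inter> K) \<subseteq> closure (?S Y \<inter> K) \<union> closure (?S (\<lambda>x. (-1) *\<^sub>R Y x) \<inter> K)"
    unfolding closure_Un[symmetric] by (rule closure_mono)
  then show ?thesis using F B by blast
qed

lemma local_trajectory:
  fixes Y :: "real^2 \<Rightarrow> real^2"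
  assumes lip: "locally_lipschitz Y" and cont: "continuous_on UNIV Y" and Yp: "Y p \<noteq> 0"
  obtains x T where "T > 0" "x 0 = p" "regular_trajectory Y x {-T<..<T}"
proof -
  define B where "B = norm (Y p) + 1"
  have B: "B > 0" by (simp add: B_def add_nonneg_pos)
  have m: "min 1 (norm (Y p)) > 0" using Yp by simp
  have "isCont Y p" using cont by (simp add: continuous_on_eq_continuous_at)
  then have "\<exists>r>0. \<forall>x. dist x p < r \<longrightarrow> dist (Y x) (Y p) < min 1 (norm (Y p))"
    unfolding continuous_at_eps_delta using m by blast
  then obtain r where r: "r > 0" "\<And>x. dist x p < r \<Longrightarrow> dist (Y x) (Y p) < min 1 (norm (Y p))" by blast
  have near: "norm (Y x) \<le> B" "Y x \<noteq> 0" if "norm (x - p) < r" for x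
  proof -
    have d: "norm (Y x - Y p) < 1" "norm (Y x - Y p) < norm (Y p)" using r(2)[of x] that by (auto simp: dist_norm)
    show "norm (Y x) \<le> B" using d norm_triangle_sub[of "Y x" "Y p"] by (simp add: B_def)
    show "Y x \<noteq> 0" using d by auto
  qed
  define T where "T = (r / 2) / (2 * B)"
  have T: "T > 0" using r B by (simp add: T_def)
  obtain x where x: "x 0 = p" "solves Y x {-T..T}" "\<And>t. t \<in> {-T..T} \<Longrightarrow> norm (x t - p) < r / 2"
  proof (rule local_solution[where Y = Y and p = p and q = p and r = "r / 2" and B = B and T = T])
    show "norm (Y x) \<le> B" if "x \<in> cball p (r / 2)" for x
      using near(1)[of x] that r by (simp add: dist_norm norm_minus_commute)
  qed (use lip r B T that in \<open>auto simp: T_def\<close>)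
  have "regular_trajectory Y x {-T<..<T}"
    unfolding regular_trajectory_def
  proof (intro conjI ballI)
    fix t assume t: "t \<in> {-T<..<T}"
    show "(x has_vector_derivative Y (x t)) (at t)"
      by (rule solves_at[OF x(2), of "{-T<..<T}"]) (use t in auto)
    show "Y (x t) \<noteq> 0" by (rule near(2)) (use x(3)[of t] t r in auto)
  qed auto
  then show thesis using that T x(1) by blast
qed

section \<open>The one-sided criteria and the theorem\<close>

text \<open>The one-sided criterion at a regular point. A trajectory through \<open>p\<close> has finite contact with the curve \<open>f = 0\<close>: otherwise it would run inside the curve
  near \<open>p\<close>, where \<open>lie Y f\<close> would vanish at points other than \<open>p\<close>. Odd order or a positive leading value puts
  part of the local arc into \<open>f > 0\<close>. Even order with a negative value keeps it out, and then the rest of the trajectory does not accumulate at \<open>p\<close> inside \<open>f > 0\<close> either.\<close>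

lemma no_orbit_iff_fold:
  fixes Y :: "real^2 \<Rightarrow> real^2" and f :: "real^2 \<Rightarrow> real"
  assumes Y: "analytic_plane Y" and f: "analytic_plane f" and Yp: "Y p \<noteq> 0"
    and fp: "f p = 0" and lp: "lie Y f p = 0"
    and T: "open T" "p \<in> T" "\<And>q. q \<in> T \<Longrightarrow> f q = 0 \<Longrightarrow> q \<noteq> p \<Longrightarrow> lie Y f q \<noteq> 0"
  shows "\<not> trajectory_through Y (plus_side f) p \<and> \<not> trajectory_tending Y (plus_side f) p \<longleftrightarrow>
    (\<exists>n. fold_point f Y n p \<and> (lie Y ^^ n) f p < 0)"
proof -
  have Ym: "\<And>i. locally_majorised (\<lambda>x. Y x $ i)"
    by (rule analytic_plane_majorised[OF analytic_plane_component[OF Y]])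
  have fm: "locally_majorised f" by (rule analytic_plane_majorised[OF f])
  have lip: "locally_lipschitz Y" by (rule locally_lipschitz_majorised[OF Ym])
  have cont: "continuous_on UNIV Y"
    using continuous_on_vec_lambda[of UNIV "\<lambda>i x. Y x $ i"] locally_majorised_continuous[OF Ym] by simp
  show ?thesis
  proof
    assume "\<exists>n. fold_point f Y n p \<and> (lie Y ^^ n) f p < 0"
    then obtain n where n: "even n" "n \<ge> 2" "\<And>k. k \<in> {1..<n} \<Longrightarrow> (lie Y ^^ k) f p = 0" "(lie Y ^^ n) f p < 0"
      by (auto simp: fold_point_def)
    have zero: "(lie Y ^^ k) f p = 0" if "k < n" for k
      using n(3)[of k] that fp by (cases "k = 0") auto
    have "\<not> trajectory_through Y (plus_side f) p"
    proof
      assume "trajectory_through Y (plus_side f) p"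
      then obtain \<gamma> I t0 where g: "regular_trajectory Y \<gamma> I" "t0 \<in> I" "\<gamma> t0 = p"
          "p \<in> closure (\<gamma> ` I \<inter> plus_side f)"
        unfolding trajectory_through_def by blast
      have "open I" using g(1) by (simp add: regular_trajectory_def)
      then obtain d where d: "d > 0" "\<And>t. \<bar>t - t0\<bar> < d \<Longrightarrow> t \<in> I"
        using g(2) unfolding open_dist dist_real_def by blast
      have sol: "(\<gamma> has_vector_derivative Y (\<gamma> t)) (at t)" if "\<bar>t - t0\<bar> < d" for t
        using g(1) d(2)[OF that] by (simp add: regular_trajectory_def)
      have z: "(lie Y ^^ k) f (\<gamma> t0) = 0" if "k < n" for k using zero[OF that] g(3) by simp
      have n0: "n > 0" and nz: "(lie Y ^^ n) f (\<gamma> t0) \<noteq> 0" using n g(3) by auto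
      obtain e where e: "e > 0" "e \<le> d" "\<And>t. \<bar>t - t0\<bar> < e \<Longrightarrow>
          sgn (f (\<gamma> t)) = sgn ((lie Y ^^ n) f (\<gamma> t0)) * sgn (t - t0) ^ n"
      proof (rule contact_sign[where \<gamma> = \<gamma>, OF Ym fm d(1) sol z n0 nz])
        fix e assume "e > 0" "e \<le> d" "\<And>t. \<bar>t - t0\<bar> < e \<Longrightarrow>
          sgn (f (\<gamma> t)) = sgn ((lie Y ^^ n) f (\<gamma> t0)) * sgn (t - t0) ^ n"
        then show thesis by (rule that)
      qed
      have neg: "\<gamma> t \<notin> plus_side f" if "\<bar>t - t0\<bar> \<le> e / 2" for t
      proof -
        have "\<bar>t - t0\<bar> < e" using that e by simp
        then have "sgn (f (\<gamma> t)) = - (sgn (t - t0) ^ n)" using e(3)[of t] n(4) g(3) by simp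
        also have "\<dots> \<le> 0" using n(1) by (simp add: zero_le_even_power)
        finally have "sgn (f (\<gamma> t)) \<le> 0" .
        then have "\<not> f (\<gamma> t) > 0" by (auto simp: sgn_if split: if_splits)
        then show ?thesis by (simp add: plus_side_def)
      qed
      have "{t0 - e/2..t0 + e/2} \<subseteq> I" using d e by (auto simp: abs_le_iff)
      from not_through_if_arc_avoids[OF lip Yp g(1-3) _ this neg] e(1) g(4) show False by simp
    qed
    then show "\<not> trajectory_through Y (plus_side f) p \<and> \<not> trajectory_tending Y (plus_side f) p"
      using no_tending_trajectory[OF cont Yp] by blast
  next
    assume no: "\<not> trajectory_through Y (plus_side f) p \<and> \<not> trajectory_tending Y (plus_side f) p"
    obtain x d where x: "d > 0" "x 0 = p" "regular_trajectory Y x {-d<..<d}"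
      by (rule local_trajectory[OF lip cont Yp])
    have sol: "(x has_vector_derivative Y (x t)) (at t)" if "\<bar>t - 0\<bar> < d" for t
      using x(3) that by (auto simp: regular_trajectory_def abs_less_iff)
    \<comment> \<open>Without a trajectory through \<open>p\<close> in the sense of the definition, the local arc does not enter \<open>f > 0\<close> close to \<open>p\<close>.\<close>
    have avoid: "\<exists>e>0. \<forall>t. \<bar>t\<bar> < e \<longrightarrow> \<not> f (x t) > 0"
    proof (rule ccontr)
      assume *: "\<not> (\<exists>e>0. \<forall>t. \<bar>t\<bar> < e \<longrightarrow> \<not> f (x t) > 0)"
      have "p \<in> closure (x ` {-d<..<d} \<inter> plus_side f)"
        unfolding closure_approachable
      proof (intro allI impI)
        fix \<epsilon> :: real assume \<epsilon>: "\<epsilon> > 0"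
        have "isCont x 0" using sol[of 0] x(1) has_vector_derivative_continuous by auto
        then obtain s where s: "s > 0" "\<And>t. dist t 0 < s \<Longrightarrow> dist (x t) (x 0) < \<epsilon>"
          unfolding continuous_at_eps_delta using \<epsilon> by blast
        have "min s d > 0" using s x by simp
        then obtain t where t: "\<bar>t\<bar> < min s d" "f (x t) > 0" using * by blast
        show "\<exists>y\<in>x ` {-d<..<d} \<inter> plus_side f. dist y p < \<epsilon>"
          by (rule bexI[of _ "x t"]) (use t s(2)[of t] x(2) in \<open>auto simp: plus_side_def abs_less_iff\<close>)
      qed
      moreover have "0 \<in> {-d<..<d}" using x(1) by simp
      ultimately have "trajectory_through Y (plus_side f) p"
        unfolding trajectory_through_def using x(2,3) by blast
      then show False using no by blast
    qed
    have "\<exists>k. (lie Y ^^ k) f p \<noteq> 0"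
    proof (rule ccontr)
      assume "\<not> (\<exists>k. (lie Y ^^ k) f p \<noteq> 0)"
      then have z: "(lie Y ^^ k) f (x 0) = 0" for k using x(2) by simp
      obtain e where e: "e > 0" "\<And>t. \<bar>t - 0\<bar> < e \<Longrightarrow> f (x t) = 0"
      proof (rule flat_contact[where \<gamma> = x, OF Ym fm x(1) sol z])
        fix e assume "e > 0" "\<And>t. \<bar>t - 0\<bar> < e \<Longrightarrow> f (x t) = 0"
        then show thesis by (rule that)
      qed
      define D where "D t = Y p \<bullet> (x t - p)" for t
      have "isCont x 0" using sol[of 0] x(1) has_vector_derivative_continuous by auto
      moreover obtain r where r: "r > 0" "ball p r \<subseteq> T" using T(1,2) open_contains_ball by blast
      ultimately obtain s where s: "s > 0" "\<And>t. dist t 0 < s \<Longrightarrow> dist (x t) (x 0) < r"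
        unfolding continuous_at_eps_delta by blast
      have sT: "x t \<in> T" if "\<bar>t\<bar> < s" for t
        using s(2)[of t] that x(2) r(2) by (auto simp: dist_commute)
      have "((\<lambda>t. x t - p) has_vector_derivative Y p) (at 0)"
        using sol[of 0] x(1,2) by (simp add: has_vector_derivative_diff_const)
      from bounded_linear.has_vector_derivative[OF bounded_linear_inner_right this, of "Y p"]
      have "(D has_real_derivative Y p \<bullet> Y p) (at 0)"
        unfolding D_def has_real_derivative_iff_has_vector_derivative .
      then obtain r where r: "r > 0" "\<And>h. 0 < h \<Longrightarrow> h < r \<Longrightarrow> D 0 < D (0 + h)"
        using DERIV_pos_inc_right[of D "Y p \<bullet> Y p" 0] Yp by auto
      \<comment> \<open>At this time the orbit is close to \<open>p\<close> but different from it, on the curve \<open>f = 0\<close>, and \<open>lie Y f = 0\<close> there.\<close>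
      define t where "t = min (min e d) (min s r) / 2"
      have t: "0 < t" "t < e" "t < d" "t < s" "t < r" using e x s r by (auto simp: t_def)
      have "x t \<noteq> p" using r(2)[OF t(1,5)] x(2) by (auto simp: D_def)
      moreover have "x t \<in> T" using sT[of t] t by simp
      moreover have "f (x t) = 0" using e(2)[of t] t by simp
      moreover have "lie Y f (x t) = 0"
      proof -
        have "((\<lambda>t. f (x t)) has_real_derivative lie Y f (x t)) (at t)"
          by (rule lie_along_curve[where \<gamma> = x and t = t and Y = Y, OF locally_majorised_differentiable[OF fm] sol])
             (use t in simp)
        moreover have "((\<lambda>t. f (x t)) has_real_derivative 0) (at t)"
        proof (rule has_field_derivative_transform_within_open[where f = "\<lambda>_. 0" and S = "{-e<..<e}"])
          show "0 = f (x s)" if "s \<in> {-e<..<e}" for s using e(2)[of s] that by (simp add: abs_less_iff)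
        qed (use t in auto)
        ultimately show ?thesis by (rule DERIV_unique)
      qed
      ultimately show False using T(3) by blast
    qed
    define n where "n = (LEAST k. (lie Y ^^ k) f p \<noteq> 0)"
    have nz: "(lie Y ^^ n) f p \<noteq> 0" unfolding n_def by (rule LeastI_ex) fact
    have zero: "(lie Y ^^ k) f p = 0" if "k < n" for k
      using not_less_Least[OF that[unfolded n_def]] by blast
    have n2: "n \<ge> 2"
    proof (rule ccontr)
      assume "\<not> n \<ge> 2"
      then have "n = 0 \<or> n = 1" by auto
      then show False using nz fp lp by auto
    qed
    have z: "(lie Y ^^ k) f (x 0) = 0" if "k < n" for k using zero[OF that] x(2) by simp
    have n0: "n > 0" and nz': "(lie Y ^^ n) f (x 0) \<noteq> 0" using n2 nz x(2) by auto
    obtain e where e: "e > 0" "e \<le> d" "\<And>t. \<bar>t - 0\<bar> < e \<Longrightarrow>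
        sgn (f (x t)) = sgn ((lie Y ^^ n) f (x 0)) * sgn (t - 0) ^ n"
    proof (rule contact_sign[where \<gamma> = x, OF Ym fm x(1) sol z n0 nz'])
      fix e assume "e > 0" "e \<le> d" "\<And>t. \<bar>t - 0\<bar> < e \<Longrightarrow>
        sgn (f (x t)) = sgn ((lie Y ^^ n) f (x 0)) * sgn (t - 0) ^ n"
      then show thesis by (rule that)
    qed
    obtain e' where e': "e' > 0" "\<And>t. \<bar>t\<bar> < e' \<Longrightarrow> \<not> f (x t) > 0" using avoid by blast
    define t where "t = min e e' / 2"
    have t: "0 < t" "t < e" "t < e'" using e e' by (auto simp: t_def)
    have "sgn (f (x t)) = sgn ((lie Y ^^ n) f p)" using e(3)[of t] t x(2) by simp
    then have neg: "(lie Y ^^ n) f p < 0"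
      using e'(2)[of t] t nz by (auto simp: sgn_if split: if_splits)
    have "even n"
    proof (rule ccontr)
      assume "odd n"
      then have "sgn (f (x (- t))) = 1" using e(3)[of "- t"] t x(2) neg by simp
      then show False using e'(2)[of "- t"] t by (auto simp: sgn_if split: if_splits)
    qed
    then have "fold_point f Y n p"
      unfolding fold_point_def using n2 Yp nz zero by auto
    then show "\<exists>n. fold_point f Y n p \<and> (lie Y ^^ n) f p < 0" using neg by blast
  qed
qed

lemma first_order_estimate:
  fixes f :: "real^2 \<Rightarrow> real"
  assumes f: "f differentiable at p" and fp: "f p = 0" and e: "e > 0"
  obtains r where "r > 0" "\<And>x. norm (x - p) < r \<Longrightarrow> \<bar>f x - gradient f p \<bullet> (x - p)\<bar> \<le> e * norm (x - p)"
proof -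
  have "(f has_derivative (\<lambda>h. gradient f p \<bullet> h)) (at p)"
    using has_derivative_partial[OF f] by (simp add: gradient_def partial_def inner_vec2)
  then have "\<exists>r>0. \<forall>x. norm (x - p) < r \<longrightarrow> norm (f x - f p - gradient f p \<bullet> (x - p)) \<le> e * norm (x - p)"
    unfolding has_derivative_at_alt using e by blast
  then show thesis using that fp by auto
qed

text \<open>A trajectory that tends to a zero of \<open>Y\<close> inside \<open>f > 0\<close> need not have a limit direction itself, but its existence implies that of a
  characteristic orbit in \<open>f > 0\<close>. If \<open>det2 v (H v)\<close> is not identically zero the trajectory itself is characteristic, as \<open>f > 0\<close> confines
  it asymptotically to the half plane given by the gradient of \<open>f\<close>. Otherwise a sector inside \<open>f > 0\<close> contains a
  characteristic orbit, which enters \<open>p\<close> in forward or backward time according to the sign of \<open>v0 \<bullet> H v0\<close>.\<close>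

lemma characteristic_orbit_of_tending:
  fixes Y :: "real^2 \<Rightarrow> real^2" and f :: "real^2 \<Rightarrow> real"
  assumes Y: "analytic_plane Y" and f: "analytic_plane f" and Yp: "Y p = 0"
    and fp: "f p = 0" and grad: "gradient f p \<noteq> 0"
    and reg: "regular_trajectory Y \<gamma> I" and tends: "tends_to_point \<gamma> I p at_top"
    and V: "open V" "p \<in> V" "\<gamma> ` I \<inter> V \<subseteq> V \<inter> plus_side f"
  shows "has_characteristic_orbit_in Y (plus_side f) p"
proof -
  define n where "n = gradient f p"
  have fd: "f differentiable at p"
    by (rule locally_majorised_differentiable[OF analytic_plane_majorised[OF f]])
  have lim: "(\<gamma> \<longlongrightarrow> p) at_top" and inI: "\<forall>\<^sub>F t in at_top. t \<in> I"
    using tends by (auto simp: tends_to_point_def)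
  have sol: "(\<gamma> has_vector_derivative Y (\<gamma> t)) (at t)" "Y (\<gamma> t) \<noteq> 0" if "t \<in> I" for t
    using reg that by (auto simp: regular_trajectory_def)
  from Y Yp show ?thesis
  proof (cases rule: leading_form)
    case (1 r)
    have "\<forall>\<^sub>F t in at_top. dist (\<gamma> t) p < r" using lim 1(1) by (rule tendstoD)
    with inI have "\<forall>\<^sub>F t in at_top. t \<in> I \<and> \<gamma> t \<in> ball p r" by eventually_elim (simp add: dist_commute)
    then obtain t where "t \<in> I" "\<gamma> t \<in> ball p r" using eventually_happens by fastforce
    then show ?thesis using sol(2) 1(2) by blast
  next
    case (2 m c C s)
    define H where "H = form c m"
    have hom: "H (s *\<^sub>R v) = s ^ m *\<^sub>R H v" for s v by (simp add: H_def form_scaleR)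
    have est: "norm (Y (p + v) - H v) \<le> C * norm v ^ Suc m" if "norm v \<le> s" for v
      using 2(4)[OF that] by (simp add: H_def)
    show ?thesis
    proof (cases "\<forall>U. open U \<and> U \<noteq> {} \<longrightarrow> (\<exists>v\<in>U. det2 v (H v) \<noteq> 0)")
      case True
      have "\<exists>u. ((\<lambda>t. (\<gamma> t - p) /\<^sub>R norm (\<gamma> t - p)) \<longlongrightarrow> u) at_top"
      proof (rule direction_converges[OF hom 2(2) est])
        show "\<exists>v\<in>U. det2 v (H v) \<noteq> 0" if "open U" "U \<noteq> {}" for U using True that by blast
        show "\<forall>\<^sub>F t in at_top. (\<gamma> has_vector_derivative Y (\<gamma> t)) (at t) \<and> \<gamma> t \<noteq> p"
          using inI by eventually_elim (use sol Yp in metis)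
        show "(\<gamma> \<longlongrightarrow> p) at_top" by (rule lim)
        show "n \<noteq> 0" using grad by (simp add: n_def)
        fix \<epsilon> :: real assume \<epsilon>: "\<epsilon> > 0"
        obtain r where r: "r > 0" "\<And>x. norm (x - p) < r \<Longrightarrow> \<bar>f x - gradient f p \<bullet> (x - p)\<bar> \<le> \<epsilon> * norm (x - p)"
          by (rule first_order_estimate[OF fd fp \<epsilon>]) (use that in blast)+ 
        have "\<forall>\<^sub>F t in at_top. dist (\<gamma> t) p < r" using lim r(1) by (rule tendstoD)
        moreover have "\<forall>\<^sub>F t in at_top. \<gamma> t \<in> V" using lim V(1,2) by (rule topological_tendstoD)
        ultimately show "\<forall>\<^sub>F t in at_top. n \<bullet> (\<gamma> t - p) \<ge> - \<epsilon> * norm (\<gamma> t - p)"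
          using inI
        proof eventually_elim
          case (elim t)
          then have "\<gamma> t \<in> plus_side f" using V(3) by blast
          then have "f (\<gamma> t) > 0" by (simp add: plus_side_def)
          then show ?case using r(2)[of "\<gamma> t"] elim(1) by (simp add: n_def dist_norm abs_le_iff)
        qed
      qed
      then have "characteristic_orbit Y p \<gamma> I"
        unfolding characteristic_orbit_def using reg tends by blast
      then show ?thesis unfolding has_characteristic_orbit_in_def using V by blast
    next
      case False
      then obtain U where U: "open U" "U \<noteq> {}" "\<And>v. v \<in> U \<Longrightarrow> det2 v (H v) = 0" by blast
      have radial: "det2 v (H v) = 0" for v
        unfolding H_def by (rule det2_form_vanishing[OF U(1,2)]) (use U(3) in \<open>simp add: H_def\<close>)
      have "open {v. n \<bullet> v > 0}" by (intro open_Collect_less continuous_intros)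
      moreover have "n \<in> {v. n \<bullet> v > 0}" using grad by (simp add: n_def)
      then have "{v. n \<bullet> v > 0} \<noteq> {}" by blast
      ultimately have "\<exists>v\<in>{v. n \<bullet> v > 0}. form c m v \<noteq> 0" by (rule 2(5))
      then obtain v where v: "n \<bullet> v > 0" "H v \<noteq> 0" by (auto simp: H_def)
      have vnz: "v \<noteq> 0" using v(1) by auto
      \<comment> \<open>A direction inside the half plane in which the leading form is a nonzero radial vector.\<close>
      define v0 where "v0 = v /\<^sub>R norm v"
      have v0: "norm v0 = 1" "n \<bullet> v0 > 0" using vnz v(1) by (simp_all add: v0_def)
      have "H v0 \<noteq> 0" using hom[of "inverse (norm v)" v] vnz v(2) by (simp add: v0_def)
      then have nz: "v0 \<bullet> H v0 \<noteq> 0"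
        using lagrange_identity[of v0 "H v0"] radial[of v0] v0(1) by auto
      have orbit: "has_characteristic_orbit_in Z (plus_side f) p"
        if Z: "analytic_plane Z" "Z p = 0" and G: "\<And>s v. G (s *\<^sub>R v) = s ^ m *\<^sub>R G v" "continuous_on UNIV G"
          "\<And>v. norm v \<le> s \<Longrightarrow> norm (Z (p + v) - G v) \<le> C * norm v ^ Suc m" "\<And>v. det2 v (G v) = 0"
          "v0 \<bullet> G v0 < 0" for Z G
      proof -
        have lip: "locally_lipschitz Z"
          by (rule locally_lipschitz_majorised[OF analytic_plane_majorised[OF analytic_plane_component[OF Z(1)]]])
        obtain x u \<nu> where x: "solves Z x {0..}" "\<And>t. t \<ge> 0 \<Longrightarrow> Z (x t) \<noteq> 0" "(x \<longlongrightarrow> p) at_top"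
            "((\<lambda>t. (x t - p) /\<^sub>R norm (x t - p)) \<longlongrightarrow> u) at_top"
            "\<nu> > 0" "\<And>t. t \<ge> 0 \<Longrightarrow> n \<bullet> (x t - p) \<ge> \<nu> * norm (x t - p)" "\<And>t. t \<ge> 0 \<Longrightarrow> x t \<noteq> p"
        proof (rule entering_sector_orbit[OF lip Z(2) G(1,2) 2(1,3,2) G(3,4) v0(1) G(5) v0(2)])
          fix x u \<nu> assume "solves Z x {0..}" "\<And>t. t \<ge> 0 \<Longrightarrow> Z (x t) \<noteq> 0" "(x \<longlongrightarrow> p) at_top"
            "((\<lambda>t. (x t - p) /\<^sub>R norm (x t - p)) \<longlongrightarrow> u) at_top"
            "\<nu> > 0" "\<And>t. t \<ge> 0 \<Longrightarrow> n \<bullet> (x t - p) \<ge> \<nu> * norm (x t - p)" "\<And>t. t \<ge> 0 \<Longrightarrow> x t \<noteq> p"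
          then show thesis by (rule that)
        qed
        have "regular_trajectory Z x {0<..}"
          unfolding regular_trajectory_def
        proof (intro conjI ballI)
          show "is_interval {0::real<..}" by (rule is_interval_oi)
          show "(x has_vector_derivative Z (x t)) (at t)" if "t \<in> {0<..}" for t
            by (rule solves_at[OF x(1), of "{0<..}"]) (use that in auto)
          show "Z (x t) \<noteq> 0" if "t \<in> {0<..}" for t using x(2)[of t] that by simp
        qed simp
        moreover have "tends_to_point x {0<..} p at_top"
          unfolding tends_to_point_def using x(3) eventually_gt_at_top[of "0::real"] by simp
        ultimately have co: "characteristic_orbit Z p x {0<..}"
          unfolding characteristic_orbit_def using x(4) by blast
        have \<nu>2: "\<nu> / 2 > 0" using x(5) by simp
        obtain r where r: "r > 0" "\<And>x. norm (x - p) < r \<Longrightarrow> \<bar>f x - gradient f p \<bullet> (x - p)\<bar> \<le> \<nu> / 2 * norm (x - p)"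
          by (rule first_order_estimate[OF fd fp \<nu>2]) (use that in blast)+
        have "x ` {0<..} \<inter> ball p r \<subseteq> ball p r \<inter> plus_side f"
        proof
          fix q assume "q \<in> x ` {0<..} \<inter> ball p r"
          then obtain t where t: "t > 0" "q = x t" "norm (q - p) < r" "q \<in> ball p r"
            by (auto simp: dist_norm norm_minus_commute)
          have "\<nu> / 2 * norm (q - p) > 0" using x(7)[of t] t \<nu>2 by simp
          moreover have "f q \<ge> n \<bullet> (q - p) - \<nu> / 2 * norm (q - p)"
            using abs_le_D2[OF r(2)[OF t(3)]] unfolding n_def by linarith
          moreover have "n \<bullet> (q - p) \<ge> \<nu> * norm (q - p)" using x(6)[of t] t by simp
          ultimately have "f q > 0" by linarith
          then show "q \<in> ball p r \<inter> plus_side f" using t by (simp add: plus_side_def)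
        qed
        moreover have "open (ball p r)" "p \<in> ball p r" using r(1) by simp_all
        ultimately show ?thesis unfolding has_characteristic_orbit_in_def
          by (intro exI[of _ x] exI[of _ "{0<..}"] exI[of _ "ball p r"] conjI co)
      qed
      show ?thesis
      proof (cases "v0 \<bullet> H v0 < 0")
        case True
        show ?thesis
        proof (rule orbit[where Z = Y and G = H, OF Y Yp hom _ est radial True])
          show "continuous_on UNIV H" unfolding H_def by (rule continuous_on_form)
        qed
      next
        case False
        then have pos: "v0 \<bullet> (- H v0) < 0" using nz by simp
        have "has_characteristic_orbit_in (\<lambda>x. - Y x) (plus_side f) p"
        proof (rule orbit[where Z = "\<lambda>x. - Y x" and G = "\<lambda>v. - H v", OF analytic_plane_minus[OF Y]])
          show "- Y p = 0" using Yp by simp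
          show "- H (a *\<^sub>R v) = a ^ m *\<^sub>R - H v" for a v using hom[of a v] by simp
          show "continuous_on UNIV (\<lambda>v. - H v)" unfolding H_def by (intro continuous_intros)
          show "norm (- Y (p + v) - - H v) \<le> C * norm v ^ Suc m" if "norm v \<le> s" for v
            using est[OF that] by (simp add: norm_minus_commute)
          show "det2 v (- H v) = 0" for v using radial[of v] by (simp add: det2_def)
          show "v0 \<bullet> (- H v0) < 0" by (rule pos)
        qed
        then show ?thesis by (rule has_characteristic_orbit_in_reverse)
      qed
    qed
  qed
qed

lemma no_orbit_iff_no_characteristic:
  fixes Y :: "real^2 \<Rightarrow> real^2" and f :: "real^2 \<Rightarrow> real"
  assumes Y: "analytic_plane Y" and f: "analytic_plane f" and Yp: "Y p = 0"
    and fp: "f p = 0" and grad: "gradient f p \<noteq> 0"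
  shows "\<not> trajectory_through Y (plus_side f) p \<and> \<not> trajectory_tending Y (plus_side f) p \<longleftrightarrow>
    \<not> has_characteristic_orbit_in Y (plus_side f) p"
proof -
  have "\<not> trajectory_through Y (plus_side f) p"
    using Yp unfolding trajectory_through_def regular_trajectory_def by blast
  moreover have "has_characteristic_orbit_in Y (plus_side f) p" if tend: "trajectory_tending Y (plus_side f) p"
  proof -
    obtain \<gamma> I V where g: "regular_trajectory Y \<gamma> I"
        "tends_to_point \<gamma> I p at_top \<or> tends_to_point \<gamma> I p at_bot"
        "open V" "p \<in> V" "\<gamma> ` I \<inter> V \<subseteq> V \<inter> plus_side f"
      using tend unfolding trajectory_tending_def by blast
    from g(2) show ?thesis
    proof
      assume "tends_to_point \<gamma> I p at_top"
      then show ?thesis by (rule characteristic_orbit_of_tending[OF Y f Yp fp grad g(1) _ g(3-5)])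
    next
      assume b: "tends_to_point \<gamma> I p at_bot"
      have "has_characteristic_orbit_in (\<lambda>x. - Y x) (plus_side f) p"
      proof (rule characteristic_orbit_of_tending[OF analytic_plane_minus[OF Y] f _ fp grad _ _ g(3,4)])
        show "regular_trajectory (\<lambda>x. - Y x) (\<lambda>t. \<gamma> (- t)) (uminus ` I)"
          using regular_trajectory_reverse[of "\<lambda>x. - Y x"] g(1) by simp
        show "tends_to_point (\<lambda>t. \<gamma> (- t)) (uminus ` I) p at_top"
          using b by (simp add: tends_to_point_reverse)
        show "(\<lambda>t. \<gamma> (- t)) ` uminus ` I \<inter> V \<subseteq> V \<inter> plus_side f"
          using g(5) by (simp add: image_image)
      qed (use Yp in simp)
      then show ?thesis by (rule has_characteristic_orbit_in_reverse)
    qed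
  qed
  moreover have "trajectory_tending Y (plus_side f) p" if ch: "has_characteristic_orbit_in Y (plus_side f) p"
  proof -
    obtain \<gamma> I V where co: "characteristic_orbit Y p \<gamma> I" "open V" "p \<in> V" "\<gamma> ` I \<inter> V \<subseteq> V \<inter> plus_side f"
      using ch unfolding has_characteristic_orbit_in_def by blast
    have "regular_trajectory Y \<gamma> I" using co(1) by (simp add: characteristic_orbit_def)
    moreover have "tends_to_point \<gamma> I p at_top \<or> tends_to_point \<gamma> I p at_bot"
      using co(1) by (auto simp: characteristic_orbit_def)
    ultimately have "regular_trajectory Y \<gamma> I \<and>
        (tends_to_point \<gamma> I p at_top \<or> tends_to_point \<gamma> I p at_bot) \<and>
        open V \<and> p \<in> V \<and> \<gamma> ` I \<inter> V \<subseteq> V \<inter> plus_side f"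
      using co(2-4) by simp
    then show ?thesis unfolding trajectory_tending_def by (intro exI)
  qed
  ultimately show ?thesis by blast
qed

lemma lie_minus:
  assumes "g differentiable at x"
  shows "lie Y (\<lambda>x. - g x) x = - lie Y g x"
proof -
  have "((\<lambda>x. - g x) has_derivative (\<lambda>h. (- partial 1 g x) * h $ 1 + (- partial 2 g x) * h $ 2)) (at x)"
    using has_derivative_minus[OF has_derivative_partial[OF assms]] by simp
  from partial_eqI[OF this] show ?thesis by (simp add: lie_partial)
qed

lemma iterate_lie_minus:
  assumes "\<And>i::2. locally_majorised (\<lambda>x. Y x $ i)" "locally_majorised g"
  shows "(lie Y ^^ n) (\<lambda>x. - g x) = (\<lambda>x. - (lie Y ^^ n) g x)"
proof (induction n)
  case (Suc n)
  have "lie Y (\<lambda>x. - (lie Y ^^ n) g x) x = - lie Y ((lie Y ^^ n) g) x" for x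
    by (rule lie_minus[OF locally_majorised_differentiable[OF locally_majorised_iterate_lie[OF assms]]])
  then show ?case using Suc by auto
qed simp

theorem theorem5:
  fixes f :: "real^2 \<Rightarrow> real"
    and Xp Xm :: "real^2 \<Rightarrow> real^2"
    and p :: "real^2"
  assumes "analytic_plane f" and "regular_value f 0"
    and "analytic_plane Xp" and "analytic_plane Xm"
    and "sigma_singular f Xp Xm p"
    and "lie Xp f p = 0" and "lie Xm f p = 0"
    and "\<exists>V. openin (top_of_set (switching_curve f)) V \<and> p \<in> V \<and>
           (\<forall>q\<in>V - {p}. lie Xp f q * lie Xm f q > 0)"
  shows
    "(Xp p \<noteq> 0 \<and> Xm p \<noteq> 0 \<longrightarrow>
        (sigma_monodromic f Xp Xm p \<longleftrightarrow>
           (\<exists>n. fold_point f Xp n p \<and> (lie Xp ^^ n) f p < 0) \<and>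
           (\<exists>n. fold_point f Xm n p \<and> (lie Xm ^^ n) f p > 0))) \<and>
     (Xp p = 0 \<and> Xm p \<noteq> 0 \<longrightarrow>
        (sigma_monodromic f Xp Xm p \<longleftrightarrow>
           \<not> has_characteristic_orbit_in Xp (plus_side f) p \<and>
           (\<exists>n. fold_point f Xm n p \<and> (lie Xm ^^ n) f p > 0))) \<and>
     (Xm p = 0 \<and> Xp p \<noteq> 0 \<longrightarrow>
        (sigma_monodromic f Xp Xm p \<longleftrightarrow>
           \<not> has_characteristic_orbit_in Xm (minus_side f) p \<and>
           (\<exists>n. fold_point f Xp n p \<and> (lie Xp ^^ n) f p < 0))) \<and>
     (Xp p = 0 \<and> Xm p = 0 \<longrightarrow>
        (sigma_monodromic f Xp Xm p \<longleftrightarrow>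
           \<not> has_characteristic_orbit_in Xp (plus_side f) p \<and>
           \<not> has_characteristic_orbit_in Xm (minus_side f) p))"
proof -
  \<comment> \<open>The side \<open>f < 0\<close> is treated as the positive side of \<open>f'\<close>. Passing to \<open>f'\<close> changes the sign of all iterated Lie derivatives, hence the sign in the
    criterion for \<open>Xm\<close>, and it keeps the order of a fold.\<close>
  define f' where "f' = (\<lambda>x. - f x)"
  have f': "analytic_plane f'" unfolding f'_def by (rule analytic_plane_minus[OF assms(1)])
  have fm: "locally_majorised f" by (rule analytic_plane_majorised[OF assms(1)])
  have Xmm: "\<And>i. locally_majorised (\<lambda>x. Xm x $ i)"
    by (rule analytic_plane_majorised[OF analytic_plane_component[OF assms(4)]])
  have fp: "f p = 0" using assms(5) by (simp add: sigma_singular_def switching_curve_def)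
  have grad: "gradient f p \<noteq> 0" using assms(2) fp by (simp add: regular_value_def)
  have minus: "minus_side f = plus_side f'" by (simp add: minus_side_def plus_side_def f'_def)
  have lie': "lie Y f' q = - lie Y f q" for Y q
    unfolding f'_def by (rule lie_minus[OF locally_majorised_differentiable[OF fm]])
  have grad': "gradient f' p \<noteq> 0"
  proof -
    have "gradient f' p \<bullet> gradient f p = - (gradient f p \<bullet> gradient f p)"
      using lie'[of "\<lambda>_. gradient f p" p] by (simp add: lie_def)
    then show ?thesis using grad by auto
  qed
  have iter: "(lie Xm ^^ n) f' q = - (lie Xm ^^ n) f q" for n q
    unfolding f'_def iterate_lie_minus[OF Xmm fm] ..
  have fold': "fold_point f' Xm n p \<longleftrightarrow> fold_point f Xm n p" for n
    by (simp add: fold_point_def iter)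
  \<comment> \<open>Near \<open>p\<close> all other points of the switching curve are sewing points, so \<open>p\<close> is isolated among the singular points.\<close>
  obtain V where V: "openin (top_of_set (switching_curve f)) V" "p \<in> V"
      "\<And>q. q \<in> V \<Longrightarrow> q \<noteq> p \<Longrightarrow> lie Xp f q * lie Xm f q > 0"
    using assms(8) by blast
  then obtain T where T: "open T" "V = switching_curve f \<inter> T" unfolding openin_open by blast
  have pT: "p \<in> T" using V T by blast
  have sew: "lie Xp f q * lie Xm f q > 0" if "q \<in> T" "f q = 0" "q \<noteq> p" for q
    by (rule V(3)) (use that T in \<open>auto simp: switching_curve_def\<close>)
  have iso: "p isolated_in {q. sigma_singular f Xp Xm q}"
    unfolding isolated_in_def
  proof (intro conjI exI[of _ T])
    show "T \<inter> {q. sigma_singular f Xp Xm q} = {p}"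
    proof
      show "T \<inter> {q. sigma_singular f Xp Xm q} \<subseteq> {p}"
      proof
        fix q assume q: "q \<in> T \<inter> {q. sigma_singular f Xp Xm q}"
        then have "f q = 0" "q \<notin> sewing_arc f Xp Xm"
          by (auto simp: sigma_singular_def sigma_regular_def switching_curve_def)
        then show "q \<in> {p}" using sew[of q] q by (auto simp: sewing_arc_def switching_curve_def)
      qed
    qed (use pT assms(5) in auto)
  qed (use T assms(5) in auto)
  have c3: "\<not> (\<forall>V. open V \<and> p \<in> V \<longrightarrow> (\<exists>q \<in> V \<inter> switching_curve f. lie Xp f q * lie Xm f q < 0))"
  proof
    assume "\<forall>V. open V \<and> p \<in> V \<longrightarrow> (\<exists>q \<in> V \<inter> switching_curve f. lie Xp f q * lie Xm f q < 0)"
    then obtain q where q: "q \<in> T" "f q = 0" "lie Xp f q * lie Xm f q < 0"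
      using T(1) pT by (auto simp: switching_curve_def)
    then show False using sew[of q] assms(6) by (cases "q = p") auto
  qed
  have mono: "sigma_monodromic f Xp Xm p \<longleftrightarrow>
      (\<not> trajectory_through Xp (plus_side f) p \<and> \<not> trajectory_tending Xp (plus_side f) p) \<and>
      (\<not> trajectory_through Xm (plus_side f') p \<and> \<not> trajectory_tending Xm (plus_side f') p)"
    unfolding sigma_monodromic_def has_sigma_characteristic_orbit_def minus using iso c3 by blast
  have p1: "\<not> trajectory_through Xp (plus_side f) p \<and> \<not> trajectory_tending Xp (plus_side f) p \<longleftrightarrow>
      (\<exists>n. fold_point f Xp n p \<and> (lie Xp ^^ n) f p < 0)" if "Xp p \<noteq> 0"
    by (rule no_orbit_iff_fold[OF assms(3,1) that fp assms(6) T(1) pT]) (use sew in force)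
  have p0: "\<not> trajectory_through Xp (plus_side f) p \<and> \<not> trajectory_tending Xp (plus_side f) p \<longleftrightarrow>
      \<not> has_characteristic_orbit_in Xp (plus_side f) p" if "Xp p = 0"
    by (rule no_orbit_iff_no_characteristic[OF assms(3,1) that fp grad])
  have m1: "\<not> trajectory_through Xm (plus_side f') p \<and> \<not> trajectory_tending Xm (plus_side f') p \<longleftrightarrow>
      (\<exists>n. fold_point f Xm n p \<and> (lie Xm ^^ n) f p > 0)" if "Xm p \<noteq> 0"
  proof -
    have "\<not> trajectory_through Xm (plus_side f') p \<and> \<not> trajectory_tending Xm (plus_side f') p \<longleftrightarrow>
        (\<exists>n. fold_point f' Xm n p \<and> (lie Xm ^^ n) f' p < 0)"
    proof (rule no_orbit_iff_fold[OF assms(4) f' that _ _ T(1) pT])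
      show "lie Xm f' q \<noteq> 0" if "q \<in> T" "f' q = 0" "q \<noteq> p" for q
      proof -
        have "f q = 0" using that(2) by (simp add: f'_def)
        then show ?thesis using sew[OF that(1) _ that(3)] by (auto simp: lie')
      qed
    qed (simp_all add: lie' assms(7), simp add: f'_def fp)
    then show ?thesis by (simp add: fold' iter)
  qed
  have m0: "\<not> trajectory_through Xm (plus_side f') p \<and> \<not> trajectory_tending Xm (plus_side f') p \<longleftrightarrow>
      \<not> has_characteristic_orbit_in Xm (minus_side f) p" if "Xm p = 0"
    unfolding minus by (rule no_orbit_iff_no_characteristic[OF assms(4) f' that _ grad']) (simp add: f'_def fp)
  show ?thesis
  proof (intro conjI impI)
    assume "Xp p \<noteq> 0 \<and> Xm p \<noteq> 0"
    then have "Xp p \<noteq> 0" "Xm p \<noteq> 0" by auto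
    show "sigma_monodromic f Xp Xm p \<longleftrightarrow>
           (\<exists>n. fold_point f Xp n p \<and> (lie Xp ^^ n) f p < 0) \<and>
           (\<exists>n. fold_point f Xm n p \<and> (lie Xm ^^ n) f p > 0)"
      unfolding mono p1[OF \<open>Xp p \<noteq> 0\<close>] m1[OF \<open>Xm p \<noteq> 0\<close>] by (rule refl)
  next
    assume "Xp p = 0 \<and> Xm p \<noteq> 0"
    then have "Xp p = 0" "Xm p \<noteq> 0" by auto
    show "sigma_monodromic f Xp Xm p \<longleftrightarrow> \<not> has_characteristic_orbit_in Xp (plus_side f) p \<and>
           (\<exists>n. fold_point f Xm n p \<and> (lie Xm ^^ n) f p > 0)"
      unfolding mono p0[OF \<open>Xp p = 0\<close>] m1[OF \<open>Xm p \<noteq> 0\<close>] by (rule refl)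
  next
    assume "Xm p = 0 \<and> Xp p \<noteq> 0"
    then have "Xm p = 0" "Xp p \<noteq> 0" by auto
    show "sigma_monodromic f Xp Xm p \<longleftrightarrow> \<not> has_characteristic_orbit_in Xm (minus_side f) p \<and>
           (\<exists>n. fold_point f Xp n p \<and> (lie Xp ^^ n) f p < 0)"
      unfolding mono p1[OF \<open>Xp p \<noteq> 0\<close>] m0[OF \<open>Xm p = 0\<close>] by (rule conj_commute)
  next
    assume "Xp p = 0 \<and> Xm p = 0"
    then have "Xp p = 0" "Xm p = 0" by auto
    show "sigma_monodromic f Xp Xm p \<longleftrightarrow> \<not> has_characteristic_orbit_in Xp (plus_side f) p \<and>
           \<not> has_characteristic_orbit_in Xm (minus_side f) p"
      unfolding mono p0[OF \<open>Xp p = 0\<close>] m0[OF \<open>Xm p = 0\<close>] by (rule refl)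
  qed
qed

end
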